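(* Let $k$ be a positive integer and $\varepsilon$ a positive real number. Let $S$ be a finite, non-empty set of prime numbers. Then $$[F_j^{(k)}]_S < (F_j^{(k)})^{\varepsilon}$$ for every sufficiently large integer $j$.
   Context: The Fibonacci sequence $(F_n)_{n\ge 0}$ is defined by $F_0=0$, $F_1=1$, $F_{n+2}=F_{n+1}+F_n$. Every positive integer $N$ has a unique Zeckendorf representation $N=\varepsilon_\ell F_\ell+\cdots+\varepsilon_2F_2+\varepsilon_1F_1$ with $\varepsilon_\ell=1$, $\varepsilon_j\in\{0,1\}$ and $\varepsilon_j\varepsilon_{j+1}=0$ for $j=1,\dots,\ell-1$; the number of digits of $N$ in its Zeckendorf representation is the number of indices $j$ with $\varepsilon_j=1$. For an integer $k\ge1$, $(F_j^{(k)})_{j\ge1}$ denotes the sequence, arranged in increasing order, of all positive integers having at most $k$ digits in their Zeckendorf representation, i.e. all integers $F_{n_h}+\cdots+F_{n_1}$ with $n_h\ge n_{h-1}+2\ge\cdots\ge n_1+2h-2$, $n_1\ge1$, $1\le h\le k$. For a finite set $S=\{q_1,\dots,q_s\}$ of primes and a positive integer $n=Aq_1^{r_1}\cdots q_s^{r_s}$ with $r_i\ge0$ and $A$ coprime to $q_1\cdots q_s$, the $S$-part of $n$ is $[n]_S:=q_1^{r_1}\cdots q_s^{r_s}$. *)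

theory Defs
  imports
    Complex_Main
    "HOL-Library.Infinite_Set"
    "HOL-Computational_Algebra.Primes"
    "HOL-Number_Theory.Fib"
begin

text \<open>
  A representation \<open>N = \<epsilon>\<^sub>\<ell> F\<^sub>\<ell> + \<dots> + \<epsilon>\<^sub>1 F\<^sub>1\<close> is encoded by the set
  \<open>I = {j. \<epsilon>\<^sub>j = 1}\<close> of its indices, so that its number of digits is \<open>card I\<close>.
  The least admissible index is 1, hence (as \<open>F\<^sub>1 = F\<^sub>2\<close>) \<open>I\<close> is not determined
  by \<open>N\<close>, and ``at most \<open>k\<close> digits'' is read as: some representation has at most \<open>k\<close> digits.
\<close>

definition zeckendorf_rep :: "nat set \<Rightarrow> nat \<Rightarrow> bool" where
  "zeckendorf_rep I N \<longleftrightarrow>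
     finite I \<and> (\<forall>j\<in>I. 1 \<le> j) \<and> (\<forall>j\<in>I. Suc j \<notin> I) \<and> N = (\<Sum>j\<in>I. fib j)"

definition few_digits :: "nat \<Rightarrow> nat set" where
  "few_digits k = {N. 0 < N \<and> (\<exists>I. zeckendorf_rep I N \<and> card I \<le> k)}"

lemma infinite_few_digits:
  assumes "1 \<le> k"
  shows "infinite (few_digits k)"
proof -
  have "fib (n + 2) \<in> few_digits k" for n
  proof -
    have "zeckendorf_rep {n + 2} (fib (n + 2))"
      by (simp add: zeckendorf_rep_def)
    moreover have "card {n + 2} \<le> k"
      using assms by simp
    moreover have "0 < fib (n + 2)"
      by (rule fib_neq_0_nat) simp
    ultimately show ?thesis
      unfolding few_digits_def by blast
  qed
  moreover have "strict_mono (\<lambda>n. fib (n + 2))"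
    by (rule strict_mono_Suc_iff[THEN iffD2]) (simp add: fib_neq_0_nat)
  ultimately show ?thesis
    by (metis (no_types, lifting) finite_subset image_subsetI range_inj_infinite
        strict_mono_imp_inj_on)
qed

text \<open>
  \<open>zeckendorf_seq k j\<close> is \<open>F\<^sub>j\<^sup>(\<^sup>k\<^sup>)\<close>, indexed from \<open>j = 1\<close>, whereas \<^const>\<open>enumerate\<close> counts
  from 0. The value at \<open>j = 0\<close> carries no meaning.
\<close>

definition zeckendorf_seq :: "nat \<Rightarrow> nat \<Rightarrow> nat" where
  "zeckendorf_seq k j = enumerate (few_digits k) (j - 1)"

definition S_part :: "nat set \<Rightarrow> nat \<Rightarrow> nat" where
  "S_part S n = (\<Prod>q\<in>S. q ^ multiplicity q n)"

lemma S_part_eq: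
  assumes "finite S" "\<And>q. q \<in> S \<Longrightarrow> prime q" "0 < n"
    and n: "n = A * (\<Prod>q\<in>S. q ^ r q)" and cop: "coprime A (\<Prod>S)"
  shows "S_part S n = (\<Prod>q\<in>S. q ^ r q)"
proof -
  have "multiplicity q n = r q" if q: "q \<in> S" for q
  proof (rule multiplicity_eqI)
    have split: "(\<Prod>p\<in>S. p ^ r p) = q ^ r q * (\<Prod>p\<in>S - {q}. p ^ r p)"
      using assms(1) q by (simp add: prod.remove)
    show "q ^ r q dvd n"
      unfolding n split by simp
    show "\<not> q ^ Suc (r q) dvd n"
    proof
      assume "q ^ Suc (r q) dvd n"
      then have "q ^ r q * q dvd q ^ r q * (A * (\<Prod>p\<in>S - {q}. p ^ r p))"
        unfolding n split by (simp add: ac_simps)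
      then have "q dvd A * (\<Prod>p\<in>S - {q}. p ^ r p)"
        using assms(2)[OF q] by (simp add: prime_gt_0_nat)
      moreover have "coprime q A"
        using cop assms(1) q by (meson coprime_commute coprime_divisors dvd_prodI dvd_refl)
      moreover have "coprime q (\<Prod>p\<in>S - {q}. p ^ r p)"
        using assms(2) q by (intro prod_coprime_right coprime_power_right_iff[THEN iffD2] disjI1)
          (auto intro: primes_coprime)
      ultimately show False
        using assms(2)[OF q] by (metis coprime_dvd_mult_right_iff coprime_self not_prime_unit
            coprime_absorb_left)
    qed
  qed
  then show ?thesis
    unfolding S_part_def by (intro prod.cong) auto
qed

end

theory Submission
  imports Defs "HOL-Analysis.Kronecker_Approximation_Theorem" "HOL-Library.Poly_Mapping" "Jordan_Normal_Form.Determinant"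
begin

text \<open>
  If the claim fails, then for some prime \<open>q \<in> S\<close> there are infinitely many sums of \<open>k\<close> Fibonacci numbers
  divisible by a power \<open>q\<^sup>R\<close> with \<open>R\<close> proportional to the largest index \<open>n\<close>. By Binet's formula such a sum is
  the value of a fixed type of Laurent polynomial at a point \<open>(\<phi>\<^bsup>v\<^sub>j\<^esup>)\<^sub>j\<close> with coefficients of size
  \<open>exp (o(n))\<close>. After passing to a subsequence, \<open>v\<^sub>j = n \<omega>\<^sub>j + O(1)\<close> for numbers \<open>\<omega>\<^sub>j\<close> that are linearly
  independent over the integers.

  Many such solutions with rapidly growing \<open>n\<close> are combined as in the proof of Roth's theorem. Siegel's lemma
  gives a combination of products of powers of the individual polynomials, one block of variables per
  solution, that is nonzero, that has only monomials whose values at the point are of nearly equal size in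
  both embeddings, and that vanishes \<open>q\<close>-adically to high order. By a zero estimate of Roth's type some
  derivative of low order does not vanish at the point. Its norm is an integer that is divisible by too
  high a power of \<open>q\<close>.
\<close>

subsection \<open>Determinants of families indexed by naturals\<close>

text \<open>The gain is linear against a square root. In a block of parameter n the degrees are
  about E / n, for one large E, so the weight of a monomial (the exponent w of its value
  \<open>gphi\<close> powr w) varies by O(E) per block. In the second embedding that value has
  absolute value \<open>gphi\<close> powr (- w). If all weights lie within \<kappa> of one centre,
  the centre therefore cancels in the norm, and only \<open>gphi\<close> powr (2 * \<kappa>)
  remains. With 2 m blocks, Chebyshev's inequality lets \<kappa> be of order sqrt m * E, while the
  exponent of q that is forced is of order m * E. A large m gives the contradiction.

  The obstacle is nonvanishing. Inside a block all coordinates of the point are powers of one unit,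
  so relations among them abound. Independence of the \<omega> makes low relations impossible, which
  gives the estimate for one block; rapid growth of n makes the degrees of successive blocks so
  unequal that one block can be eliminated against the others cheaply. Derivatives are always taken
  as operators that multiply a monomial by a polynomial in its exponents, so they do not disturb the
  sizes of monomials.\<close>

definition dt :: "nat \<Rightarrow> (nat \<Rightarrow> nat \<Rightarrow> 'a) \<Rightarrow> 'a::comm_ring_1" where
  "dt l f = det (mat l l (\<lambda>(i, j). f i j))"

lemma dt_cong: "(\<And>i j. i < l \<Longrightarrow> j < l \<Longrightarrow> f i j = g i j) \<Longrightarrow> dt l f = dt l g"
  unfolding dt_def by (rule arg_cong[where f = det]) (auto intro!: eq_matI)

lemma dt_eq_sum:
  "dt l f = (\<Sum>p\<in>{p. p permutes {0..<l}}. signof p * (\<Prod>i<l. f i (p i)))"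
proof -
  have "(\<Prod>i = 0..<l. mat l l (\<lambda>(i, j). f i j) $$ (i, p i)) = (\<Prod>i<l. f i (p i))"
    if "p permutes {0..<l}" for p
    using permutes_in_image[OF that] by (intro prod.cong) (auto simp: atLeast0LessThan)
  then show ?thesis
    unfolding dt_def by (subst det_def'[of _ l]) (auto intro!: sum.cong)
qed

lemma dt_mult: "dt l f * dt l g = dt l (\<lambda>i j. \<Sum>k<l. f i k * g k j)"
  unfolding dt_def
  by (subst det_mult[symmetric, of _ l])
     (auto intro!: arg_cong[where f = det] eq_matI simp: scalar_prod_def atLeast0LessThan)

lemma dt_eq_0_iff:
  fixes f :: "nat \<Rightarrow> nat \<Rightarrow> 'a::idom"
  shows "dt l f = 0 \<longleftrightarrow> (\<exists>v. (\<exists>i<l. v i \<noteq> 0) \<and> (\<forall>i<l. (\<Sum>j<l. f i j * v j) = 0))"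
    (is "_ \<longleftrightarrow> ?R")
proof -
  let ?A = "mat l l (\<lambda>(i, j). f i j)"
  have *: "dt l f = 0 \<longleftrightarrow> (\<exists>v. v \<in> carrier_vec l \<and> v \<noteq> 0\<^sub>v l \<and> ?A *\<^sub>v v = 0\<^sub>v l)"
    unfolding dt_def by (rule det_0_iff_vec_prod_zero) auto
  show ?thesis
  proof
    assume "dt l f = 0"
    then obtain v where v: "v \<in> carrier_vec l" "v \<noteq> 0\<^sub>v l" "?A *\<^sub>v v = 0\<^sub>v l"
      using * by blast
    have "\<exists>i<l. v $ i \<noteq> 0" using v(1,2) by (auto intro!: eq_vecI)
    moreover have "(\<Sum>j<l. f i j * v $ j) = 0" if "i < l" for i
      using arg_cong[OF v(3), of "\<lambda>x. x $ i"] that v(1)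
      by (auto simp: scalar_prod_def atLeast0LessThan)
    ultimately show ?R by (intro exI[of _ "\<lambda>i. v $ i"]) auto
  next
    assume ?R
    then obtain v i where v: "i < l" "v i \<noteq> 0" "\<And>i. i < l \<Longrightarrow> (\<Sum>j<l. f i j * v j) = 0" by blast
    have "vec l v \<noteq> 0\<^sub>v l" using v(1,2) by (metis index_vec index_zero_vec(1))
    moreover have "?A *\<^sub>v vec l v = 0\<^sub>v l"
      using v(3) by (intro eq_vecI) (auto simp: scalar_prod_def atLeast0LessThan)
    ultimately show "dt l f = 0" unfolding * by (intro exI[of _ "vec l v"]) auto
  qed
qed

lemma dt_eq_0_equal_rows:
  assumes "i < l" "j < l" "i \<noteq> j" "\<And>k. k < l \<Longrightarrow> f i k = f j k"
  shows "dt l f = 0"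
  unfolding dt_def
  by (rule det_identical_rows[of _ l i j]) (use assms in \<open>auto intro!: eq_vecI\<close>)

lemma dt_eq_0_equal_cols:
  assumes "i < l" "j < l" "i \<noteq> j" "\<And>k. k < l \<Longrightarrow> f k i = f k j"
  shows "dt l f = 0"
  unfolding dt_def
  by (rule det_identical_columns[of _ l i j]) (use assms in \<open>auto intro!: eq_vecI\<close>)

text \<open>The adjugate. Cofactors along row \<open>b\<close> do not see that row, so replacing it
  by \<open>r\<close> gives a linear form in \<open>r\<close> whose coefficients are column
  \<open>b\<close> of \<open>g\<close>. The later multilinearity arguments rest on this last
  clause.\<close>

lemma dt_adjE:
  fixes f :: "nat \<Rightarrow> nat \<Rightarrow> 'a::comm_ring_1"
  obtains g where
    "\<And>i j. i < l \<Longrightarrow> j < l \<Longrightarrow> (\<Sum>k<l. f i k * g k j) = (if i = j then dt l f else 0)"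
    "\<And>i j. i < l \<Longrightarrow> j < l \<Longrightarrow> (\<Sum>k<l. g i k * f k j) = (if i = j then dt l f else 0)"
    "\<And>r b. b < l \<Longrightarrow> dt l (f(b := r)) = (\<Sum>k<l. r k * g k b)"
proof -
  let ?A = "mat l l (\<lambda>(i, j). f i j)"
  have A: "?A \<in> carrier_mat l l" by simp
  note adj = adj_mat[OF A]
  have dim: "dim_row (adj_mat ?A) = l" "dim_col (adj_mat ?A) = l" using adj(1) by auto
  let ?g = "\<lambda>k j. adj_mat ?A $$ (k, j)"
  show thesis
  proof (rule that[of ?g])
    fix i j assume ij: "i < l" "j < l"
    show "(\<Sum>k<l. f i k * ?g k j) = (if i = j then dt l f else 0)"
      using arg_cong[OF adj(2), of "\<lambda>X. X $$ (i, j)"] ij dim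
      by (auto simp: scalar_prod_def atLeast0LessThan dt_def)
    show "(\<Sum>k<l. ?g i k * f k j) = (if i = j then dt l f else 0)"
      using arg_cong[OF adj(3), of "\<lambda>X. X $$ (i, j)"] ij dim
      by (auto simp: scalar_prod_def atLeast0LessThan dt_def)
  next
    fix r b assume b: "b < l"
    let ?B = "mat l l (\<lambda>(i, j). (f(b := r)) i j)"
    have "dt l (f(b := r)) = (\<Sum>j<l. ?B $$ (b, j) * cofactor ?B b j)"
      unfolding dt_def by (rule laplace_expansion_row) (use b in auto)
    also have "\<dots> = (\<Sum>j<l. r j * ?g j b)"
    proof (rule sum.cong)
      fix j assume j: "j \<in> {..<l}"
      have "mat_delete ?B b j = mat_delete ?A b j"
        unfolding mat_delete_def using b j by (intro eq_matI) auto
      then have "cofactor ?B b j = cofactor ?A b j" by (simp add: cofactor_def)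
      then show "?B $$ (b, j) * cofactor ?B b j = r j * ?g j b"
        using b j by (auto simp: adj_mat_def)
    qed simp
    finally show "dt l (f(b := r)) = (\<Sum>j<l. r j * ?g j b)" .
  qed
qed

lemma dt_diag: "dt l (\<lambda>i j. if i = j then c else 0) = c ^ l"
proof -
  have "mat l l (\<lambda>(i, j). if i = j then c else 0) = c \<cdot>\<^sub>m 1\<^sub>m l" by (intro eq_matI) auto
  then show ?thesis by (simp add: dt_def)
qed

lemma dt_scale_cols: "dt l (\<lambda>i j. c j * f i j) = (\<Prod>j<l. c j) * dt l f"
proof -
  have "(\<Prod>i<l. c (p i) * f i (p i)) = (\<Prod>j<l. c j) * (\<Prod>i<l. f i (p i))"
    if "p permutes {0..<l}" for p
    using that permutes_imp_bij[OF that] unfolding prod.distrib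
    by (subst prod.reindex_bij_betw[where g = c and h = p and T = "{..<l}"])
       (simp_all add: atLeast0LessThan)
  then show ?thesis
    unfolding dt_eq_sum sum_distrib_left
    by (intro sum.cong) (auto simp: algebra_simps)
qed

text \<open>A kernel vector of the transpose is the coefficient vector of a nonzero polynomial of
  degree below \<open>l\<close> with the \<open>l\<close> distinct roots \<open>e j\<close>.\<close>

lemma dt_vandermonde_neq_0:
  fixes e :: "nat \<Rightarrow> 'a::idom"
  assumes "inj_on e {..<l}"
  shows "dt l (\<lambda>i j. e j ^ i) \<noteq> 0"
proof
  assume "dt l (\<lambda>i j. e j ^ i) = 0"
  moreover have "dt l (\<lambda>i j. e j ^ i) = dt l (\<lambda>j i. e j ^ i)"
  proof -
    have "transpose_mat (mat l l (\<lambda>(i, j). e j ^ i)) = mat l l (\<lambda>(j, i). e j ^ i)"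
      by (intro eq_matI) auto
    moreover have "det (transpose_mat (mat l l (\<lambda>(i, j). e j ^ i))) = det (mat l l (\<lambda>(i, j). e j ^ i))"
      by (rule det_transpose[of _ l]) simp
    ultimately show ?thesis unfolding dt_def by simp
  qed
  ultimately have "dt l (\<lambda>j i. e j ^ i) = 0" by simp
  then obtain v where "(\<exists>k<l. v k \<noteq> 0) \<and> (\<forall>j<l. (\<Sum>i<l. e j ^ i * v i) = 0)"
    unfolding dt_eq_0_iff by (elim exE)
  then obtain k where v: "k < l" "v k \<noteq> 0" "\<And>j. j < l \<Longrightarrow> (\<Sum>i<l. e j ^ i * v i) = 0"
    by auto
  define q where "q = (\<Sum>i<l. Polynomial.monom (v i) i)"
  have "Polynomial.coeff q k = v k"
    unfolding q_def Polynomial.coeff_sum using v(1)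
    by (simp add: if_distrib cong: if_cong)
  then have q0: "q \<noteq> 0" using v(2) by auto
  have "Polynomial.degree q < l"
    unfolding q_def
    by (rule Polynomial.degree_sum_less)
       (use v(1) in \<open>auto intro: le_less_trans[OF Polynomial.degree_monom_le]\<close>)
  moreover have "card (e ` {..<l}) \<le> card {x. poly q x = 0}"
  proof (rule card_mono)
    show "finite {x. poly q x = 0}" using q0 by (rule poly_roots_finite)
    show "e ` {..<l} \<subseteq> {x. poly q x = 0}"
      using v(3) by (auto simp: q_def poly_sum poly_monom mult.commute)
  qed
  moreover have "card {x. poly q x = 0} \<le> Polynomial.degree q"
    using q0 by (rule card_poly_roots_bound)
  ultimately show False using assms by (simp add: card_image)
qed

subsection \<open>Polynomials and their index at a point\<close>

abbreviation lookup :: "('k \<Rightarrow>\<^sub>0 'a::zero) \<Rightarrow> 'k \<Rightarrow> 'a" where "lookup \<equiv> Poly_Mapping.lookup"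
abbreviation keys :: "('k \<Rightarrow>\<^sub>0 'a::zero) \<Rightarrow> 'k set" where "keys \<equiv> Poly_Mapping.keys"

type_synonym mon = "nat \<Rightarrow>\<^sub>0 nat"
type_synonym 'a mpoly = "mon \<Rightarrow>\<^sub>0 'a"

text \<open>For \<open>Q\<close> a polynomial in the exponents this is a differential operator in
  the Euler derivations x d/dx, which are diagonal on monomials.\<close>

definition opr :: "('k \<Rightarrow> 'a) \<Rightarrow> ('k \<Rightarrow>\<^sub>0 'a) \<Rightarrow> ('k \<Rightarrow>\<^sub>0 'a::semiring_0)" where
  "opr Q F = Poly_Mapping.mapp (\<lambda>I c. Q I * c) F"

lemma lookup_opr [simp]: "lookup (opr Q F) I = Q I * lookup F I"
  by (auto simp: opr_def lookup_mapp when_def in_keys_iff)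

lemma keys_opr: "keys (opr Q F) \<subseteq> keys F"
  by (auto simp: in_keys_iff)

lemma opr_opr: "opr P (opr Q F) = opr (\<lambda>I. P I * Q I) F"
  by (intro poly_mapping_eqI) (simp add: mult.assoc)

lemma opr_add: "opr (\<lambda>I. P I + Q I) F = opr P F + opr Q F"
  by (intro poly_mapping_eqI) (simp add: lookup_add distrib_right)

lemma opr_add_right: "opr Q (F + G) = opr Q F + opr Q G"
  by (intro poly_mapping_eqI) (simp add: lookup_add distrib_left)

lemma opr_0_right [simp]: "opr Q 0 = 0"
  by (intro poly_mapping_eqI) simp

lemma opr_sum_right: "opr Q (\<Sum>x\<in>S. F x) = (\<Sum>x\<in>S. opr Q (F x))"
  by (induction S rule: infinite_finite_induct) (simp_all add: opr_add_right)

lemma sum_single_keys: "(\<Sum>k\<in>keys F. Poly_Mapping.single k (lookup F k)) = F"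
proof (intro poly_mapping_eqI)
  fix k
  show "lookup (\<Sum>k\<in>keys F. Poly_Mapping.single k (lookup F k)) k = lookup F k"
    by (simp add: lookup_sum lookup_single when_def in_keys_iff)
qed

lemma sum_single_keys':
  "finite S \<Longrightarrow> keys F \<subseteq> S \<Longrightarrow> (\<Sum>k\<in>S. Poly_Mapping.single k (lookup F k)) = F"
  by (subst (2) sum_single_keys[of F, symmetric], rule sum.mono_neutral_right)
     (auto simp: in_keys_iff)

lemma mult_eq_sum_single:
  "F * G = (\<Sum>k\<in>keys F. \<Sum>m\<in>keys G. Poly_Mapping.single (k + m) (lookup F k * lookup G m))"
  by (subst (1) sum_single_keys[of F, symmetric], subst (1) sum_single_keys[of G, symmetric])
     (simp add: sum_product mult_single)

lemma lookup_mult_eq_sum: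
  "lookup (F * G) b = (\<Sum>k\<in>keys F. \<Sum>m\<in>keys G. lookup F k * lookup G m when k + m = b)"
  by (subst mult_eq_sum_single) (simp add: lookup_sum lookup_single)

lemma lookup_const_mult [simp]: "lookup (Poly_Mapping.single 0 a * G) b = a * lookup G b"
  for a :: "'a::semiring_0"
proof (cases "a = 0")
  case False
  then show ?thesis
    by (simp add: lookup_mult_eq_sum when_def in_keys_iff)
qed simp

lemma lookup_mult_single:
  fixes G :: "'k::cancel_comm_monoid_add \<Rightarrow>\<^sub>0 'a::semiring_0"
  shows "lookup (G * Poly_Mapping.single m a) (k + m) = lookup G k * a"
proof (cases "a = 0")
  case False
  then show ?thesis
    by (simp add: lookup_mult_eq_sum when_def in_keys_iff)
qed simp

lemma lookup_mult_single_eq_0: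
  fixes G :: "'k::comm_monoid_add \<Rightarrow>\<^sub>0 'a::semiring_0"
  assumes "\<And>k. b \<noteq> k + m"
  shows "lookup (G * Poly_Mapping.single m a) b = 0"
  by (simp add: lookup_mult_eq_sum when_def assms[THEN not_sym])

definition wt :: "(nat \<Rightarrow> 'b::comm_semiring_1) \<Rightarrow> mon \<Rightarrow> 'b" where
  "wt w b = (\<Sum>c\<in>keys b. of_nat (lookup b c) * w c)"

lemma wt_superset: "finite S \<Longrightarrow> keys b \<subseteq> S \<Longrightarrow> wt w b = (\<Sum>c\<in>S. of_nat (lookup b c) * w c)"
  unfolding wt_def by (rule sum.mono_neutral_left) (auto simp: in_keys_iff)

lemma wt_add: "wt w (a + b) = wt w a + wt w b"
proof -
  let ?S = "keys a \<union> keys b"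
  have "keys (a + b) \<subseteq> ?S" by (rule keys_add)
  then show ?thesis
    by (simp add: wt_superset[of ?S] lookup_add distrib_right sum.distrib)
qed

lemma wt_0 [simp]: "wt w 0 = 0" by (simp add: wt_def)

lemma wt_single [simp]: "wt w (Poly_Mapping.single c n) = of_nat n * w c"
  by (simp add: wt_def)

lemma wt_nonneg: "(\<And>c. w c \<ge> 0) \<Longrightarrow> wt w b \<ge> (0 :: 'b::linordered_idom)"
  unfolding wt_def by (intro sum_nonneg) simp

text \<open>The coefficient of x^b in (1 + x)^I; also the eigenvalue on x^I of x^b times the divided
  derivative of order b.\<close>

definition bin :: "mon \<Rightarrow> mon \<Rightarrow> nat" where
  "bin I b = (\<Prod>c\<in>keys b. lookup I c choose lookup b c)"

lemma bin_superset: "finite S \<Longrightarrow> keys b \<subseteq> S \<Longrightarrow> bin I b = (\<Prod>c\<in>S. lookup I c choose lookup b c)"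
  unfolding bin_def by (rule prod.mono_neutral_left) (auto simp: in_keys_iff)

lemma bin_0 [simp]: "bin I 0 = 1" by (simp add: bin_def)

lemma bin_eq_0: "\<not> keys b \<subseteq> keys I \<Longrightarrow> bin I b = 0"
proof -
  assume "\<not> keys b \<subseteq> keys I"
  then obtain c where "c \<in> keys b" "c \<notin> keys I" by auto
  then have "c \<in> keys b" "lookup I c = 0" "lookup b c \<noteq> 0" by (auto simp: in_keys_iff)
  then show ?thesis unfolding bin_def by (intro prod_zero bexI[of _ c]) (simp_all add: binomial_eq_0)
qed

text \<open>In one variable, n * (n choose k) = (k + 1) * (n choose k + 1) + k * (n choose k). So
  multiplying by an exponent involves only the next binomial, with nonnegative coefficients;
  \<open>ops_var\<close> and \<open>bspan_var\<close> both depend on this.\<close>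

lemma var_mult_bin:
  "lookup I c * bin I b
    = Suc (lookup b c) * bin I (b + Poly_Mapping.single c 1) + lookup b c * bin I b"
proof -
  let ?S = "insert c (keys b)" and ?k = "lookup b c" and ?n = "lookup I c"
  have sub: "keys (b + Poly_Mapping.single c 1) \<subseteq> ?S" "keys b \<subseteq> ?S"
    using keys_add[of b "Poly_Mapping.single c 1"] by auto
  let ?R = "\<Prod>d\<in>keys b - {c}. lookup I d choose lookup b d"
  have fin: "finite (keys b)" by simp
  have 1: "bin I b = (?n choose ?k) * ?R"
    by (subst bin_superset[OF _ sub(2)]) (simp_all add: prod.insert_remove)
  have R2: "(\<Prod>d\<in>keys b - {c}. lookup I d choose lookup (b + Poly_Mapping.single c 1) d) = ?R"
    by (intro prod.cong) (auto simp: lookup_add lookup_single when_def)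
  have 2: "bin I (b + Poly_Mapping.single c 1) = (?n choose Suc ?k) * ?R"
    by (subst bin_superset[OF _ sub(1)]) (simp_all only: prod.insert_remove fin R2,
        simp_all add: lookup_add)
  have "?n * (?n choose ?k) = Suc ?k * (?n choose Suc ?k) + ?k * (?n choose ?k)"
    using Suc_times_binomial_eq[of ?n ?k] by (simp add: algebra_simps)
  then have "?n * (?n choose ?k) * ?R = (Suc ?k * (?n choose Suc ?k) + ?k * (?n choose ?k)) * ?R" by simp
  then show ?thesis unfolding 1 2 by (simp only: distrib_right mult.assoc)
qed

definition pw :: "(nat \<Rightarrow> 'a::comm_monoid_mult) \<Rightarrow> mon \<Rightarrow> 'a" where
  "pw p I = (\<Prod>c\<in>keys I. p c ^ lookup I c)"

lemma pw_superset: "finite S \<Longrightarrow> keys I \<subseteq> S \<Longrightarrow> pw p I = (\<Prod>c\<in>S. p c ^ lookup I c)"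
  unfolding pw_def by (rule prod.mono_neutral_left) (auto simp: in_keys_iff)

text \<open>\<open>ev p b F\<close> is the coefficient of \<open>x\<^sup>b\<close> in \<open>F(p(1 + x))\<close>, and \<open>van p w T F\<close> says that \<open>F\<close> has
  index at least \<open>T\<close> at the point \<open>p\<close> with respect to the weights \<open>w\<close>.\<close>

definition ev :: "(nat \<Rightarrow> 'a) \<Rightarrow> mon \<Rightarrow> 'a mpoly \<Rightarrow> 'a::comm_ring_1" where
  "ev p b F = (\<Sum>I\<in>keys F. lookup F I * (pw p I * of_nat (bin I b)))"

definition van :: "(nat \<Rightarrow> 'a) \<Rightarrow> (nat \<Rightarrow> real) \<Rightarrow> real \<Rightarrow> 'a::comm_ring_1 mpoly \<Rightarrow> bool" where
  "van p w T F \<longleftrightarrow> (\<forall>b. wt w b < T \<longrightarrow> ev p b F = 0)"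

lemma ev_superset:
  "finite S \<Longrightarrow> keys F \<subseteq> S \<Longrightarrow> ev p b F = (\<Sum>I\<in>S. lookup F I * (pw p I * of_nat (bin I b)))"
  unfolding ev_def by (rule sum.mono_neutral_left) (auto simp: in_keys_iff)

lemma ev_0 [simp]: "ev p b 0 = 0" by (simp add: ev_def)

lemma ev_add: "ev p b (F + G) = ev p b F + ev p b G"
proof -
  let ?S = "keys F \<union> keys G"
  have "keys (F + G) \<subseteq> ?S" by (rule keys_add)
  then show ?thesis
    by (simp add: ev_superset[of ?S] lookup_add distrib_right sum.distrib)
qed

lemma ev_sum: "ev p b (\<Sum>x\<in>S. F x) = (\<Sum>x\<in>S. ev p b (F x))"
  by (induction S rule: infinite_finite_induct) (simp_all add: ev_add)

lemma ev_single [simp]: "ev p b (Poly_Mapping.single I a) = a * (pw p I * of_nat (bin I b))"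
  by (cases "a = 0") (simp_all add: ev_def)

section \<open>Taylor expansion at a point\<close>

abbreviation lin :: "(nat \<Rightarrow> 'a) \<Rightarrow> nat \<Rightarrow> 'a::comm_ring_1 mpoly" where
  "lin p c \<equiv> Poly_Mapping.single 0 (p c) * (1 + Poly_Mapping.single (Poly_Mapping.single c 1) 1)"

text \<open>The image of x^I under x_c -> p_c (1 + x_c). Scaling instead of shifting makes every
  Taylor coefficient of a monomial an integer multiple of its value \<open>pw p I\<close>.\<close>

definition tmon :: "(nat \<Rightarrow> 'a) \<Rightarrow> mon \<Rightarrow> 'a::comm_ring_1 mpoly" where
  "tmon p I = (\<Prod>c\<in>keys I. lin p c ^ lookup I c)"

lemma single_var_power:
  "(Poly_Mapping.single (Poly_Mapping.single c 1) (1::'a::comm_ring_1)) ^ k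
    = Poly_Mapping.single (Poly_Mapping.single c k) (1 :: 'a)" for c :: nat
  by (induction k) (simp_all add: mult_single single_add[symmetric])

lemma single_0_power:
  "(Poly_Mapping.single 0 a :: 'a::comm_ring_1 mpoly) ^ k = Poly_Mapping.single 0 (a ^ k)"
  by (induction k) (simp_all add: mult_single)

lemma one_plus_var_power:
  "(Poly_Mapping.single 0 a * (1 + Poly_Mapping.single (Poly_Mapping.single c 1) 1)) ^ n
    = (\<Sum>k\<le>n. Poly_Mapping.single (Poly_Mapping.single c k) (a ^ n * of_nat (n choose k)) :: 'a::comm_ring_1 mpoly)"
proof -
  have "(1 + Poly_Mapping.single (Poly_Mapping.single c 1) 1) ^ n
      = (\<Sum>k\<le>n. of_nat (n choose k) * Poly_Mapping.single (Poly_Mapping.single c 1) 1 ^ k :: 'a mpoly)"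
    by (subst add.commute, subst binomial_ring) simp
  also have "\<dots> = (\<Sum>k\<le>n. Poly_Mapping.single (Poly_Mapping.single c k) (of_nat (n choose k)))"
    unfolding single_var_power
    by (simp add: single_of_nat[symmetric] mult_single del: single_of_nat)
  finally show ?thesis
    by (simp add: power_mult_distrib single_0_power sum_distrib_left mult_single)
qed

lemma lookup_prod_one_plus_var:
  assumes "finite S"
  shows "lookup (\<Prod>c\<in>S. lin p c ^ n c) b
    = (if keys b \<subseteq> S then \<Prod>c\<in>S. p c ^ n c * of_nat (n c choose lookup b c) else (0::'a::comm_ring_1))"
  using assms
proof (induction S arbitrary: b rule: finite_induct)
  case empty
  show ?case by (auto simp: lookup_one when_def)
next
  case (insert c S)
  let ?G = "\<Prod>c\<in>S. lin p c ^ n c :: 'a mpoly"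
  let ?a = "\<lambda>k. p c ^ n c * of_nat (n c choose k)"
  \<comment> \<open>Only the term of degree \<open>lookup b c\<close> in the new variable can
    contribute to the coefficient of \<open>b\<close>; \<open>?b'\<close> is what remains of
    \<open>b\<close> for the other variables.\<close>
  let ?b' = "b - Poly_Mapping.single c (lookup b c)"
  have b': "b = ?b' + Poly_Mapping.single c (lookup b c)"
    by (intro poly_mapping_eqI) (auto simp: lookup_add lookup_minus lookup_single when_def)
  have kb': "keys ?b' = keys b - {c}"
    by (auto simp: in_keys_iff lookup_minus lookup_single when_def split: if_splits)
  have zero: "lookup (?G * Poly_Mapping.single (Poly_Mapping.single c k) (?a k)) b = 0"
    if k: "k \<noteq> lookup b c" for k
  proof (cases "\<exists>d. b = d + Poly_Mapping.single c k")
    case True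
    then obtain d where d: "b = d + Poly_Mapping.single c k" by blast
    have "lookup d c \<noteq> 0" using k unfolding d by (simp add: lookup_add)
    then have "c \<in> keys d" by (simp add: in_keys_iff)
    then have "\<not> keys d \<subseteq> S" using insert.hyps by blast
    then have "lookup ?G d = 0" unfolding insert.IH by simp
    then show ?thesis unfolding d by (simp add: lookup_mult_single)
  qed (simp add: lookup_mult_single_eq_0)
  have "lookup (\<Prod>c\<in>insert c S. lin p c ^ n c) b
     = lookup (?G * (\<Sum>k\<le>n c. Poly_Mapping.single (Poly_Mapping.single c k) (?a k))) b"
    by (simp only: prod.insert[OF insert.hyps] one_plus_var_power[of "p c" c "n c"] mult.commute)
  also have "\<dots> = (\<Sum>k\<le>n c. lookup (?G * Poly_Mapping.single (Poly_Mapping.single c k) (?a k)) b)"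
    by (simp add: sum_distrib_left lookup_sum)
  also have "\<dots> = (if lookup b c \<le> n c then
      lookup (?G * Poly_Mapping.single (Poly_Mapping.single c (lookup b c)) (?a (lookup b c))) b else 0)"
    using zero by (auto intro!: sum.neutral simp: sum.remove[of "{..n c}" "lookup b c"])
  also have "\<dots> = lookup ?G ?b' * ?a (lookup b c)"
    by (subst (2) b') (simp add: lookup_mult_single binomial_eq_0)
  also have "\<dots> = (if keys b \<subseteq> insert c S then \<Prod>c\<in>insert c S. p c ^ n c * of_nat (n c choose lookup b c) else 0)"
  proof -
    have "(\<Prod>d\<in>S. p d ^ n d * of_nat (n d choose lookup ?b' d)) = (\<Prod>d\<in>S. p d ^ n d * of_nat (n d choose lookup b d) :: 'a)"
      using insert.hyps by (intro prod.cong) (auto simp: lookup_minus lookup_single when_def)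
    then show ?thesis
      using insert.hyps unfolding insert.IH kb' by (auto simp: mult.commute)
  qed
  finally show ?case .
qed

lemma lookup_tmon: "lookup (tmon p I) b = pw p I * of_nat (bin I b)"
proof (cases "keys b \<subseteq> keys I")
  case True
  then show ?thesis
    unfolding tmon_def lookup_prod_one_plus_var[OF finite_keys]
    by (simp add: prod.distrib pw_def bin_superset[of "keys I"])
next
  case False
  then show ?thesis
    unfolding tmon_def lookup_prod_one_plus_var[OF finite_keys] by (simp add: bin_eq_0)
qed

lemma tmon_add: "tmon p (I + J) = tmon p I * tmon p J"
proof -
  let ?S = "keys I \<union> keys J"
  have sup: "tmon p K = (\<Prod>c\<in>?S. lin p c ^ lookup K c)"
    if "keys K \<subseteq> ?S" for K
    unfolding tmon_def using that by (intro prod.mono_neutral_left) (auto simp: in_keys_iff)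
  show ?thesis
    using keys_add[of I J] by (simp add: sup lookup_add power_add prod.distrib)
qed

text \<open>A ring homomorphism with coefficients \<open>ev p b F\<close>: the index of
  \<open>F\<close> becomes the least weight of a key, and its behaviour under products can be read
  off.\<close>

definition tau :: "(nat \<Rightarrow> 'a) \<Rightarrow> 'a mpoly \<Rightarrow> 'a::comm_ring_1 mpoly" where
  "tau p F = (\<Sum>I\<in>keys F. Poly_Mapping.single 0 (lookup F I) * tmon p I)"

lemma lookup_tau: "lookup (tau p F) b = ev p b F"
  by (simp add: tau_def ev_def lookup_sum lookup_tmon)

lemma tau_sum: "tau p (\<Sum>x\<in>S. F x) = (\<Sum>x\<in>S. tau p (F x))"
  by (intro poly_mapping_eqI) (simp add: lookup_tau lookup_sum ev_sum)

lemma tau_single: "tau p (Poly_Mapping.single I a) = Poly_Mapping.single 0 a * tmon p I"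
  by (intro poly_mapping_eqI) (simp add: lookup_tau lookup_tmon)

lemma tau_mult: "tau p (F * G) = tau p F * tau p G"
proof -
  have "tau p (F * G) = (\<Sum>k\<in>keys F. \<Sum>m\<in>keys G. tau p (Poly_Mapping.single k (lookup F k)) * tau p (Poly_Mapping.single m (lookup G m)))"
    unfolding mult_eq_sum_single[of F G] tau_sum
    by (intro sum.cong refl) (simp add: tau_single tmon_add mult_single[of 0 _ 0, symmetric, simplified] ac_simps)
  also have "\<dots> = tau p (\<Sum>k\<in>keys F. Poly_Mapping.single k (lookup F k)) * tau p (\<Sum>m\<in>keys G. Poly_Mapping.single m (lookup G m))"
    by (simp add: tau_sum sum_product)
  finally show ?thesis by (simp add: sum_single_keys)
qed

lemma tau_1: "tau p 1 = 1"
  by (simp add: single_one[symmetric] tau_single tmon_def del: single_one) simp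

lemma van_tau: "van p w T F \<longleftrightarrow> (\<forall>b\<in>keys (tau p F). T \<le> wt w b)"
  unfolding van_def by (auto simp: in_keys_iff lookup_tau not_less[symmetric])

lemma van_mono: "van p w T F \<Longrightarrow> T' \<le> T \<Longrightarrow> van p w T' F"
  by (force simp: van_def)

lemma van_nonpos: "(\<And>c. 0 \<le> w c) \<Longrightarrow> T \<le> 0 \<Longrightarrow> van p w T F"
  unfolding van_def using wt_nonneg[of w] by (meson less_le_trans not_le)

lemma van_add: "van p w T F \<Longrightarrow> van p w T G \<Longrightarrow> van p w T (F + G)"
  by (simp add: van_def ev_add)

lemma van_sum: "(\<And>x. x \<in> S \<Longrightarrow> van p w T (F x)) \<Longrightarrow> van p w T (\<Sum>x\<in>S. F x)"
  by (simp add: van_def ev_sum)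

lemma van_mult:
  assumes "van p w T F" "van p w T' G"
  shows "van p w (T + T') (F * G)"
  unfolding van_tau tau_mult
proof
  fix b assume "b \<in> keys (tau p F * tau p G)"
  then obtain b1 b2 where "b = b1 + b2" "b1 \<in> keys (tau p F)" "b2 \<in> keys (tau p G)"
    using keys_mult by blast
  then show "T + T' \<le> wt w b" using assms by (auto simp: van_tau wt_add intro: add_mono)
qed

lemma van_1: "van p w 0 1"
  unfolding van_tau tau_1 by simp

lemma van_prod:
  "(\<And>x. x \<in> S \<Longrightarrow> van p w (T x) (F x)) \<Longrightarrow> van p w (\<Sum>x\<in>S. T x) (\<Prod>x\<in>S. F x)"
  by (induction S rule: infinite_finite_induct) (auto simp: van_1 intro: van_mult)

text \<open>The index is additive over a domain: of the lowest-weight keys of each factor take the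
  greatest in the order on monomials. Their sum arises in only one way in the product, so its
  coefficient does not cancel.\<close>

lemma van_mult_cases:
  fixes F G :: "'a::idom mpoly"
  assumes "van p w (T + T') (F * G)"
  shows "van p w T F \<or> van p w T' G"
proof (rule ccontr)
  assume neg: "\<not> ?thesis"
  have ex: "\<exists>a. a \<in> keys H \<and> wt w a < T \<and> (\<forall>b\<in>keys H. wt w a \<le> wt w b) \<and>
                 (\<forall>b\<in>keys H. wt w b = wt w a \<longrightarrow> b \<le> a)"
    if "\<not> (\<forall>b\<in>keys H. T \<le> wt w b)" for H :: "'a mpoly" and T
  proof -
    let ?m = "Min (wt w ` keys H)"
    have ne: "keys H \<noteq> {}" using that by auto
    have "?m \<in> wt w ` keys H" using ne by (intro Min_in) auto
    then obtain a0 where a0: "a0 \<in> keys H" "wt w a0 = ?m" by auto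
    let ?M = "{a \<in> keys H. wt w a = ?m}"
    have M: "Max ?M \<in> ?M" using a0 by (intro Max_in) auto
    have "\<forall>b\<in>keys H. ?m \<le> wt w b" by simp
    moreover have "\<forall>b\<in>keys H. wt w b = ?m \<longrightarrow> b \<le> Max ?M" by (auto intro: Max_ge)
    moreover have "?m < T" using that by (meson Min_le finite_imageI finite_keys imageI le_less_trans not_le)
    ultimately show ?thesis using M by (intro exI[of _ "Max ?M"]) auto
  qed
  obtain a where a: "a \<in> keys (tau p F)" "wt w a < T" "\<forall>b\<in>keys (tau p F). wt w a \<le> wt w b"
    "\<forall>b\<in>keys (tau p F). wt w b = wt w a \<longrightarrow> b \<le> a"
    using ex[of "tau p F" T] neg unfolding van_tau by blast
  obtain c where c: "c \<in> keys (tau p G)" "wt w c < T'" "\<forall>b\<in>keys (tau p G). wt w c \<le> wt w b"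
    "\<forall>b\<in>keys (tau p G). wt w b = wt w c \<longrightarrow> b \<le> c"
    using ex[of "tau p G" T'] neg unfolding van_tau by blast
  have uniq: "k = a \<and> m = c"
    if "k \<in> keys (tau p F)" "m \<in> keys (tau p G)" "k + m = a + c" for k m
  proof -
    have "wt w k + wt w m = wt w a + wt w c" by (metis that(3) wt_add)
    moreover have "wt w a \<le> wt w k" "wt w c \<le> wt w m" using that a(3) c(3) by auto
    ultimately have "wt w k = wt w a" "wt w m = wt w c" by linarith+
    then have le: "k \<le> a" "m \<le> c" using that a(4) c(4) by auto
    show ?thesis
    proof (rule ccontr)
      assume "\<not> ?thesis"
      then have "k < a \<or> m < c" using le by auto
      then have "k + m < a + c" using le by (auto intro: add_less_le_mono add_le_less_mono)
      then show False using that by simp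
    qed
  qed
  have "lookup (tau p F * tau p G) (a + c)
      = (\<Sum>k\<in>keys (tau p F). \<Sum>m\<in>keys (tau p G). if k = a then if m = c then lookup (tau p F) a * lookup (tau p G) c else 0 else 0)"
    unfolding lookup_mult_eq_sum
    by (intro sum.cong refl) (use uniq in \<open>auto simp: when_def\<close>)
  also have "\<dots> = lookup (tau p F) a * lookup (tau p G) c"
  proof -
    have "(\<Sum>m\<in>keys (tau p G). if k = a then if m = c then lookup (tau p F) a * lookup (tau p G) c else 0 else 0)
        = (if k = a then lookup (tau p F) a * lookup (tau p G) c else 0)" for k
      using c(1) by (cases "k = a") (simp_all add: sum.delta)
    then show ?thesis using a(1) by (simp add: sum.delta)
  qed
  also have "\<dots> \<noteq> 0" using a(1) c(1) by (simp add: in_keys_iff)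
  finally have "T + T' \<le> wt w (a + c)"
    using assms unfolding van_tau tau_mult by (auto simp: in_keys_iff)
  then show False using a(2) c(2) by (simp add: wt_add)
qed

section \<open>Operators of bounded order\<close>

lemma ev_opr: "ev p b (opr Q F) = (\<Sum>I\<in>keys F. Q I * lookup F I * (pw p I * of_nat (bin I b)))"
  by (subst ev_superset[OF finite_keys keys_opr]) simp

text \<open>Stands for "differential operator of weighted order at most \<open>t\<close>", expressed
  only by what is used: the index drops by at most \<open>t\<close>. In this form products, sums and
  cancellation of integers are immediate.\<close>

definition ops :: "(nat \<Rightarrow> 'a) \<Rightarrow> (nat \<Rightarrow> real) \<Rightarrow> real \<Rightarrow> (mon \<Rightarrow> 'a::comm_ring_1) \<Rightarrow> bool" where
  "ops p w t Q \<longleftrightarrow> (\<forall>F T. van p w T F \<longrightarrow> van p w (T - t) (opr Q F))"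

lemma ops_const: "0 \<le> t \<Longrightarrow> ops p w t (\<lambda>_. c)"
proof -
  have "ev p b (opr (\<lambda>_. c) F) = c * ev p b F" for b F
    unfolding ev_opr ev_def[of p b F] by (simp add: sum_distrib_left mult.assoc)
  then show "0 \<le> t \<Longrightarrow> ops p w t (\<lambda>_. c)" by (auto simp: ops_def van_def)
qed

lemma ops_mult: "ops p w s P \<Longrightarrow> ops p w t Q \<Longrightarrow> ops p w (s + t) (\<lambda>I. P I * Q I)"
  unfolding ops_def
proof (intro allI impI)
  fix F T
  assume P: "\<forall>F T. van p w T F \<longrightarrow> van p w (T - s) (opr P F)"
    and Q: "\<forall>F T. van p w T F \<longrightarrow> van p w (T - t) (opr Q F)" and F: "van p w T F"
  have "van p w (T - t - s) (opr P (opr Q F))" using P Q F by blast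
  moreover have "T - t - s = T - (s + t)" by simp
  ultimately show "van p w (T - (s + t)) (opr (\<lambda>I. P I * Q I) F)" by (simp only: opr_opr)
qed

lemma ops_add: "ops p w t P \<Longrightarrow> ops p w t Q \<Longrightarrow> ops p w t (\<lambda>I. P I + Q I)"
  unfolding ops_def opr_add by (blast intro: van_add)

lemma ops_prod:
  "(\<And>x. x \<in> S \<Longrightarrow> ops p w (t x) (Q x)) \<Longrightarrow> ops p w (\<Sum>x\<in>S. t x) (\<lambda>I. \<Prod>x\<in>S. Q x I)"
  by (induction S rule: infinite_finite_induct) (auto intro: ops_mult ops_const)

lemma ops_sum:
  "0 \<le> t \<Longrightarrow> (\<And>x. x \<in> S \<Longrightarrow> ops p w t (Q x)) \<Longrightarrow> ops p w t (\<lambda>I. \<Sum>x\<in>S. Q x I)"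
  by (induction S rule: infinite_finite_induct) (auto intro: ops_add ops_const)

lemma ops_var:
  assumes "0 \<le> w c"
  shows "ops p w (w c) (\<lambda>I. of_nat (lookup I c))"
  unfolding ops_def van_def
proof (intro allI impI)
  fix F T b assume F: "\<forall>b. wt w b < T \<longrightarrow> ev p b F = 0" and b: "wt w b < T - w c"
  let ?e = "Poly_Mapping.single c 1"
  have "ev p b (opr (\<lambda>I. of_nat (lookup I c)) F)
      = (\<Sum>I\<in>keys F. lookup F I * (pw p I * of_nat (lookup I c * bin I b)))"
    by (simp add: ev_opr algebra_simps)
  also have "\<dots> = of_nat (Suc (lookup b c)) * ev p (b + ?e) F + of_nat (lookup b c) * ev p b F"
    unfolding var_mult_bin ev_def sum_distrib_left sum.distrib[symmetric]
    by (intro sum.cong refl) (simp add: algebra_simps)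
  also have "\<dots> = 0"
    using F b assms by (simp add: wt_add)
  finally show "ev p b (opr (\<lambda>I. of_nat (lookup I c)) F) = 0" .
qed

lemma ops_cancel:
  fixes p :: "nat \<Rightarrow> 'a::{idom,ring_char_0}"
  assumes "ops p w t (\<lambda>I. of_nat n * Q I)" "n \<noteq> 0"
  shows "ops p w t Q"
proof -
  have "ev p b (opr (\<lambda>I. of_nat n * Q I) F) = of_nat n * ev p b (opr Q F)" for b F
    by (simp add: ev_opr sum_distrib_left mult.assoc)
  then show ?thesis using assms by (auto simp: ops_def van_def)
qed

text \<open>Induction by (n + 1) * (m choose n + 1) = (m - n) * (m choose n); the factor n + 1 is
  then cancelled, which characteristic 0 permits.\<close>

lemma ops_choose:
  fixes p :: "nat \<Rightarrow> 'a::{idom,ring_char_0}"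
  assumes "0 \<le> w c"
  shows "ops p w (of_nat n * w c) (\<lambda>I. of_nat (lookup I c choose n))"
proof (induction n)
  case 0
  then show ?case using ops_const[of 0 p w 1] by simp
next
  case (Suc n)
  have *: "of_nat (Suc n) * of_nat (m choose Suc n) = (of_nat m + - of_nat n) * (of_nat (m choose n) :: 'a)" for m
  proof -
    have "m * (m choose n) = Suc n * (m choose Suc n) + n * (m choose n)"
      using Suc_times_binomial_eq[of m n] by (simp add: algebra_simps)
    then have "of_nat m * of_nat (m choose n) = of_nat (Suc n) * of_nat (m choose Suc n) + of_nat n * (of_nat (m choose n) :: 'a)"
      by (metis of_nat_add of_nat_mult)
    then show ?thesis by (simp add: algebra_simps)
  qed
  have "ops p w (w c + of_nat n * w c) (\<lambda>I. (of_nat (lookup I c) + - of_nat n) * of_nat (lookup I c choose n))"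
    by (intro ops_mult ops_add Suc ops_var ops_const assms)
  then have "ops p w (of_nat (Suc n) * w c) (\<lambda>I. of_nat (Suc n) * of_nat (lookup I c choose Suc n))"
    unfolding * by (simp add: algebra_simps)
  then show ?case by (rule ops_cancel) simp
qed

lemma ops_bin:
  fixes p :: "nat \<Rightarrow> 'a::{idom,ring_char_0}"
  assumes "\<And>c. 0 \<le> w c"
  shows "ops p w (wt w a) (\<lambda>I. of_nat (bin I a))"
  unfolding wt_def bin_def of_nat_prod by (intro ops_prod ops_choose assms)

lemma van_opr: "van p w T F \<Longrightarrow> ops p w t Q \<Longrightarrow> T' \<le> T - t \<Longrightarrow> van p w T' (opr Q F)"
  unfolding ops_def by (meson van_mono)

text \<open>An operator of order below the index leaves a polynomial that still vanishes at
  \<open>p\<close>. This turns a high index into linear relations between the values of the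
  monomials.\<close>

lemma van_ops_sum_eq_0:
  assumes "van p w T F" "ops p w t Q" "t < T"
  shows "(\<Sum>I\<in>keys F. Q I * lookup F I * pw p I) = 0"
proof -
  have "van p w (T - t) (opr Q F)" using assms by (auto simp: ops_def)
  then have "ev p 0 (opr Q F) = 0" using assms(3) by (simp add: van_def)
  then show ?thesis by (simp add: ev_opr mult.assoc)
qed

text \<open>Every term of the Leibniz expansion takes one entry from each column, so the bounds of
  the columns add up.\<close>

lemma van_dt:
  fixes f :: "nat \<Rightarrow> nat \<Rightarrow> 'a::comm_ring_1 mpoly"
  assumes "\<And>i j. i < l \<Longrightarrow> j < l \<Longrightarrow> van p w (T j) (f i j)"
  shows "van p w (\<Sum>j<l. T j) (dt l f)"
  unfolding dt_eq_sum
proof (rule van_sum)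
  fix \<pi> assume "\<pi> \<in> {\<pi>. \<pi> permutes {0..<l}}"
  then have \<pi>: "\<pi> permutes {..<l}" by (simp add: atLeast0LessThan)
  have "van p w (\<Sum>i<l. T (\<pi> i)) (\<Prod>i<l. f i (\<pi> i))"
    using permutes_in_image[OF \<pi>] by (intro van_prod assms) auto
  moreover have "(\<Sum>i<l. T (\<pi> i)) = (\<Sum>j<l. T j)"
    using sum.permute[OF \<pi>, of T] by (simp add: comp_def)
  ultimately have "van p w (\<Sum>j<l. T j) (\<Prod>i<l. f i (\<pi> i))" by simp
  moreover have "van p w 0 (signof \<pi> :: 'a mpoly)"
  proof -
    have "ev p b (- 1) = - ev p b 1" for b
      using ev_add[of p b "- 1" 1] by (simp add: eq_neg_iff_add_eq_0)
    then have "van p w 0 (- 1 :: 'a mpoly)"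
      using van_1[of p w] unfolding van_def by simp
    then show ?thesis using van_1[of p w] by (auto simp: sign_def)
  qed
  ultimately have "van p w (0 + (\<Sum>j<l. T j)) (signof \<pi> * (\<Prod>i<l. f i (\<pi> i)))"
    by (intro van_mult)
  then show "van p w (\<Sum>j<l. T j) (signof \<pi> * (\<Prod>i<l. f i (\<pi> i)))" by (simp only: add_0)
qed

subsection \<open>The ring of integers of the golden field\<close>

text \<open>\<open>ZP a b\<close> encodes \<open>a + b \<phi>\<close>, where \<open>\<phi>\<^sup>2 = \<phi> + 1\<close>.\<close>

datatype zphi = ZP (zre: int) (zphi_coeff: int)

instantiation zphi :: comm_ring_1
begin

definition "0 = ZP 0 0"
definition "1 = ZP 1 0"
definition "x + y = ZP (zre x + zre y) (zphi_coeff x + zphi_coeff y)"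
definition "x - y = ZP (zre x - zre y) (zphi_coeff x - zphi_coeff y)"
definition "- x = ZP (- zre x) (- zphi_coeff x)" for x :: zphi
definition "x * y = ZP (zre x * zre y + zphi_coeff x * zphi_coeff y)
  (zre x * zphi_coeff y + zphi_coeff x * zre y + zphi_coeff x * zphi_coeff y)"

instance
  by standard
    (auto simp: zero_zphi_def one_zphi_def plus_zphi_def minus_zphi_def uminus_zphi_def times_zphi_def
      algebra_simps)

end

definition gphi :: real where "gphi = (1 + sqrt 5) / 2"
definition gpsi :: real where "gpsi = (1 - sqrt 5) / 2"

lemma gphi_sq: "gphi * gphi = gphi + 1" and gpsi_sq: "gpsi * gpsi = gpsi + 1"
  by (simp_all add: gphi_def gpsi_def field_simps)

lemma gphi_add_gpsi: "gphi + gpsi = 1" and gphi_mult_gpsi: "gphi * gpsi = - 1"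
  by (simp_all add: gphi_def gpsi_def field_simps)

lemma gphi_bounds: "1 < gphi" "gphi < 2"
proof -
  have "1 < sqrt 5" by (simp add: real_less_rsqrt)
  moreover have "sqrt 5 < 3" by (simp add: real_less_lsqrt)
  ultimately show "1 < gphi" "gphi < 2" by (simp_all add: gphi_def)
qed

lemma gphi_pos [simp]: "0 < gphi" using gphi_bounds by simp

lemma gpsi_eq: "gpsi = - inverse gphi"
  using gphi_mult_gpsi gphi_bounds by (simp add: field_simps)

definition emb1 :: "zphi \<Rightarrow> real" where
  "emb1 x = of_int (zre x) + of_int (zphi_coeff x) * gphi"

definition emb2 :: "zphi \<Rightarrow> real" where
  "emb2 x = of_int (zre x) + of_int (zphi_coeff x) * gpsi"

lemma emb_0 [simp]: "emb1 0 = 0" "emb2 0 = 0"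
  and emb_1 [simp]: "emb1 1 = 1" "emb2 1 = 1"
  and emb_add [simp]: "emb1 (x + y) = emb1 x + emb1 y" "emb2 (x + y) = emb2 x + emb2 y"
  and emb_uminus [simp]: "emb1 (- x) = - emb1 x" "emb2 (- x) = - emb2 x"
  and emb_diff [simp]: "emb1 (x - y) = emb1 x - emb1 y" "emb2 (x - y) = emb2 x - emb2 y"
  by (simp_all add: emb1_def emb2_def zero_zphi_def one_zphi_def plus_zphi_def minus_zphi_def
      uminus_zphi_def algebra_simps)

lemma emb_mult [simp]: "emb1 (x * y) = emb1 x * emb1 y" "emb2 (x * y) = emb2 x * emb2 y"
proof -
  have *: "(a + b * g) * (c + d * g) = a * c + b * d + (a * d + b * c + b * d) * g"
    if "g * g = g + 1" for a b c d g :: real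
  proof -
    have "(a + b * g) * (c + d * g) = a * c + (a * d + b * c) * g + b * d * (g * g)"
      by (simp add: algebra_simps)
    then show ?thesis unfolding that by (simp add: algebra_simps)
  qed
  show "emb1 (x * y) = emb1 x * emb1 y" "emb2 (x * y) = emb2 x * emb2 y"
    unfolding emb1_def emb2_def *[OF gphi_sq] *[OF gpsi_sq] by (simp_all add: times_zphi_def)
qed

lemma emb_power [simp]: "emb1 (x ^ n) = emb1 x ^ n" "emb2 (x ^ n) = emb2 x ^ n"
  by (induction n) simp_all

lemma emb_sum: "emb1 (\<Sum>x\<in>S. f x) = (\<Sum>x\<in>S. emb1 (f x))" "emb2 (\<Sum>x\<in>S. f x) = (\<Sum>x\<in>S. emb2 (f x))"
  by (induction S rule: infinite_finite_induct) simp_all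

lemma emb_prod: "emb1 (\<Prod>x\<in>S. f x) = (\<Prod>x\<in>S. emb1 (f x))" "emb2 (\<Prod>x\<in>S. f x) = (\<Prod>x\<in>S. emb2 (f x))"
  by (induction S rule: infinite_finite_induct) simp_all

lemma emb_of_nat [simp]: "emb1 (of_nat n) = of_nat n" "emb2 (of_nat n) = of_nat n"
  by (induction n) simp_all

lemma emb_of_int [simp]: "emb1 (of_int n) = of_int n" "emb2 (of_int n) = of_int n"
  by (cases n rule: int_cases2; simp)+

text \<open>If \<open>y\<close> were nonzero, the 5-adic valuations of the two sides would have
  different parity.\<close>

lemma square_eq_5_square:
  fixes x y :: int
  assumes "x * x = 5 * (y * y)"
  shows "y = 0"
proof (rule ccontr)
  assume y: "y \<noteq> 0"
  then have x: "x \<noteq> 0" using assms by auto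
  have p: "prime_elem (5 :: int)" by (rule prime_imp_prime_elem) simp
  have "multiplicity 5 (x * x) = 2 * multiplicity 5 x"
    using x p by (simp add: prime_elem_multiplicity_mult_distrib)
  moreover have "multiplicity 5 (5 * (y * y)) = Suc (2 * multiplicity 5 y)"
    using y p by (simp add: prime_elem_multiplicity_mult_distrib)
  ultimately have "2 * multiplicity 5 x = Suc (2 * multiplicity 5 y)" using assms by simp
  then show False by presburger
qed

lemma emb_norm_int:
  "emb1 x * emb2 x = of_int (zre x * zre x + zre x * zphi_coeff x - zphi_coeff x * zphi_coeff x)"
proof -
  have "emb1 x * emb2 x = of_int (zre x) * of_int (zre x)
      + of_int (zre x) * of_int (zphi_coeff x) * (gphi + gpsi)
      + of_int (zphi_coeff x) * of_int (zphi_coeff x) * (gphi * gpsi)"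
    unfolding emb1_def emb2_def by (simp add: algebra_simps)
  then show ?thesis unfolding gphi_add_gpsi gphi_mult_gpsi by simp
qed

lemma emb_norm_ge_1:
  assumes "x \<noteq> 0"
  shows "1 \<le> \<bar>emb1 x\<bar> * \<bar>emb2 x\<bar>"
proof -
  let ?n = "zre x * zre x + zre x * zphi_coeff x - zphi_coeff x * zphi_coeff x"
  have "?n \<noteq> 0"
  proof
    assume n: "?n = 0"
    \<comment> \<open>Completing the square: four times the norm form a^2 + a b - b^2 is (2 a + b)^2
      - 5 b^2.\<close>
    then have "(2 * zre x + zphi_coeff x) * (2 * zre x + zphi_coeff x) = 5 * (zphi_coeff x * zphi_coeff x)"
      by (simp add: algebra_simps)
    then have "zphi_coeff x = 0" by (rule square_eq_5_square)
    then show False using n assms by (cases x) (simp add: zero_zphi_def)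
  qed
  then have "1 \<le> \<bar>?n\<bar>" by simp
  then have "1 \<le> \<bar>emb1 x * emb2 x\<bar>" unfolding emb_norm_int by linarith
  then show ?thesis by (simp add: abs_mult)
qed

instance zphi :: idom
proof
  fix x y :: zphi assume "x \<noteq> 0" "y \<noteq> 0"
  then have "emb1 x \<noteq> 0" "emb1 y \<noteq> 0" using emb_norm_ge_1 by fastforce+
  then have "emb1 (x * y) \<noteq> 0" by simp
  then show "x * y \<noteq> 0" by (metis emb_0(1))
qed

instance zphi :: ring_char_0
proof (standard, rule injI)
  fix m n assume "of_nat m = (of_nat n :: zphi)"
  then have "emb1 (of_nat m) = emb1 (of_nat n)" by simp
  then show "m = n" by simp
qed

text \<open>The house of an algebraic integer. It is at least 1 on nonzero elements, and a small
  first embedding is excluded by \<open>emb1_lower\<close>, a Liouville inequality.\<close>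

definition nrm :: "zphi \<Rightarrow> real" where "nrm x = max \<bar>emb1 x\<bar> \<bar>emb2 x\<bar>"

lemma nrm_0 [simp]: "nrm 0 = 0" and nrm_1 [simp]: "nrm 1 = 1" and nrm_of_nat [simp]: "nrm (of_nat n) = of_nat n"
  and nrm_of_int [simp]: "nrm (of_int k) = \<bar>of_int k\<bar>" and nrm_uminus [simp]: "nrm (- x) = nrm x"
  by (simp_all add: nrm_def)

lemma nrm_nonneg [simp]: "0 \<le> nrm x" by (simp add: nrm_def le_max_iff_disj)

lemma emb_le_nrm: "\<bar>emb1 x\<bar> \<le> nrm x" "\<bar>emb2 x\<bar> \<le> nrm x" by (simp_all add: nrm_def)

lemma nrm_add: "nrm (x + y) \<le> nrm x + nrm y"
  unfolding nrm_def emb_add by (intro max.boundedI) (auto simp: max_def)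

lemma nrm_sum: "nrm (\<Sum>x\<in>S. f x) \<le> (\<Sum>x\<in>S. nrm (f x))"
  by (induction S rule: infinite_finite_induct) (auto intro: order_trans[OF nrm_add])

lemma nrm_mult: "nrm (x * y) \<le> nrm x * nrm y"
  unfolding nrm_def emb_mult abs_mult by (intro max.boundedI mult_mono) auto

lemma nrm_ge_1: "x \<noteq> 0 \<Longrightarrow> 1 \<le> nrm x"
proof (rule ccontr)
  assume x: "x \<noteq> 0" and "\<not> 1 \<le> nrm x"
  then have "\<bar>emb1 x\<bar> < 1" "\<bar>emb2 x\<bar> < 1" by (auto simp: nrm_def)
  then have "\<bar>emb1 x\<bar> * \<bar>emb2 x\<bar> < 1 * 1" by (intro mult_strict_mono) auto
  then show False using emb_norm_ge_1[OF x] by simp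
qed

lemma emb1_lower: "x \<noteq> 0 \<Longrightarrow> 1 \<le> \<bar>emb1 x\<bar> * nrm x"
  using emb_norm_ge_1[of x] mult_left_mono[OF emb_le_nrm(2)[of x], of "\<bar>emb1 x\<bar>"] by linarith

subsection \<open>Lengths and degrees of polynomials\<close>

text \<open>The length, not the height: the sum of the houses is submultiplicative without any
  factor depending on the degree.\<close>

definition sz :: "('k \<Rightarrow>\<^sub>0 zphi) \<Rightarrow> real" where
  "sz F = (\<Sum>I\<in>keys F. nrm (lookup F I))"

lemma sz_superset: "finite S \<Longrightarrow> keys F \<subseteq> S \<Longrightarrow> sz F = (\<Sum>I\<in>S. nrm (lookup F I))"
  unfolding sz_def by (rule sum.mono_neutral_left) (auto simp: in_keys_iff)

lemma sz_nonneg [simp]: "0 \<le> sz F" by (simp add: sz_def sum_nonneg)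

lemma sz_0 [simp]: "sz 0 = 0" by (simp add: sz_def)

lemma sz_single [simp]: "sz (Poly_Mapping.single I a) = nrm a" by (simp add: sz_def)

lemma sz_1 [simp]: "sz (1 :: 'k::zero \<Rightarrow>\<^sub>0 zphi) = 1"
  by (simp add: single_one[symmetric] del: single_one)

lemma sz_add: "sz (F + G) \<le> sz F + sz G"
proof -
  let ?S = "keys F \<union> keys G"
  have "keys (F + G) \<subseteq> ?S" by (rule keys_add)
  then show ?thesis
    by (simp add: sz_superset[of ?S] lookup_add sum.distrib[symmetric] sum_mono nrm_add)
qed

lemma sz_sum: "sz (\<Sum>x\<in>S. F x) \<le> (\<Sum>x\<in>S. sz (F x))"
  by (induction S rule: infinite_finite_induct) (auto intro: order_trans[OF sz_add])

lemma sz_mult: "sz (F * G) \<le> sz F * sz G"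
proof -
  have "sz (F * G) \<le> (\<Sum>k\<in>keys F. \<Sum>m\<in>keys G. nrm (lookup F k * lookup G m))"
    unfolding mult_eq_sum_single by (intro order_trans[OF sz_sum] sum_mono) simp
  also have "\<dots> \<le> (\<Sum>k\<in>keys F. \<Sum>m\<in>keys G. nrm (lookup F k) * nrm (lookup G m))"
    by (intro sum_mono nrm_mult)
  finally show ?thesis by (simp add: sz_def sum_product)
qed

lemma sz_prod: "sz (\<Prod>x\<in>S. F x :: 'k::comm_monoid_add \<Rightarrow>\<^sub>0 zphi) \<le> (\<Prod>x\<in>S. sz (F x))"
  by (induction S rule: infinite_finite_induct) (auto intro!: order_trans[OF sz_mult] mult_left_mono)

lemma sz_power: "sz ((F :: 'k::comm_monoid_add \<Rightarrow>\<^sub>0 zphi) ^ n) \<le> sz F ^ n"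
  by (induction n) (auto intro!: order_trans[OF sz_mult] mult_left_mono)

lemma sz_opr_le:
  assumes "\<And>I. I \<in> keys F \<Longrightarrow> nrm (Q I) \<le> B"
  shows "sz (opr Q F) \<le> B * sz F"
proof -
  have "sz (opr Q F) = (\<Sum>I\<in>keys F. nrm (Q I * lookup F I))"
    by (subst sz_superset[OF finite_keys keys_opr]) simp
  also have "\<dots> \<le> (\<Sum>I\<in>keys F. B * nrm (lookup F I))"
    using assms by (intro sum_mono order_trans[OF nrm_mult] mult_right_mono) auto
  finally show ?thesis by (simp add: sz_def sum_distrib_left)
qed

lemma sz_ge_1: "F \<noteq> 0 \<Longrightarrow> 1 \<le> sz F"
proof -
  assume "F \<noteq> 0"
  then obtain I where I: "I \<in> keys F" using keys_eq_empty by blast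
  then have "1 \<le> nrm (lookup F I)" by (intro nrm_ge_1) (simp add: in_keys_iff)
  also have "\<dots> \<le> sz F" unfolding sz_def by (rule member_le_sum) (use I in auto)
  finally show ?thesis .
qed

lemma nrm_lookup_le_sz: "nrm (lookup F I) \<le> sz F"
proof (cases "I \<in> keys F")
  case True
  then show ?thesis unfolding sz_def by (intro member_le_sum) auto
qed (simp add: in_keys_iff)

lemma sz_dt:
  fixes f :: "nat \<Rightarrow> nat \<Rightarrow> zphi mpoly"
  assumes "\<And>i j. i < l \<Longrightarrow> j < l \<Longrightarrow> sz (f i j) \<le> B"
  shows "sz (dt l f) \<le> fact l * B ^ l"
proof -
  have "sz (signof \<pi> * (\<Prod>i<l. f i (\<pi> i))) \<le> B ^ l" if "\<pi> permutes {0..<l}" for \<pi>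
  proof -
    have \<pi>: "\<pi> permutes {..<l}" using that by (simp add: atLeast0LessThan)
    have "sz (\<Prod>i<l. f i (\<pi> i)) \<le> (\<Prod>i<l. sz (f i (\<pi> i)))" by (rule sz_prod)
    also have "\<dots> \<le> (\<Prod>i<l. B)"
      using permutes_in_image[OF \<pi>] by (intro prod_mono conjI assms) auto
    finally have "sz (\<Prod>i<l. f i (\<pi> i)) \<le> B ^ l" by simp
    moreover have "sz (- F) = sz F" for F :: "zphi mpoly" by (simp add: sz_def)
    ultimately show ?thesis by (auto simp: sign_def)
  qed
  then have "sz (dt l f) \<le> (\<Sum>\<pi>\<in>{\<pi>. \<pi> permutes {0..<l}}. B ^ l)"
    unfolding dt_eq_sum by (intro order_trans[OF sz_sum] sum_mono) auto
  also have "\<dots> = fact l * B ^ l" by (simp add: card_permutations)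
  finally show ?thesis .
qed

text \<open>The bounds are real since degrees will be measured as multiples of real scales such as
  \<open>L * Dv c\<close>.\<close>

definition dg :: "(nat \<Rightarrow> real) \<Rightarrow> 'a::zero mpoly \<Rightarrow> bool" where
  "dg \<delta> F \<longleftrightarrow> (\<forall>I\<in>keys F. \<forall>c. real (lookup I c) \<le> \<delta> c)"

lemma dg_0 [simp]: "dg \<delta> 0" by (simp add: dg_def)

lemma dg_sum:
  fixes F :: "'b \<Rightarrow> 'a::comm_monoid_add mpoly"
  assumes "\<And>x. x \<in> S \<Longrightarrow> dg \<delta> (F x)"
  shows "dg \<delta> (\<Sum>x\<in>S. F x)"
  using assms
proof (induction S rule: infinite_finite_induct)
  case (insert x S)
  then show ?case using keys_add[of "F x" "\<Sum>x\<in>S. F x"] by (fastforce simp: dg_def)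
qed simp_all

lemma dg_mult:
  fixes F G :: "'a::comm_ring_1 mpoly"
  shows "dg \<delta> F \<Longrightarrow> dg \<epsilon> G \<Longrightarrow> dg (\<lambda>c. \<delta> c + \<epsilon> c) (F * G)"
  unfolding dg_def
proof (intro ballI allI)
  fix I c
  assume *: "\<forall>I\<in>keys F. \<forall>c. real (lookup I c) \<le> \<delta> c" "\<forall>I\<in>keys G. \<forall>c. real (lookup I c) \<le> \<epsilon> c"
    and "I \<in> keys (F * G)"
  then obtain a b where "I = a + b" "a \<in> keys F" "b \<in> keys G" using keys_mult by blast
  then show "real (lookup I c) \<le> \<delta> c + \<epsilon> c" using * by (simp add: lookup_add add_mono)
qed

lemma dg_1: "dg (\<lambda>_. 0) (1 :: 'a::comm_ring_1 mpoly)"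
  by (simp add: dg_def)

lemma dg_prod:
  fixes F :: "'b \<Rightarrow> 'a::comm_ring_1 mpoly"
  assumes "\<And>x. x \<in> S \<Longrightarrow> dg (\<delta> x) (F x)"
  shows "dg (\<lambda>c. \<Sum>x\<in>S. \<delta> x c) (\<Prod>x\<in>S. F x)"
  using assms by (induction S rule: infinite_finite_induct) (simp_all add: dg_1 dg_mult)

lemma dg_dt:
  fixes f :: "nat \<Rightarrow> nat \<Rightarrow> 'a::comm_ring_1 mpoly"
  assumes "\<And>i j. i < l \<Longrightarrow> j < l \<Longrightarrow> dg \<delta> (f i j)"
  shows "dg (\<lambda>c. real l * \<delta> c) (dt l f)"
  unfolding dt_eq_sum
proof (rule dg_sum)
  fix \<pi> assume "\<pi> \<in> {\<pi>. \<pi> permutes {0..<l}}"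
  then have \<pi>: "\<pi> permutes {..<l}" by (simp add: atLeast0LessThan)
  have "dg (\<lambda>c. \<Sum>i<l. \<delta> c) (\<Prod>i<l. f i (\<pi> i))"
    using permutes_in_image[OF \<pi>] by (intro dg_prod assms) auto
  then have *: "dg (\<lambda>c. real l * \<delta> c) (\<Prod>i<l. f i (\<pi> i))" by simp
  have "keys (- F) = keys F" for F :: "'a mpoly" by (auto simp: in_keys_iff)
  then have "dg (\<lambda>c. real l * \<delta> c) (- (\<Prod>i<l. f i (\<pi> i)))"
    using * unfolding dg_def by simp
  then show "dg (\<lambda>c. real l * \<delta> c) (signof \<pi> * (\<Prod>i<l. f i (\<pi> i)))"
    using * by (simp add: sign_def)
qed

lemma dg_opr: "dg \<delta> F \<Longrightarrow> dg \<delta> (opr Q F)"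
  using keys_opr[of Q F] by (auto simp: dg_def)

subsection \<open>Generalised Wronskians\<close>

lemma dt_transpose: "dt l (\<lambda>i j. f j i) = dt l f"
proof -
  have "transpose_mat (mat l l (\<lambda>(i, j). f i j)) = mat l l (\<lambda>(i, j). f j i)"
    by (intro eq_matI) auto
  then show ?thesis using det_transpose[of "mat l l (\<lambda>(i, j). f i j)" l] by (simp add: dt_def)
qed

lemma dt_adj_ex:
  "\<exists>g. (\<forall>i<l. \<forall>j<l. (\<Sum>k<l. f i k * g k j) = (if i = j then dt l f else 0)) \<and>
    (\<forall>i<l. \<forall>j<l. (\<Sum>k<l. g i k * f k j) = (if i = j then dt l f else 0)) \<and>
    (\<forall>b<l. \<forall>r. dt l (f(b := r)) = (\<Sum>k<l. r k * g k b))"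
proof (rule dt_adjE[of l f])
  fix g
  assume "\<And>i j. i < l \<Longrightarrow> j < l \<Longrightarrow> (\<Sum>k<l. f i k * g k j) = (if i = j then dt l f else 0)"
    "\<And>i j. i < l \<Longrightarrow> j < l \<Longrightarrow> (\<Sum>k<l. g i k * f k j) = (if i = j then dt l f else 0)"
    "\<And>r b. b < l \<Longrightarrow> dt l (f(b := r)) = (\<Sum>k<l. r k * g k b)"
  then show ?thesis by (intro exI[of _ g] conjI allI impI)
qed

lemma dt_1: "dt (Suc 0) f = f 0 0"
  unfolding dt_def by (subst det_single) auto

text \<open>Kronecker substitution: the new variable gets a coefficient \<open>B\<close> above all
  earlier values on \<open>X\<close>, so division with remainder by \<open>B\<close> recovers the
  exponents.\<close>

lemma injective_linear_form:
  fixes X :: "mon set"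
  assumes "finite A" "finite X"
  shows "\<exists>\<gamma>::nat \<Rightarrow> nat. \<forall>I\<in>X. \<forall>J\<in>X.
    (\<Sum>c\<in>A. \<gamma> c * lookup I c) = (\<Sum>c\<in>A. \<gamma> c * lookup J c) \<longrightarrow> (\<forall>c\<in>A. lookup I c = lookup J c)"
  using assms(1)
proof (induction A rule: finite_induct)
  case (insert c A)
  then obtain \<gamma> :: "nat \<Rightarrow> nat" where \<gamma>: "\<And>I J. I \<in> X \<Longrightarrow> J \<in> X \<Longrightarrow>
    (\<Sum>c\<in>A. \<gamma> c * lookup I c) = (\<Sum>c\<in>A. \<gamma> c * lookup J c) \<Longrightarrow> \<forall>c\<in>A. lookup I c = lookup J c"
    by blast
  define e where "e I = (\<Sum>c\<in>A. \<gamma> c * lookup I c)" for I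
  define B where "B = Suc (Max (e ` X \<union> {0}))"
  have less: "e I < B" if "I \<in> X" for I
    unfolding B_def less_Suc_eq_le using that assms(2) by (intro Max_ge) auto
  define \<gamma>' where "\<gamma>' = \<gamma>(c := B)"
  have e': "(\<Sum>d\<in>insert c A. \<gamma>' d * lookup I d) = B * lookup I c + e I" for I
  proof -
    have "(\<Sum>d\<in>A. \<gamma>' d * lookup I d) = e I"
      unfolding e_def \<gamma>'_def using insert.hyps by (intro sum.cong) auto
    then show ?thesis using insert.hyps by (simp add: \<gamma>'_def)
  qed
  show ?case
  proof (intro exI[of _ \<gamma>'] ballI impI)
    fix I J d assume IJ: "I \<in> X" "J \<in> X"
      and eq: "(\<Sum>d\<in>insert c A. \<gamma>' d * lookup I d) = (\<Sum>d\<in>insert c A. \<gamma>' d * lookup J d)"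
      and d: "d \<in> insert c A"
    have "B * lookup I c + e I = B * lookup J c + e J" using eq unfolding e' .
    then have "(B * lookup I c + e I) div B = (B * lookup J c + e J) div B"
      "(B * lookup I c + e I) mod B = (B * lookup J c + e J) mod B" by simp_all
    then have "lookup I c = lookup J c" "e I = e J" using less[OF IJ(1)] less[OF IJ(2)] by simp_all
    then show "lookup I d = lookup J d" using \<gamma>[OF IJ] d by (auto simp: e_def)
  qed
qed simp

section \<open>Components of highest weight\<close>

definition piece :: "('k \<Rightarrow> nat) \<Rightarrow> nat \<Rightarrow> ('k \<Rightarrow>\<^sub>0 'a) \<Rightarrow> ('k \<Rightarrow>\<^sub>0 'a::semiring_1)" where
  "piece e n F = opr (\<lambda>K. if e K = n then 1 else 0) F"

definition wle :: "('k \<Rightarrow> nat) \<Rightarrow> nat \<Rightarrow> ('k \<Rightarrow>\<^sub>0 'a::zero) \<Rightarrow> bool" where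
  "wle e n F \<longleftrightarrow> (\<forall>K\<in>keys F. e K \<le> n)"

lemma lookup_piece: "lookup (piece e n F) K = (if e K = n then lookup F K else 0)"
  by (simp add: piece_def)

lemma piece_sum: "piece e n (\<Sum>x\<in>S. F x) = (\<Sum>x\<in>S. piece e n (F x))"
  by (simp add: piece_def opr_sum_right)

lemma wle_sum:
  fixes F :: "'b \<Rightarrow> 'k \<Rightarrow>\<^sub>0 'a::comm_monoid_add"
  assumes "\<And>x. x \<in> S \<Longrightarrow> wle e n (F x)"
  shows "wle e n (\<Sum>x\<in>S. F x)"
  using assms
proof (induction S rule: infinite_finite_induct)
  case (insert x S)
  then show ?case using keys_add[of "F x" "\<Sum>x\<in>S. F x"] by (fastforce simp: wle_def)
qed (simp_all add: wle_def)

lemma lookup_mult_superset: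
  assumes "finite S" "finite T" "keys F \<subseteq> S" "keys G \<subseteq> T"
  shows "lookup (F * G) b = (\<Sum>k\<in>S. \<Sum>m\<in>T. lookup F k * lookup G m when k + m = b)"
proof -
  have "lookup (F * G) b = (\<Sum>k\<in>keys F. \<Sum>m\<in>T. lookup F k * lookup G m when k + m = b)"
    unfolding lookup_mult_eq_sum using assms
    by (intro sum.cong refl sum.mono_neutral_left) (auto simp: in_keys_iff when_def)
  also have "\<dots> = (\<Sum>k\<in>S. \<Sum>m\<in>T. lookup F k * lookup G m when k + m = b)"
    using assms by (intro sum.mono_neutral_left) (auto simp: in_keys_iff when_def intro!: sum.neutral)
  finally show ?thesis .
qed

lemma piece_mult:
  fixes F G :: "'k::comm_monoid_add \<Rightarrow>\<^sub>0 'a::semiring_1"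
  assumes e: "\<And>a b. e (a + b) = e a + e b" and F: "wle e m F" and G: "wle e n G"
  shows "wle e (m + n) (F * G)" "piece e (m + n) (F * G) = piece e m F * piece e n G"
proof -
  show "wle e (m + n) (F * G)"
    unfolding wle_def
  proof
    fix K assume "K \<in> keys (F * G)"
    then obtain a b where "K = a + b" "a \<in> keys F" "b \<in> keys G" using keys_mult by blast
    then show "e K \<le> m + n" using F G by (auto simp: wle_def e intro: add_mono)
  qed
  show "piece e (m + n) (F * G) = piece e m F * piece e n G"
  proof (intro poly_mapping_eqI)
    fix b
    have sub: "keys (piece e m F) \<subseteq> keys F" "keys (piece e n G) \<subseteq> keys G"
      unfolding piece_def by (rule keys_opr)+
    have "lookup (piece e m F * piece e n G) b
      = (\<Sum>k\<in>keys F. \<Sum>l\<in>keys G. lookup (piece e m F) k * lookup (piece e n G) l when k + l = b)"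
      by (rule lookup_mult_superset) (use sub in auto)
    also have "\<dots> = (\<Sum>k\<in>keys F. \<Sum>l\<in>keys G. (if e b = m + n then lookup F k * lookup G l when k + l = b else 0))"
    proof (intro sum.cong refl)
      fix k l assume kl: "k \<in> keys F" "l \<in> keys G"
      have le: "e k \<le> m" "e l \<le> n" using F G kl by (auto simp: wle_def)
      show "(lookup (piece e m F) k * lookup (piece e n G) l when k + l = b)
        = (if e b = m + n then lookup F k * lookup G l when k + l = b else 0)"
      proof (cases "k + l = b")
        case True
        then have "e b = e k + e l" using e by metis
        then have "e b = m + n \<longleftrightarrow> e k = m \<and> e l = n" using le by auto
        then show ?thesis by (auto simp: lookup_piece)
      qed simp
    qed
    also have "\<dots> = lookup (piece e (m + n) (F * G)) b"
      by (simp add: lookup_piece lookup_mult_eq_sum)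
    finally show "lookup (piece e (m + n) (F * G)) b = lookup (piece e m F * piece e n G) b" by simp
  qed
qed

text \<open>Each Leibniz term meets every column once, so all of them are bounded by the same total
  weight, and the top component of each is the product of the top components of its entries.\<close>

lemma piece_dt:
  fixes f :: "nat \<Rightarrow> nat \<Rightarrow> ('k::comm_monoid_add \<Rightarrow>\<^sub>0 'a::comm_ring_1)"
  assumes e: "\<And>a b. e (a + b) = e a + e b"
    and f: "\<And>i j. i < l \<Longrightarrow> j < l \<Longrightarrow> wle e (n j) (f i j)"
  shows "piece e (\<Sum>j<l. n j) (dt l f) = dt l (\<lambda>i j. piece e (n j) (f i j))"
proof -
  have e0: "e 0 = 0" using e[of 0 0] by simp
  have prod: "wle e (\<Sum>i\<in>S. m i) (\<Prod>i\<in>S. h i) \<and>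
      piece e (\<Sum>i\<in>S. m i) (\<Prod>i\<in>S. h i) = (\<Prod>i\<in>S. piece e (m i) (h i))"
    if "finite S" "\<And>i. i \<in> S \<Longrightarrow> wle e (m i) (h i)"
    for S :: "nat set" and m and h :: "nat \<Rightarrow> ('k \<Rightarrow>\<^sub>0 'a)"
    using that
  proof (induction S rule: finite_induct)
    case empty
    have "piece e 0 1 = (1 :: 'k \<Rightarrow>\<^sub>0 'a)"
      by (intro poly_mapping_eqI) (auto simp: lookup_piece lookup_one when_def e0)
    then show ?case by (simp add: wle_def e0)
  next
    case (insert x S)
    then show ?case using piece_mult[OF e, of "m x" "h x" "\<Sum>i\<in>S. m i" "\<Prod>i\<in>S. h i"] by simp
  qed
  have "piece e (\<Sum>j<l. n j) (signof \<pi> * (\<Prod>i<l. f i (\<pi> i))) = signof \<pi> * (\<Prod>i<l. piece e (n (\<pi> i)) (f i (\<pi> i)))"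
    if "\<pi> permutes {0..<l}" for \<pi>
  proof -
    have \<pi>: "\<pi> permutes {..<l}" using that by (simp add: atLeast0LessThan)
    have "(\<Sum>i<l. n (\<pi> i)) = (\<Sum>j<l. n j)" using sum.permute[OF \<pi>, of n] by (simp add: comp_def)
    moreover have "piece e (\<Sum>i<l. n (\<pi> i)) (\<Prod>i<l. f i (\<pi> i)) = (\<Prod>i<l. piece e (n (\<pi> i)) (f i (\<pi> i)))"
      using permutes_in_image[OF \<pi>] by (intro conjunct2[OF prod] f) auto
    ultimately have 1: "piece e (\<Sum>j<l. n j) (\<Prod>i<l. f i (\<pi> i)) = (\<Prod>i<l. piece e (n (\<pi> i)) (f i (\<pi> i)))"
      by simp
    have 2: "piece e m (- F) = - piece e m F" for m and F :: "'k \<Rightarrow>\<^sub>0 'a"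
      by (intro poly_mapping_eqI) (simp add: lookup_piece)
    show ?thesis by (simp add: sign_def 1 2)
  qed
  then show ?thesis unfolding dt_eq_sum piece_sum by (intro sum.cong) auto
qed

lemma keys_dt:
  fixes f :: "nat \<Rightarrow> nat \<Rightarrow> ('k::comm_monoid_add \<Rightarrow>\<^sub>0 'a::comm_ring_1)"
  assumes P: "P 0" "\<And>a b. P a \<Longrightarrow> P b \<Longrightarrow> P (a + b)"
    and f: "\<And>i j K. i < l \<Longrightarrow> j < l \<Longrightarrow> K \<in> keys (f i j) \<Longrightarrow> P K"
    and K: "K \<in> keys (dt l f)"
  shows "P K"
proof -
  have prod: "\<forall>K\<in>keys (\<Prod>i\<in>S. h i). P K" if "\<And>i K. i \<in> S \<Longrightarrow> K \<in> keys (h i) \<Longrightarrow> P K"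
    for S :: "nat set" and h :: "nat \<Rightarrow> ('k \<Rightarrow>\<^sub>0 'a)"
    using that
  proof (induction S rule: infinite_finite_induct)
    case (insert x S)
    show ?case
    proof
      fix K assume "K \<in> keys (\<Prod>i\<in>insert x S. h i)"
      then have "K \<in> keys (h x * (\<Prod>i\<in>S. h i))" using insert.hyps by simp
      then obtain a b where "K = a + b" "a \<in> keys (h x)" "b \<in> keys (\<Prod>i\<in>S. h i)" using keys_mult by blast
      then show "P K" using insert by (auto intro: P)
    qed
  qed (auto simp: P)
  obtain \<pi> where \<pi>: "\<pi> permutes {0..<l}" "K \<in> keys (signof \<pi> * (\<Prod>i<l. f i (\<pi> i)))"
    using K keys_sum[of "\<lambda>p. signof p * (\<Prod>i<l. f i (p i))" "{p. p permutes {0..<l}}"]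
    unfolding dt_eq_sum by auto
  have "keys (- F) = keys F" for F :: "'k \<Rightarrow>\<^sub>0 'a" by (auto simp: in_keys_iff)
  then have "K \<in> keys (\<Prod>i<l. f i (\<pi> i))" using \<pi>(2) by (auto simp: sign_def split: if_splits)
  moreover have "\<forall>K\<in>keys (\<Prod>i<l. f i (\<pi> i)). P K"
  proof (rule prod)
    have \<pi>': "\<pi> permutes {..<l}" using \<pi>(1) by (simp add: atLeast0LessThan)
    fix i K assume "i \<in> {..<l}" "K \<in> keys (f i (\<pi> i))"
    then show "P K" using f[of i "\<pi> i" K] permutes_in_image[OF \<pi>', of i] by simp
  qed
  ultimately show "P K" by blast
qed

text \<open>Combinations with natural coefficients suffice: the form to be expanded has natural
  coefficients, and \<open>var_mult_bin\<close> introduces no signs.\<close>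

inductive bspan :: "nat set \<Rightarrow> nat \<Rightarrow> (mon \<Rightarrow> nat) \<Rightarrow> bool" for A n where
  bin: "keys t \<subseteq> A \<Longrightarrow> wt (\<lambda>_. 1) t \<le> n \<Longrightarrow> bspan A n (\<lambda>I. bin I t)"
| add: "bspan A n p \<Longrightarrow> bspan A n q \<Longrightarrow> bspan A n (\<lambda>I. p I + q I)"
| scale: "bspan A n p \<Longrightarrow> bspan A n (\<lambda>I. k * p I)"

lemma bspan_var:
  assumes "c \<in> A"
  shows "bspan A n q \<Longrightarrow> bspan A (Suc n) (\<lambda>I. lookup I c * q I)"
proof (induction rule: bspan.induct)
  case (bin t)
  have "keys (t + Poly_Mapping.single c 1) \<subseteq> A"
    using keys_add[of t "Poly_Mapping.single c 1"] bin assms by auto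
  then show ?case unfolding var_mult_bin
    using bin by (intro bspan.add bspan.scale bspan.bin) (auto simp: wt_add)
next
  case (add p q)
  show ?case unfolding distrib_left by (rule bspan.add[OF add.IH])
next
  case (scale p k)
  show ?case unfolding mult.left_commute[of _ k] by (rule bspan.scale[OF scale.IH])
qed

lemma bspan_power:
  assumes "finite A"
  shows "bspan A n (\<lambda>I. (\<Sum>c\<in>A. \<gamma> c * lookup I c) ^ n)"
proof (induction n)
  case 0
  then show ?case using bspan.bin[of 0 A 0] by simp
next
  case (Suc n)
  have zero: "bspan A m (\<lambda>I. 0)" for m
    using bspan.scale[OF bspan.bin[of 0 A m], of 0] by simp
  have "bspan A (Suc n) (\<lambda>I. \<Sum>c\<in>B. \<gamma> c * (lookup I c * (\<Sum>c\<in>A. \<gamma> c * lookup I c) ^ n))" if "B \<subseteq> A" for B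
    using finite_subset[OF that assms] that
  proof (induction B rule: finite_induct)
    case (insert c B)
    then show ?case using Suc.IH by (auto intro!: bspan.add bspan.scale bspan_var)
  qed (simp add: zero)
  from this[of A] show ?case by (simp add: sum_distrib_right mult.assoc)
qed

text \<open>Choosing the rows \<open>\<iota>\<close> of a nonzero minor with maximal total weight makes
  the reduced matrix \<open>\<kappa>\<close> triangular, so the leading part of the determinant is a Vandermonde determinant;
  powers of a linear form in the exponents are then exchanged for products of binomial coefficients by
  multilinearity.\<close>

lemma wronskian_nonzero:
  fixes M :: "mon \<Rightarrow> nat \<Rightarrow> 'a::{idom,ring_char_0} mpoly"
  assumes fin: "finite A" "finite X"
    and X: "\<And>I. I \<in> X \<Longrightarrow> keys I \<subseteq> A"
    and M: "\<And>I b K. I \<in> X \<Longrightarrow> b < l \<Longrightarrow> K \<in> keys (M I b) \<Longrightarrow> keys K \<inter> A = {}"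
    and ex: "\<exists>\<iota>. (\<forall>a<l. \<iota> a \<in> X) \<and> dt l (\<lambda>a b. M (\<iota> a) b) \<noteq> 0"
  shows "\<exists>\<alpha>. (\<forall>i<l. keys (\<alpha> i) \<subseteq> A \<and> wt (\<lambda>_. 1) (\<alpha> i) \<le> i) \<and>
    dt l (\<lambda>i b. \<Sum>I\<in>X. M I b * Poly_Mapping.single I (of_nat (bin I (\<alpha> i)))) \<noteq> 0"
proof -
  obtain \<gamma> :: "nat \<Rightarrow> nat" where \<gamma>: "\<And>I J. I \<in> X \<Longrightarrow> J \<in> X \<Longrightarrow>
      (\<Sum>c\<in>A. \<gamma> c * lookup I c) = (\<Sum>c\<in>A. \<gamma> c * lookup J c) \<Longrightarrow> \<forall>c\<in>A. lookup I c = lookup J c"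
    using injective_linear_form[OF fin] by blast
  define e where "e I = (\<Sum>c\<in>A. \<gamma> c * lookup I c)" for I :: mon
  have e_add: "e (a + b) = e a + e b" for a b
    by (simp add: e_def lookup_add distrib_left sum.distrib)
  have e_inj: "I = J" if "I \<in> X" "J \<in> X" "e I = e J" for I J
  proof (intro poly_mapping_eqI)
    fix c
    show "lookup I c = lookup J c"
    proof (cases "c \<in> A")
      case True then show ?thesis using \<gamma>[of I J] that by (simp add: e_def)
    next
      case False
      then have "c \<notin> keys I" "c \<notin> keys J" using X that by blast+
      then show ?thesis by (simp add: in_keys_iff)
    qed
  qed
  have e_M: "e K = 0" if "keys K \<inter> A = {}" for K
    unfolding e_def using that by (intro sum.neutral) (auto simp: in_keys_iff disjoint_iff)
  let ?P = "\<lambda>\<iota>. (\<forall>a<l. \<iota> a \<in> X) \<and> dt l (\<lambda>a b. M (\<iota> a) b) \<noteq> 0"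
  have bound: "(\<Sum>a<l. e (\<iota> a)) < Suc (l * Max (e ` X))" if "?P \<iota>" for \<iota>
  proof -
    have "(\<Sum>a<l. e (\<iota> a)) \<le> (\<Sum>a<l. Max (e ` X))"
      using that fin by (intro sum_mono Max_ge) auto
    then show ?thesis by simp
  qed
  obtain \<iota> where \<iota>: "?P \<iota>" and max: "\<And>\<iota>'. ?P \<iota>' \<Longrightarrow> (\<Sum>a<l. e (\<iota>' a)) \<le> (\<Sum>a<l. e (\<iota> a))"
  proof -
    obtain \<iota>0 where "?P \<iota>0" using ex by (elim exE)
    then have "\<exists>x. ?P x \<and> (\<forall>y. ?P y \<longrightarrow> (\<Sum>a<l. e (y a)) \<le> (\<Sum>a<l. e (x a)))"
      by (rule ex_has_greatest_nat[of ?P \<iota>0 _ "Suc (l * Max (e ` X))"]) (intro allI impI bound)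
    then obtain x where "?P x" "\<And>y. ?P y \<Longrightarrow> (\<Sum>a<l. e (y a)) \<le> (\<Sum>a<l. e (x a))"
      by (elim exE conjE) blast
    then show thesis by (rule that)
  qed
  define D where "D = dt l (\<lambda>a b. M (\<iota> a) b)"
  have D0: "D \<noteq> 0" and \<iota>X: "\<And>a. a < l \<Longrightarrow> \<iota> a \<in> X" using \<iota> by (auto simp: D_def)
  obtain g where g1: "\<And>i j. i < l \<Longrightarrow> j < l \<Longrightarrow> (\<Sum>k<l. M (\<iota> i) k * g k j) = (if i = j then D else 0)"
    and g2: "\<And>r b. b < l \<Longrightarrow> dt l ((\<lambda>a b. M (\<iota> a) b)(b := r)) = (\<Sum>k<l. r k * g k b)"
  proof -
    obtain g where "\<forall>i<l. \<forall>j<l. (\<Sum>k<l. M (\<iota> i) k * g k j) = (if i = j then D else 0)"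
      "\<forall>b<l. \<forall>r. dt l ((\<lambda>a b. M (\<iota> a) b)(b := r)) = (\<Sum>k<l. r k * g k b)"
      using dt_adj_ex[of l "\<lambda>a b. M (\<iota> a) b"] unfolding D_def by (elim exE conjE)
    then show thesis by (intro that[of g]) blast+
  qed
  \<comment> \<open>The matrix \<open>M\<close> multiplied by the adjugate of the chosen rows. By
    \<open>\<kappa>_dt\<close>, an entry is the minor in which row \<open>I\<close> replaces row
    \<open>\<iota> b\<close>.\<close>
  define \<kappa> where "\<kappa> I b = (\<Sum>k<l. M I k * g k b)" for I b
  have \<kappa>_dt: "\<kappa> I b = dt l (\<lambda>a. M ((\<iota>(b := I)) a))" if "b < l" for I b
  proof -
    have "(\<lambda>a. M ((\<iota>(b := I)) a)) = (\<lambda>a b. M (\<iota> a) b)(b := M I)" by (auto simp: fun_eq_iff)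
    then show ?thesis unfolding \<kappa>_def using g2[OF that, of "M I"] by simp
  qed
  have \<kappa>_keys: "e K = 0" if "b < l" "I \<in> X" "K \<in> keys (\<kappa> I b)" for I b K
  proof (rule e_M, rule keys_dt[where P = "\<lambda>K. keys K \<inter> A = {}"])
    show "K \<in> keys (dt l (\<lambda>a. M ((\<iota>(b := I)) a)))" using that \<kappa>_dt by simp
    show "keys (a + b) \<inter> A = {}" if "keys a \<inter> A = {}" "keys b \<inter> A = {}" for a b :: mon
      using that keys_add[of a b] by blast
    show "keys K \<inter> A = {}" if "i < l" "j < l" "K \<in> keys (M ((\<iota>(b := I)) i) j)" for i j K
      using that M[of "(\<iota>(b := I)) i" j K] \<iota>X \<open>I \<in> X\<close> by (auto split: if_splits)
  qed simp
  \<comment> \<open>A nonzero entry is a nonzero minor, so by maximality exchanging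
    \<open>\<iota> b\<close> for \<open>I\<close> cannot raise the total weight.\<close>
  have \<kappa>_le: "e I \<le> e (\<iota> b)" if b: "b < l" "I \<in> X" "\<kappa> I b \<noteq> 0" for I b
  proof -
    have "(\<Sum>a<l. e ((\<iota>(b := I)) a)) \<le> (\<Sum>a<l. e (\<iota> a))"
      using b \<iota>X \<kappa>_dt[OF b(1), of I] by (intro max) auto
    moreover have "(\<Sum>a<l. e ((\<iota>(b := I)) a)) = e I + (\<Sum>a\<in>{..<l} - {b}. e (\<iota> a))"
      using b(1) by (subst sum.remove[of _ b]) (auto intro!: sum.cong)
    moreover have "(\<Sum>a<l. e (\<iota> a)) = e (\<iota> b) + (\<Sum>a\<in>{..<l} - {b}. e (\<iota> a))"
      using b(1) by (subst sum.remove[of _ b]) auto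
    ultimately show ?thesis by simp
  qed
  have \<iota>_inj: "inj_on \<iota> {..<l}"
  proof (rule inj_onI, rule ccontr)
    fix a b assume "a \<in> {..<l}" "b \<in> {..<l}" "\<iota> a = \<iota> b" "a \<noteq> b"
    then have "D = 0" unfolding D_def by (intro dt_eq_0_equal_rows[of a l b]) auto
    then show False using D0 by simp
  qed
  \<comment> \<open>Since \<open>\<kappa>\<close> has weight 0, column \<open>b\<close> has weight
    at most \<open>e (\<iota> b)\<close>; only the term \<open>I = \<iota> b\<close> reaches it, as
    \<open>e\<close> is injective on \<open>X\<close>, and there \<open>\<kappa>\<close> equals
    \<open>D\<close>.\<close>
  define P where "P i b = (\<Sum>I\<in>X. \<kappa> I b * Poly_Mapping.single I (of_nat (e I ^ i)))" for i b
  have P_key: "e K = e I" if "b < l" "I \<in> X" "K \<in> keys (\<kappa> I b * Poly_Mapping.single I c)" for I b K c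
  proof -
    have "\<exists>x y. K = x + y \<and> x \<in> keys (\<kappa> I b) \<and> y \<in> keys (Poly_Mapping.single I c)"
      using keys_mult that(3) by blast
    then obtain x y where "K = x + y" "x \<in> keys (\<kappa> I b)" "y \<in> keys (Poly_Mapping.single I c)"
      by blast
    then show ?thesis using \<kappa>_keys[OF that(1,2)] by (auto simp: e_add split: if_splits)
  qed
  have wleP: "wle e (e (\<iota> b)) (P i b)" if "b < l" for i b
    unfolding P_def
  proof (rule wle_sum)
    fix I assume I: "I \<in> X"
    show "wle e (e (\<iota> b)) (\<kappa> I b * Poly_Mapping.single I (of_nat (e I ^ i)))"
      using P_key[OF that I] \<kappa>_le[OF that I] by (cases "\<kappa> I b = 0") (auto simp: wle_def)
  qed
  have pieceP: "piece e (e (\<iota> b)) (P i b) = (D * Poly_Mapping.single (\<iota> b) 1) * of_nat (e (\<iota> b)) ^ i"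
    if b: "b < l" for i b
  proof -
    have "piece e (e (\<iota> b)) (P i b)
      = (\<Sum>I\<in>X. if I = \<iota> b then \<kappa> I b * Poly_Mapping.single I (of_nat (e I ^ i)) else 0)"
      unfolding P_def piece_sum
    proof (intro sum.cong refl)
      fix I assume I: "I \<in> X"
      let ?t = "\<kappa> I b * Poly_Mapping.single I (of_nat (e I ^ i))"
      have "lookup (piece e (e (\<iota> b)) ?t) K = (if I = \<iota> b then lookup ?t K else 0)" for K
        using P_key[OF b I, of K "of_nat (e I ^ i)"] e_inj[OF I \<iota>X[OF b]]
        by (cases "K \<in> keys ?t") (auto simp: lookup_piece in_keys_iff)
      then show "piece e (e (\<iota> b)) ?t = (if I = \<iota> b then ?t else 0)"
        by (intro poly_mapping_eqI) simp
    qed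
    also have "\<dots> = \<kappa> (\<iota> b) b * Poly_Mapping.single (\<iota> b) (of_nat (e (\<iota> b) ^ i))"
      using fin \<iota>X[OF b] by simp
    also have "\<kappa> (\<iota> b) b = D" using g1[OF b b] by (simp add: \<kappa>_def)
    also have "Poly_Mapping.single (\<iota> b) (of_nat (e (\<iota> b) ^ i))
        = Poly_Mapping.single (\<iota> b) 1 * Poly_Mapping.single 0 (of_nat (e (\<iota> b) ^ i) :: 'a)"
      by (simp add: mult_single del: single_of_nat)
    also have "Poly_Mapping.single 0 (of_nat (e (\<iota> b) ^ i) :: 'a) = of_nat (e (\<iota> b)) ^ i"
      by (rule trans[OF single_of_nat of_nat_power])
    finally show ?thesis by (simp add: mult.assoc)
  qed
  have "dt l P \<noteq> 0"
  proof
    assume "dt l P = 0"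
    then have "0 = piece e (\<Sum>b<l. e (\<iota> b)) (dt l P)" by (simp add: piece_def)
    also have "\<dots> = dt l (\<lambda>i b. piece e (e (\<iota> b)) (P i b))"
      by (rule piece_dt) (use wleP e_add in auto)
    also have "\<dots> = dt l (\<lambda>i b. (D * Poly_Mapping.single (\<iota> b) 1) * of_nat (e (\<iota> b)) ^ i)"
      by (rule dt_cong) (simp add: pieceP)
    also have "\<dots> = (\<Prod>b<l. D * Poly_Mapping.single (\<iota> b) 1) * dt l (\<lambda>i b. of_nat (e (\<iota> b)) ^ i)"
      by (rule dt_scale_cols)
    finally have "(\<Prod>b<l. D * Poly_Mapping.single (\<iota> b) 1) = 0 \<or>
        dt l (\<lambda>i b. of_nat (e (\<iota> b)) ^ i :: 'a mpoly) = 0" by simp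
    moreover have "(\<Prod>b<l. D * Poly_Mapping.single (\<iota> b) (1 :: 'a)) \<noteq> 0"
    proof -
      have "Poly_Mapping.single J (1 :: 'a) \<noteq> 0" for J :: mon
        by (metis lookup_single_eq lookup_zero zero_neq_one)
      then show ?thesis using D0 by simp
    qed
    moreover have "dt l (\<lambda>i b. of_nat (e (\<iota> b)) ^ i :: 'a mpoly) \<noteq> 0"
    proof (rule dt_vandermonde_neq_0, rule inj_onI)
      fix a b assume "a \<in> {..<l}" "b \<in> {..<l}" "of_nat (e (\<iota> a)) = (of_nat (e (\<iota> b)) :: 'a mpoly)"
      then have "\<iota> a = \<iota> b" using e_inj \<iota>X by simp
      then show "a = b" using \<iota>_inj \<open>a \<in> _\<close> \<open>b \<in> _\<close> by (auto dest: inj_onD)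
    qed
    ultimately show False by blast
  qed
  define R where "R q b = (\<Sum>I\<in>X. M I b * Poly_Mapping.single I (of_nat (q I)))" for q :: "mon \<Rightarrow> nat" and b
  have "dt l P = dt l (\<lambda>i. R (\<lambda>I. e I ^ i)) * dt l g"
    unfolding dt_mult P_def R_def \<kappa>_def
    unfolding sum_distrib_right
    by (rule dt_cong, subst sum.swap) (intro sum.cong refl, simp add: ac_simps)
  then have R0: "dt l (\<lambda>i. R (\<lambda>I. e I ^ i)) \<noteq> 0" using \<open>dt l P \<noteq> 0\<close> by auto
  let ?ok = "\<lambda>i t. keys t \<subseteq> A \<and> wt (\<lambda>_. 1 :: nat) t \<le> i"
  \<comment> \<open>Rows are exchanged one at a time: the first \<open>n\<close> already carry
    binomials, the others still carry powers of \<open>e\<close>.\<close>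
  have "\<exists>\<alpha>. (\<forall>i<n. ?ok i (\<alpha> i)) \<and>
      dt l (\<lambda>i. if i < n then R (\<lambda>I. bin I (\<alpha> i)) else R (\<lambda>I. e I ^ i)) \<noteq> 0" if "n \<le> l" for n
    using that
  proof (induction n)
    case 0
    then show ?case using R0 by simp
  next
    case (Suc n)
    then have "n \<le> l" by simp
    from Suc.IH[OF this] obtain \<alpha> where \<alpha>: "\<forall>i<n. ?ok i (\<alpha> i)"
      and nz: "dt l (\<lambda>i. if i < n then R (\<lambda>I. bin I (\<alpha> i)) else R (\<lambda>I. e I ^ i)) \<noteq> 0"
      by (elim exE conjE)
    define f where "f = (\<lambda>i. if i < n then R (\<lambda>I. bin I (\<alpha> i)) else R (\<lambda>I. e I ^ i))"
    obtain h where h: "\<And>r. dt l (f(n := r)) = (\<Sum>k<l. r k * h k n)"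
    proof -
      obtain h where "\<forall>b<l. \<forall>r. dt l (f(b := r)) = (\<Sum>k<l. r k * h k b)"
        using dt_adj_ex[of l f] by (elim exE conjE)
      then show thesis using Suc.prems by (intro that[of h]) simp
    qed
    have "\<exists>t. ?ok n t \<and> dt l (f(n := R (\<lambda>I. bin I t))) \<noteq> 0"
    proof (rule ccontr)
      assume neg: "\<not> ?thesis"
      \<comment> \<open>The determinant is linear in row \<open>n\<close>. Vanishing for all
        binomials of order at most \<open>n\<close> would pass to their span, which contains the
        \<open>n\<close>-th power of \<open>e\<close>.\<close>
      have "dt l (f(n := R q)) = 0" if "bspan A n q" for q
        using that
      proof (induction rule: bspan.induct)
        case (bin t)
        then show ?case using neg by blast
      next
        case (add p q)
        have "R (\<lambda>I. p I + q I) k = R p k + R q k" for k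
          by (simp add: R_def single_add distrib_left sum.distrib)
        then show ?case using add.IH unfolding h by (simp only: distrib_right sum.distrib) simp
      next
        case (scale p j)
        have "R (\<lambda>I. j * p I) k = of_nat j * R p k" for k
        proof -
          have "Poly_Mapping.single I (of_nat (j * p I)) = of_nat j * Poly_Mapping.single I (of_nat (p I) :: 'a)" for I
            by (simp add: mult_single single_of_nat[symmetric] del: single_of_nat)
          then show ?thesis by (simp add: R_def sum_distrib_left ac_simps)
        qed
        then show ?case using scale.IH unfolding h by (simp only: mult.assoc sum_distrib_left[symmetric]) simp
      qed
      from this[OF bspan_power[OF fin(1), of n \<gamma>]]
      have "dt l (f(n := R (\<lambda>I. e I ^ n))) = 0" by (simp add: e_def)
      moreover have "f(n := R (\<lambda>I. e I ^ n)) = f" by (auto simp: f_def)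
      ultimately show False using nz by (simp only: f_def)
    qed
    then obtain t where t: "?ok n t" "dt l (f(n := R (\<lambda>I. bin I t))) \<noteq> 0" by blast
    have "f(n := R (\<lambda>I. bin I t))
        = (\<lambda>i. if i < Suc n then R (\<lambda>I. bin I ((\<alpha>(n := t)) i)) else R (\<lambda>I. e I ^ i))"
      by (auto simp: f_def fun_eq_iff)
    then have "dt l (\<lambda>i. if i < Suc n then R (\<lambda>I. bin I ((\<alpha>(n := t)) i)) else R (\<lambda>I. e I ^ i)) \<noteq> 0"
      using t(2) by (simp only: not_False_eq_True)
    moreover have "\<forall>i<Suc n. ?ok i ((\<alpha>(n := t)) i)" using t(1) \<alpha> by (simp add: less_Suc_eq)
    ultimately show ?case by (intro exI[of _ "\<alpha>(n := t)"] conjI)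
  qed
  from this[OF order_refl] obtain \<alpha> where \<alpha>: "\<forall>i<l. ?ok i (\<alpha> i)"
    "dt l (\<lambda>i. if i < l then R (\<lambda>I. bin I (\<alpha> i)) else R (\<lambda>I. e I ^ i)) \<noteq> 0"
    by (elim exE conjE)
  have "dt l (\<lambda>i. if i < l then R (\<lambda>I. bin I (\<alpha> i)) else R (\<lambda>I. e I ^ i))
      = dt l (\<lambda>i b. \<Sum>I\<in>X. M I b * Poly_Mapping.single I (of_nat (bin I (\<alpha> i))))"
    by (rule dt_cong) (simp add: R_def)
  then have "dt l (\<lambda>i b. \<Sum>I\<in>X. M I b * Poly_Mapping.single I (of_nat (bin I (\<alpha> i)))) \<noteq> 0"
    using \<alpha>(2) by (simp only: not_False_eq_True)
  with \<alpha>(1) show ?thesis by (intro exI[of _ \<alpha>] conjI)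
qed

subsection \<open>Separation of variables\<close>

definition restr :: "nat set \<Rightarrow> mon \<Rightarrow> mon" where
  "restr A K = Poly_Mapping.mapp (\<lambda>c n. if c \<in> A then n else 0) K"

lemma lookup_restr: "lookup (restr A K) c = (if c \<in> A then lookup K c else 0)"
  by (auto simp: restr_def lookup_mapp when_def in_keys_iff)

lemma keys_restr: "keys (restr A K) \<subseteq> A"
  by (auto simp: in_keys_iff lookup_restr split: if_splits)

lemma restr_split: "restr (- A) K + restr A K = K"
  by (intro poly_mapping_eqI) (simp add: lookup_add lookup_restr)

lemma bin_restr: "keys a \<subseteq> A \<Longrightarrow> bin (restr A K) a = bin K a"
  unfolding bin_def by (intro prod.cong) (auto simp: lookup_restr)

abbreviation disj :: "nat set \<Rightarrow> mon \<Rightarrow> bool" where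
  "disj A K \<equiv> keys K \<inter> A = {}"

lemma disj_iff: "disj A K \<longleftrightarrow> (\<forall>c\<in>A. lookup K c = 0)"
  by (auto simp: in_keys_iff disjoint_iff)

text \<open>With \<open>P = disj A\<close> and \<open>s\<close> supported on \<open>A\<close>, this
  is the coefficient of x^s when \<open>F\<close> is read as a polynomial in the variables of
  \<open>A\<close> over all the others.\<close>

definition slc :: "(mon \<Rightarrow> bool) \<Rightarrow> mon \<Rightarrow> 'a mpoly \<Rightarrow> 'a::zero mpoly" where
  "slc P s F = Abs_poly_mapping (\<lambda>K. if P K then lookup F (K + s) else 0)"

lemma lookup_slc: "lookup (slc P s F) K = (if P K then lookup F (K + s) else 0)"
proof -
  have "finite ((\<lambda>K. K + s) -` keys F)" by (intro finite_vimageI) (auto simp: inj_def)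
  then have "finite {K. (if P K then lookup F (K + s) else 0) \<noteq> 0}"
    by (rule rev_finite_subset) (auto simp: in_keys_iff)
  then show ?thesis unfolding slc_def by (simp add: lookup_Abs_poly_mapping)
qed

lemma keys_slc: "K \<in> keys (slc P s F) \<longleftrightarrow> P K \<and> K + s \<in> keys F"
  by (simp add: in_keys_iff lookup_slc)

lemma sz_slc: "sz (slc P s F) \<le> sz F"
proof -
  have inj: "inj_on (\<lambda>K. K + s) (keys (slc P s F))" by (auto simp: inj_on_def)
  have "sz (slc P s F) = (\<Sum>K\<in>keys (slc P s F). nrm (lookup F (K + s)))"
    unfolding sz_def by (intro sum.cong) (auto simp: keys_slc lookup_slc)
  also have "\<dots> = (\<Sum>K\<in>(\<lambda>K. K + s) ` keys (slc P s F). nrm (lookup F K))"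
    by (simp add: sum.reindex[OF inj])
  also have "\<dots> \<le> sz F"
    unfolding sz_def by (intro sum_mono2) (auto simp: keys_slc)
  finally show ?thesis .
qed

text \<open>Terms of \<open>F\<close> are grouped by their part in \<open>A\<close>. A factor
  attached to each group depends only on that part, hence acts as a diagonal operator.\<close>

lemma sum_slc:
  fixes F :: "'a::comm_ring_1 mpoly"
  assumes "finite X" and X: "\<And>I. I \<in> X \<Longrightarrow> keys I \<subseteq> A" and F: "\<And>K. K \<in> keys F \<Longrightarrow> restr A K \<in> X"
  shows "(\<Sum>I\<in>X. slc (disj A) I F * Poly_Mapping.single I (q I)) = opr (\<lambda>K. q (restr A K)) F"
proof (intro poly_mapping_eqI)
  fix K
  have K: "K = restr (- A) K + restr A K" by (simp add: restr_split)
  have "lookup (slc (disj A) I F * Poly_Mapping.single I (q I)) K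
      = (if I = restr A K then lookup F K * q I else 0)" if I: "I \<in> X" for I
  proof (cases "I = restr A K")
    case True
    have "lookup (slc (disj A) I F * Poly_Mapping.single I (q I)) (restr (- A) K + I)
        = lookup (slc (disj A) I F) (restr (- A) K) * q I" by (rule lookup_mult_single)
    moreover have "disj A (restr (- A) K)" by (simp add: disj_iff lookup_restr)
    ultimately show ?thesis using True K by (simp add: lookup_slc)
  next
    case False
    have "lookup (slc (disj A) I F * Poly_Mapping.single I (q I)) K = 0"
    proof (cases "\<exists>K'. K = K' + I")
      case True
      then obtain K' where K': "K = K' + I" by blast
      have "\<not> disj A K'"
      proof
        assume d: "disj A K'"
        have "I = restr A K"
        proof (intro poly_mapping_eqI)
          fix c
          show "lookup I c = lookup (restr A K) c"
            using d X[OF I] unfolding K' disj_iff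
            by (cases "c \<in> A") (auto simp: lookup_restr lookup_add in_keys_iff subset_iff)
        qed
        then show False using False by simp
      qed
      then show ?thesis unfolding K' lookup_mult_single by (simp add: lookup_slc)
    qed (simp add: lookup_mult_single_eq_0)
    then show ?thesis using False by simp
  qed
  then have "lookup (\<Sum>I\<in>X. slc (disj A) I F * Poly_Mapping.single I (q I)) K
      = (\<Sum>I\<in>X. if I = restr A K then lookup F K * q I else 0)"
    unfolding lookup_sum by (intro sum.cong) auto
  also have "\<dots> = (if restr A K \<in> X then lookup F K * q (restr A K) else 0)"
    using assms(1) by simp
  also have "\<dots> = lookup (opr (\<lambda>K. q (restr A K)) F) K"
    using F[of K] by (cases "K \<in> keys F") (simp_all add: in_keys_iff mult.commute)
  finally show "lookup (\<Sum>I\<in>X. slc (disj A) I F * Poly_Mapping.single I (q I)) K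
      = lookup (opr (\<lambda>K. q (restr A K)) F) K" .
qed

text \<open>Maximality of the nonzero minor \<open>D\<close> expresses every entry of the coefficient matrix through the
  rows \<open>\<iota>\<close> and columns \<open>\<kappa>\<close>.\<close>

lemma rank_identity:
  fixes M :: "'i \<Rightarrow> 'j \<Rightarrow> 'a::idom"
  assumes D: "dt l (\<lambda>a b. M (\<iota> a) (\<kappa> b)) = D" "D \<noteq> 0"
    and g: "\<forall>i<l. \<forall>j<l. (\<Sum>k<l. g i k * M (\<iota> k) (\<kappa> j)) = (if i = j then D else 0)"
    and zero: "dt (Suc l) (\<lambda>a b. M ((\<iota>(l := I)) a) ((\<kappa>(l := j)) b)) = 0"
  shows "D * M I j = (\<Sum>k<l. \<Sum>k'<l. M I (\<kappa> k) * g k k' * M (\<iota> k') j)"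
proof -
  obtain v where vv: "(\<exists>i<Suc l. v i \<noteq> 0) \<and>
    (\<forall>i<Suc l. (\<Sum>b<Suc l. M ((\<iota>(l := I)) i) ((\<kappa>(l := j)) b) * v b) = 0)"
    using zero unfolding dt_eq_0_iff by (elim exE)
  note v = conjunct1[OF vv] conjunct2[OF vv]
  have row: "(\<Sum>b<l. M (\<iota> i) (\<kappa> b) * v b) = - (M (\<iota> i) j * v l)" if "i < l" for i
    using v(2)[rule_format, of i] that by (simp add: eq_neg_iff_add_eq_0)
  have last: "M I j * v l = - (\<Sum>b<l. M I (\<kappa> b) * v b)"
    using v(2)[rule_format, of l] by (simp add: eq_neg_iff_add_eq_0 add.commute)
  have Dv: "D * v k = - (\<Sum>k'<l. g k k' * M (\<iota> k') j) * v l" if k: "k < l" for k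
  proof -
    have "D * v k = (\<Sum>b<l. (if k = b then D else 0) * v b)"
      using k by (simp add: if_distrib[of "\<lambda>x. x * _"] cong: if_cong)
    also have "\<dots> = (\<Sum>b<l. (\<Sum>k'<l. g k k' * M (\<iota> k') (\<kappa> b)) * v b)"
      using g k by (intro sum.cong) auto
    also have "\<dots> = (\<Sum>k'<l. g k k' * (\<Sum>b<l. M (\<iota> k') (\<kappa> b) * v b))"
      unfolding sum_distrib_left sum_distrib_right by (subst sum.swap) (simp add: mult.assoc)
    also have "\<dots> = (\<Sum>k'<l. g k k' * - (M (\<iota> k') j * v l))"
      by (intro sum.cong refl) (simp add: row)
    also have "\<dots> = - (\<Sum>k'<l. g k k' * M (\<iota> k') j) * v l"
      by (simp add: sum_negf sum_distrib_right mult.assoc)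
    finally show ?thesis .
  qed
  \<comment> \<open>If the last entry vanished, \<open>Dv\<close> would force all the others to
    vanish too.\<close>
  have vl: "v l \<noteq> 0"
  proof
    assume "v l = 0"
    then have "v k = 0" if "k < l" for k using Dv[OF that] D(2) by simp
    then show False using v(1) \<open>v l = 0\<close> by (auto simp: less_Suc_eq)
  qed
  have "D * M I j * v l = - (\<Sum>b<l. M I (\<kappa> b) * (D * v b))"
    using arg_cong[OF last, of "\<lambda>x. D * x"] by (simp add: sum_distrib_left ac_simps)
  also have "\<dots> = (\<Sum>b<l. M I (\<kappa> b) * (\<Sum>k'<l. g b k' * M (\<iota> k') j) * v l)"
    by (simp add: Dv sum_negf mult.assoc)
  also have "\<dots> = (\<Sum>k<l. \<Sum>k'<l. M I (\<kappa> k) * g k k' * M (\<iota> k') j) * v l"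
    by (simp add: sum_distrib_left sum_distrib_right mult.assoc)
  finally show ?thesis using vl by simp
qed

text \<open>Roth's factorisation. Arrange the coefficients of \<open>F\<close> in a matrix indexed
  by the monomials in \<open>A\<close> and the powers of \<open>y\<close>; variables outside both
  stay in the entries. If its rank is \<open>l\<close>, the matrix of mixed derivatives of
  \<open>F\<close> factors through a minor \<open>D\<close> of size \<open>l\<close>, and so does
  its determinant: one factor is free of \<open>y\<close>, the other free of \<open>A\<close>.
  Derivatives of order at most \<open>i\<close> suffice in row or column \<open>i\<close>.\<close>

lemma elimination:
  fixes F :: "'a::{idom,ring_char_0} mpoly"
  assumes F0: "F \<noteq> 0" and finA: "finite A" and y: "y \<notin> A" and N: "\<And>K. K \<in> keys F \<Longrightarrow> lookup K y \<le> N"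
  obtains l \<alpha> \<beta> \<iota> \<kappa> D where "1 \<le> l" "l \<le> Suc N"
    "\<forall>i<l. keys (\<alpha> i) \<subseteq> A \<and> wt (\<lambda>_. 1) (\<alpha> i) \<le> i"
    "\<forall>i<l. keys (\<beta> i) \<subseteq> {y} \<and> wt (\<lambda>_. 1) (\<beta> i) \<le> i"
    "dt l (\<lambda>i b. opr (\<lambda>K. of_nat (bin K (\<alpha> i))) (slc (disj {y}) (Poly_Mapping.single y (\<kappa> b)) F)) \<noteq> 0"
    "dt l (\<lambda>a b. opr (\<lambda>K. of_nat (bin K (\<beta> b))) (slc (disj A) (\<iota> a) F)) \<noteq> 0"
    "D \<noteq> 0"
    "dt l (\<lambda>i b. opr (\<lambda>K. of_nat (bin K (\<alpha> i))) (slc (disj {y}) (Poly_Mapping.single y (\<kappa> b)) F))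
     * dt l (\<lambda>a b. opr (\<lambda>K. of_nat (bin K (\<beta> b))) (slc (disj A) (\<iota> a) F))
     = D * dt l (\<lambda>i b. opr (\<lambda>K. of_nat (bin K (\<alpha> i)) * of_nat (bin K (\<beta> b))) F)"
proof -
  let ?s = "\<lambda>j. Poly_Mapping.single y (j :: nat)"
  define X where "X = restr A ` keys F"
  define Y where "Y = ?s ` {..N}"
  have finXY: "finite X" "finite Y" by (simp_all add: X_def Y_def)
  have keysX: "keys I \<subseteq> A" if "I \<in> X" for I using that keys_restr by (auto simp: X_def)
  have keysY: "keys t \<subseteq> {y}" if "t \<in> Y" for t using that by (auto simp: Y_def split: if_splits)
  define M where "M I t = slc (disj A) I (slc (disj {y}) t F)" for I t
  have M_comm: "M I t = slc (disj {y}) t (slc (disj A) I F)" if "I \<in> X" "t \<in> Y" for I t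
  proof (intro poly_mapping_eqI)
    fix K
    have "lookup I y = 0" using keysX[OF that(1)] y by (auto simp: in_keys_iff)
    then have 1: "disj {y} (K + I) \<longleftrightarrow> disj {y} K" unfolding disj_iff by (simp add: lookup_add)
    have "lookup t c = 0" if "c \<in> A" for c
      using keysY[OF \<open>t \<in> Y\<close>] y that by (auto simp: in_keys_iff)
    then have 2: "disj A (K + t) \<longleftrightarrow> disj A K" unfolding disj_iff by (simp add: lookup_add)
    have 3: "K + I + t = K + t + I" by (simp add: ac_simps)
    show "lookup (M I t) K = lookup (slc (disj {y}) t (slc (disj A) I F)) K"
      unfolding M_def lookup_slc 1 2 3 by simp
  qed
  have M_keys: "keys K \<inter> A = {}" "keys K \<inter> {y} = {}" if "K \<in> keys (M I t)" "I \<in> X" "t \<in> Y" for I t K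
  proof -
    show "keys K \<inter> A = {}" using that by (simp add: M_def keys_slc)
    show "keys K \<inter> {y} = {}" using that by (simp add: M_comm keys_slc)
  qed
  have restrX: "restr A K \<in> X" if "K \<in> keys (slc (disj {y}) t F)" "t \<in> Y" for K t
  proof -
    have "restr A K = restr A (K + t)"
      using keysY[OF that(2)] y
      by (intro poly_mapping_eqI) (auto simp: lookup_restr lookup_add in_keys_iff)
    then show ?thesis using that by (auto simp: X_def keys_slc)
  qed
  have restrY: "restr {y} K \<in> Y" if "lookup K y \<le> N" for K
  proof -
    have "restr {y} K = ?s (lookup K y)"
      by (intro poly_mapping_eqI) (auto simp: lookup_restr lookup_single when_def)
    then show ?thesis using that by (auto simp: Y_def)
  qed
  have restrY': "restr {y} K \<in> Y" if "K \<in> keys (slc (disj A) I F)" for K I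
    using N[of "K + I"] that by (intro restrY) (auto simp: keys_slc lookup_add)
  let ?P = "\<lambda>l. \<exists>\<iota> \<kappa>. (\<forall>a<l. \<iota> a \<in> X \<and> \<kappa> a \<in> Y) \<and> dt l (\<lambda>a b. M (\<iota> a) (\<kappa> b)) \<noteq> 0"
  \<comment> \<open>A nonzero minor has distinct columns, and there are only \<open>Suc N\<close>
    powers of \<open>y\<close>.\<close>
  have bound: "l \<le> Suc N" if P: "?P l" for l
  proof -
    obtain \<iota> \<kappa> where *: "\<forall>a<l. \<iota> a \<in> X \<and> \<kappa> a \<in> Y" "dt l (\<lambda>a b. M (\<iota> a) (\<kappa> b)) \<noteq> 0"
      using P by (elim exE conjE)
    have "inj_on \<kappa> {..<l}"
    proof (rule inj_onI, rule ccontr)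
      fix a b assume "a \<in> {..<l}" "b \<in> {..<l}" "\<kappa> a = \<kappa> b" "a \<noteq> b"
      then have "dt l (\<lambda>a b. M (\<iota> a) (\<kappa> b)) = 0" by (intro dt_eq_0_equal_cols[of a l b]) auto
      then show False using * by simp
    qed
    moreover have "\<kappa> ` {..<l} \<subseteq> Y" using * by auto
    ultimately have "card {..<l} \<le> card Y" using finXY(2) by (metis card_image card_mono)
    also have "card Y \<le> Suc N" unfolding Y_def by (rule order_trans[OF card_image_le]) auto
    finally show ?thesis by simp
  qed
  have P1: "?P (Suc 0)"
  proof -
    obtain K where K: "K \<in> keys F" using F0 keys_eq_empty by blast
    let ?t = "restr {y} K"
    have "restr (- insert y A) K + restr A K + ?t = K"
      using y by (intro poly_mapping_eqI) (auto simp: lookup_add lookup_restr)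
    moreover have "disj A (restr (- insert y A) K)" "disj {y} (restr (- insert y A) K + restr A K)"
      using y unfolding disj_iff by (simp_all add: lookup_restr lookup_add)
    ultimately have "lookup (M (restr A K) ?t) (restr (- insert y A) K) = lookup F K"
      by (simp add: M_def lookup_slc)
    then have "M (restr A K) ?t \<noteq> 0" using K by (auto simp: in_keys_iff)
    moreover have "restr A K \<in> X" "?t \<in> Y" using K N restrY by (auto simp: X_def)
    ultimately show ?thesis
      by (intro exI[of _ "\<lambda>_. restr A K"] exI[of _ "\<lambda>_. ?t"]) (simp add: dt_1)
  qed
  have "\<exists>l. ?P l \<and> (\<forall>l'. ?P l' \<longrightarrow> l' \<le> l)"
    by (rule ex_has_greatest_nat[of ?P "Suc 0" "\<lambda>l. l" "Suc (Suc N)"]) (use P1 bound in \<open>auto simp: less_Suc_eq_le\<close>)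
  then obtain l where l: "?P l" "\<And>l'. ?P l' \<Longrightarrow> l' \<le> l" by blast
  have l1: "1 \<le> l" using l(2)[OF P1] by simp
  obtain \<iota> \<kappa> where \<iota>\<kappa>: "\<forall>a<l. \<iota> a \<in> X \<and> \<kappa> a \<in> Y" and nz: "dt l (\<lambda>a b. M (\<iota> a) (\<kappa> b)) \<noteq> 0"
    using l(1) by (elim exE conjE)
  define D where "D = dt l (\<lambda>a b. M (\<iota> a) (\<kappa> b))"
  have D0: "D \<noteq> 0" using nz by (simp add: D_def)
  obtain g where g: "\<forall>i<l. \<forall>j<l. (\<Sum>k<l. M (\<iota> i) (\<kappa> k) * g k j) = (if i = j then D else 0)"
    "\<forall>i<l. \<forall>j<l. (\<Sum>k<l. g i k * M (\<iota> k) (\<kappa> j)) = (if i = j then D else 0)"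
    using dt_adj_ex[of l "\<lambda>a b. M (\<iota> a) (\<kappa> b)"] unfolding D_def by (elim exE conjE)
  have rank: "D * M I t = (\<Sum>k<l. \<Sum>k'<l. M I (\<kappa> k) * g k k' * M (\<iota> k') t)" if It: "I \<in> X" "t \<in> Y" for I t
  proof (rule rank_identity[where M = M and \<iota> = \<iota> and \<kappa> = \<kappa> and g = g and D = D and l = l])
    show "D \<noteq> 0" by (rule D0)
    show "\<forall>i<l. \<forall>j<l. (\<Sum>k<l. g i k * M (\<iota> k) (\<kappa> j)) = (if i = j then D else 0)" by (rule g(2))
    show "dt l (\<lambda>a b. M (\<iota> a) (\<kappa> b)) = D" by (simp add: D_def)
    show "dt (Suc l) (\<lambda>a b. M ((\<iota>(l := I)) a) ((\<kappa>(l := t)) b)) = 0"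
    proof (rule ccontr)
      assume nz': "dt (Suc l) (\<lambda>a b. M ((\<iota>(l := I)) a) ((\<kappa>(l := t)) b)) \<noteq> 0"
      have "\<forall>a<Suc l. (\<iota>(l := I)) a \<in> X \<and> (\<kappa>(l := t)) a \<in> Y" using \<iota>\<kappa> It by (simp add: less_Suc_eq)
      then have "?P (Suc l)" using nz' by (intro exI[of _ "\<iota>(l := I)"] exI[of _ "\<kappa>(l := t)"] conjI)
      then show False using l(2)[of "Suc l"] by simp
    qed
  qed
  have "\<exists>\<alpha>. (\<forall>i<l. keys (\<alpha> i) \<subseteq> A \<and> wt (\<lambda>_. 1) (\<alpha> i) \<le> i) \<and>
    dt l (\<lambda>i b. \<Sum>I\<in>X. M I (\<kappa> b) * Poly_Mapping.single I (of_nat (bin I (\<alpha> i)))) \<noteq> 0"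
    by (rule wronskian_nonzero[where M = "\<lambda>I b. M I (\<kappa> b)"])
       (use finA finXY keysX M_keys(1) \<iota>\<kappa> nz in auto)
  then obtain \<alpha> where \<alpha>: "\<forall>i<l. keys (\<alpha> i) \<subseteq> A \<and> wt (\<lambda>_. 1) (\<alpha> i) \<le> i"
    "dt l (\<lambda>i b. \<Sum>I\<in>X. M I (\<kappa> b) * Poly_Mapping.single I (of_nat (bin I (\<alpha> i)))) \<noteq> 0"
    by (elim exE conjE)
  have nz': "dt l (\<lambda>b a. M (\<iota> a) (\<kappa> b)) \<noteq> 0"
    using nz dt_transpose[of l "\<lambda>a b. M (\<iota> a) (\<kappa> b)"] by simp
  have "\<exists>\<beta>. (\<forall>i<l. keys (\<beta> i) \<subseteq> {y} \<and> wt (\<lambda>_. 1) (\<beta> i) \<le> i) \<and>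
    dt l (\<lambda>i a. \<Sum>t\<in>Y. M (\<iota> a) t * Poly_Mapping.single t (of_nat (bin t (\<beta> i)))) \<noteq> 0"
    by (rule wronskian_nonzero[where M = "\<lambda>t a. M (\<iota> a) t"])
       (use finXY keysY M_keys(2) \<iota>\<kappa> nz' in auto)
  then obtain \<beta> where \<beta>: "\<forall>i<l. keys (\<beta> i) \<subseteq> {y} \<and> wt (\<lambda>_. 1) (\<beta> i) \<le> i"
    "dt l (\<lambda>i a. \<Sum>t\<in>Y. M (\<iota> a) t * Poly_Mapping.single t (of_nat (bin t (\<beta> i)))) \<noteq> 0"
    by (elim exE conjE)
  define u where "u i b = opr (\<lambda>K. of_nat (bin K (\<alpha> i))) (slc (disj {y}) (\<kappa> b) F)" for i b
  define v where "v a b = opr (\<lambda>K. of_nat (bin K (\<beta> b))) (slc (disj A) (\<iota> a) F)" for a b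
  define W where "W i b = opr (\<lambda>K. of_nat (bin K (\<alpha> i)) * of_nat (bin K (\<beta> b))) F" for i b
  have u_eq: "u i b = (\<Sum>I\<in>X. M I (\<kappa> b) * Poly_Mapping.single I (of_nat (bin I (\<alpha> i))))"
    if "i < l" "b < l" for i b
  proof -
    have "(\<Sum>I\<in>X. M I (\<kappa> b) * Poly_Mapping.single I (of_nat (bin I (\<alpha> i))))
        = opr (\<lambda>K. of_nat (bin (restr A K) (\<alpha> i))) (slc (disj {y}) (\<kappa> b) F)"
      unfolding M_def by (rule sum_slc) (use finXY keysX restrX \<iota>\<kappa> that in auto)
    then show ?thesis unfolding u_def using \<alpha>(1) that by (simp add: bin_restr)
  qed
  have v_eq: "v a b = (\<Sum>t\<in>Y. M (\<iota> a) t * Poly_Mapping.single t (of_nat (bin t (\<beta> b))))"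
    if "a < l" "b < l" for a b
  proof -
    have "(\<Sum>t\<in>Y. M (\<iota> a) t * Poly_Mapping.single t (of_nat (bin t (\<beta> b))))
        = (\<Sum>t\<in>Y. slc (disj {y}) t (slc (disj A) (\<iota> a) F) * Poly_Mapping.single t (of_nat (bin t (\<beta> b))))"
      using \<iota>\<kappa> that by (intro sum.cong refl) (simp add: M_comm)
    also have "\<dots> = opr (\<lambda>K. of_nat (bin (restr {y} K) (\<beta> b))) (slc (disj A) (\<iota> a) F)"
      by (rule sum_slc) (use finXY keysY restrY' in auto)
    finally show ?thesis unfolding v_def using \<beta>(1) that by (simp add: bin_restr)
  qed
  have W_eq: "W i b = (\<Sum>I\<in>X. \<Sum>t\<in>Y. M I t * Poly_Mapping.single I (of_nat (bin I (\<alpha> i)))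
      * Poly_Mapping.single t (of_nat (bin t (\<beta> b))))" if "i < l" "b < l" for i b
  proof -
    have "W i b = opr (\<lambda>K. of_nat (bin (restr A K) (\<alpha> i))) (opr (\<lambda>K. of_nat (bin K (\<beta> b))) F)"
      unfolding W_def opr_opr using \<alpha>(1) that by (simp add: bin_restr)
    also have "\<dots> = (\<Sum>I\<in>X. slc (disj A) I (opr (\<lambda>K. of_nat (bin K (\<beta> b))) F) * Poly_Mapping.single I (of_nat (bin I (\<alpha> i))))"
    proof (rule sum_slc[where q = "\<lambda>I. of_nat (bin I (\<alpha> i))" and A = A and X = X
          and F = "opr (\<lambda>K. of_nat (bin K (\<beta> b))) F", symmetric])
      fix K assume "K \<in> keys (opr (\<lambda>K. of_nat (bin K (\<beta> b))) F)"
      then have "K \<in> keys F" by (rule subsetD[OF keys_opr])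
      then show "restr A K \<in> X" by (simp add: X_def)
    qed (use finXY keysX in auto)
    also have "\<dots> = (\<Sum>I\<in>X. \<Sum>t\<in>Y. M I t * Poly_Mapping.single I (of_nat (bin I (\<alpha> i)))
      * Poly_Mapping.single t (of_nat (bin t (\<beta> b))))"
    proof (intro sum.cong refl)
      fix I assume I: "I \<in> X"
      have "slc (disj A) I (opr (\<lambda>K. of_nat (bin K (\<beta> b))) F)
          = opr (\<lambda>K. of_nat (bin (restr {y} K) (\<beta> b))) (slc (disj A) I F)"
      proof (intro poly_mapping_eqI)
        fix K
        have "lookup I y = 0" using keysX[OF I] y by (auto simp: in_keys_iff)
        then have "restr {y} (K + I) = restr {y} K"
          by (intro poly_mapping_eqI) (auto simp: lookup_restr lookup_add)
        then have "bin (K + I) (\<beta> b) = bin (restr {y} K) (\<beta> b)"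
          using \<beta>(1) that by (metis bin_restr)
        then show "lookup (slc (disj A) I (opr (\<lambda>K. of_nat (bin K (\<beta> b))) F)) K
          = lookup (opr (\<lambda>K. of_nat (bin (restr {y} K) (\<beta> b))) (slc (disj A) I F)) K"
          by (simp add: lookup_slc)
      qed
      also have "\<dots> = (\<Sum>t\<in>Y. slc (disj {y}) t (slc (disj A) I F) * Poly_Mapping.single t (of_nat (bin t (\<beta> b))))"
        by (rule sum_slc[where q = "\<lambda>t. of_nat (bin t (\<beta> b))" and A = "{y}" and X = Y
            and F = "slc (disj A) I F", symmetric]) (use finXY keysY restrY' in auto)
      also have "\<dots> = (\<Sum>t\<in>Y. M I t * Poly_Mapping.single t (of_nat (bin t (\<beta> b))))"
        using I by (intro sum.cong refl) (simp add: M_comm)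
      finally show "slc (disj A) I (opr (\<lambda>K. of_nat (bin K (\<beta> b))) F) * Poly_Mapping.single I (of_nat (bin I (\<alpha> i)))
        = (\<Sum>t\<in>Y. M I t * Poly_Mapping.single I (of_nat (bin I (\<alpha> i))) * Poly_Mapping.single t (of_nat (bin t (\<beta> b))))"
        by (simp add: sum_distrib_left sum_distrib_right ac_simps)
    qed
    finally show ?thesis .
  qed
  \<comment> \<open>\<open>rank\<close> is inserted into each coefficient of \<open>F\<close>.
    Summing over \<open>X\<close> and over \<open>Y\<close> separately then assembles
    \<open>u\<close> and \<open>v\<close>.\<close>
  have DW: "D * W i b = (\<Sum>k<l. u i k * (\<Sum>k'<l. g k k' * v k' b))" if ib: "i < l" "b < l" for i b
  proof -
    let ?p = "\<lambda>I. Poly_Mapping.single I (of_nat (bin I (\<alpha> i)) :: 'a)"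
    let ?q = "\<lambda>t. Poly_Mapping.single t (of_nat (bin t (\<beta> b)) :: 'a)"
    have "D * W i b = (\<Sum>I\<in>X. \<Sum>t\<in>Y. (\<Sum>k<l. \<Sum>k'<l. M I (\<kappa> k) * g k k' * M (\<iota> k') t) * ?p I * ?q t)"
      unfolding W_eq[OF ib] sum_distrib_left
      by (intro sum.cong refl) (simp only: rank mult.assoc[symmetric])
    also have "\<dots> = (\<Sum>I\<in>X. \<Sum>t\<in>Y. \<Sum>k<l. \<Sum>k'<l. (M I (\<kappa> k) * ?p I) * (g k k' * (M (\<iota> k') t * ?q t)))"
      unfolding sum_distrib_right by (intro sum.cong refl) (simp add: ac_simps)
    also have "\<dots> = (\<Sum>I\<in>X. \<Sum>k<l. \<Sum>t\<in>Y. \<Sum>k'<l. (M I (\<kappa> k) * ?p I) * (g k k' * (M (\<iota> k') t * ?q t)))"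
      by (intro sum.cong refl, rule sum.swap)
    also have "\<dots> = (\<Sum>k<l. \<Sum>I\<in>X. \<Sum>t\<in>Y. \<Sum>k'<l. (M I (\<kappa> k) * ?p I) * (g k k' * (M (\<iota> k') t * ?q t)))"
      by (rule sum.swap)
    also have "\<dots> = (\<Sum>k<l. \<Sum>I\<in>X. \<Sum>k'<l. \<Sum>t\<in>Y. (M I (\<kappa> k) * ?p I) * (g k k' * (M (\<iota> k') t * ?q t)))"
      by (intro sum.cong refl, rule sum.swap)
    also have "\<dots> = (\<Sum>k<l. (\<Sum>I\<in>X. M I (\<kappa> k) * ?p I) * (\<Sum>k'<l. g k k' * (\<Sum>t\<in>Y. M (\<iota> k') t * ?q t)))"
      by (intro sum.cong refl, subst sum_distrib_right) (simp only: sum_distrib_left)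
    also have "\<dots> = (\<Sum>k<l. u i k * (\<Sum>k'<l. g k k' * v k' b))"
      using ib by (intro sum.cong refl) (simp add: u_eq v_eq)
    finally show ?thesis .
  qed
  \<comment> \<open>The determinant of the adjugate is the power of \<open>D\<close> with exponent
    \<open>l - 1\<close>, stated here without subtraction.\<close>
  have "D * dt l g = D ^ l"
  proof -
    have "D * dt l g = dt l (\<lambda>i j. \<Sum>k<l. M (\<iota> i) (\<kappa> k) * g k j)"
      unfolding D_def by (rule dt_mult)
    also have "\<dots> = dt l (\<lambda>i j. if i = j then D else 0)" by (rule dt_cong) (use g(1) in auto)
    finally show ?thesis by (simp add: dt_diag)
  qed
  moreover have "dt l u * (dt l g * dt l v) = D ^ l * dt l W"
  proof -
    have "dt l u * (dt l g * dt l v) = dt l (\<lambda>i b. D * W i b)"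
      unfolding dt_mult by (rule dt_cong) (simp add: DW)
    also have "\<dots> = D ^ l * dt l W" using dt_scale_cols[of l "\<lambda>_. D" W] by simp
    finally show ?thesis .
  qed
  ultimately have "D ^ l * (dt l u * dt l v) = D ^ l * (D * dt l W)"
    by (metis (no_types, lifting) mult.assoc mult.commute mult.left_commute)
  then have UV: "dt l u * dt l v = D * dt l W" using D0 by simp
  have u0: "dt l u \<noteq> 0"
    using \<alpha>(2) dt_cong[of l u "\<lambda>i b. \<Sum>I\<in>X. M I (\<kappa> b) * Poly_Mapping.single I (of_nat (bin I (\<alpha> i)))"] u_eq
    by simp
  have v0: "dt l v \<noteq> 0"
  proof -
    have "dt l (\<lambda>i a. \<Sum>t\<in>Y. M (\<iota> a) t * Poly_Mapping.single t (of_nat (bin t (\<beta> i)))) = dt l (\<lambda>i a. v a i)"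
      by (rule dt_cong) (simp add: v_eq)
    then show ?thesis using \<beta>(2) dt_transpose[of l v] by simp
  qed
  have \<kappa>: "\<kappa> b = ?s (lookup (\<kappa> b) y)" if "b < l" for b
    using \<iota>\<kappa> that by (auto simp: Y_def)
  have u_eq': "dt l u = dt l (\<lambda>i b. opr (\<lambda>K. of_nat (bin K (\<alpha> i))) (slc (disj {y}) (?s (lookup (\<kappa> b) y)) F))"
    by (rule dt_cong) (simp add: u_def \<kappa>[symmetric])
  show thesis
  proof (rule that[of l \<alpha> \<beta> "\<lambda>b. lookup (\<kappa> b) y" \<iota> D])
    show "1 \<le> l" "D \<noteq> 0" "l \<le> Suc N" using l1 D0 bound[OF l(1)] by auto
    show "\<forall>i<l. keys (\<alpha> i) \<subseteq> A \<and> wt (\<lambda>_. 1) (\<alpha> i) \<le> i" by (rule \<alpha>(1))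
    show "\<forall>i<l. keys (\<beta> i) \<subseteq> {y} \<and> wt (\<lambda>_. 1) (\<beta> i) \<le> i" by (rule \<beta>(1))
  qed (use u0 v0 UV in \<open>simp_all only: u_eq'[symmetric] v_def[symmetric] W_def[symmetric] not_False_eq_True\<close>)
qed

subsection \<open>Zero estimates\<close>

lemma wt_le:
  fixes w :: "nat \<Rightarrow> real"
  assumes "\<And>c. c \<in> keys a \<Longrightarrow> w c \<le> M" "wt (\<lambda>_. 1) a \<le> n" "0 \<le> M"
  shows "wt w a \<le> real n * M"
proof -
  have "wt w a \<le> (\<Sum>c\<in>keys a. real (lookup a c) * M)"
    unfolding wt_def by (intro sum_mono mult_left_mono assms) auto
  also have "\<dots> = real (wt (\<lambda>_. 1) a) * M" by (simp add: wt_def sum_distrib_right)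
  also have "\<dots> \<le> real n * M" using assms by (intro mult_right_mono) auto
  finally show ?thesis .
qed

lemma bin_le_exp:
  assumes "finite S" "keys K \<subseteq> S" "\<And>c. real (lookup K c) \<le> d"
  shows "real (bin K a) \<le> exp (real (card S) * d)"
proof (cases "keys a \<subseteq> keys K")
  case True
  have d: "0 \<le> d" using assms(3)[of 0] by linarith
  have e2: "2 ^ n \<le> exp (real n)" for n
  proof -
    have "(2::real) ^ n \<le> exp 1 ^ n" using exp_ge_add_one_self[of 1] by (intro power_mono) auto
    then show ?thesis by (simp add: exp_of_nat_mult[symmetric])
  qed
  have "real (bin K a) = (\<Prod>c\<in>keys a. real (lookup K c choose lookup a c))"
    by (simp add: bin_def)
  also have "\<dots> \<le> (\<Prod>c\<in>keys a. exp d)"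
  proof (intro prod_mono conjI)
    fix c
    have "real (lookup K c choose lookup a c) \<le> 2 ^ lookup K c"
      using binomial_le_pow2[of "lookup K c" "lookup a c"] by (metis of_nat_le_iff of_nat_numeral of_nat_power)
    also have "\<dots> \<le> exp d" using e2 assms(3) by (meson exp_le_cancel_iff order_trans)
    finally show "real (lookup K c choose lookup a c) \<le> exp d" .
  qed simp
  also have "\<dots> = exp (real (card (keys a)) * d)" by (simp add: exp_of_nat_mult)
  also have "\<dots> \<le> exp (real (card S) * d)"
    using True assms card_mono[of S "keys a"] d by (auto intro!: mult_right_mono)
  finally show ?thesis .
qed (simp add: bin_eq_0)

text \<open>The factorial is absorbed into the exponential: \<open>l\<close> is at most
  \<open>x\<close>, hence at most exp x.\<close>

lemma fact_power_le:
  assumes "sz F \<le> fact l * B ^ l" "B \<le> exp b" "0 \<le> B" "real l \<le> x"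
  shows "sz F \<le> exp (real l * (b + x))"
proof -
  have "fact l \<le> (real l) ^ l" using fact_le_power[of l, where 'a = real] by simp
  also have "\<dots> \<le> exp x ^ l"
  proof (rule power_mono)
    show "real l \<le> exp x" using assms(4) exp_ge_add_one_self[of x] by linarith
  qed simp
  finally have "fact l * B ^ l \<le> exp x ^ l * exp b ^ l"
    using assms by (intro mult_mono power_mono) auto
  also have "\<dots> = exp (real l * (b + x))" by (simp add: exp_of_nat_mult exp_add power_mult_distrib mult.commute)
  finally show ?thesis using assms(1) by linarith
qed

text \<open>The index lost by successive eliminations. A determinant keeps at least (\<theta> / 2)^2
  / 8 = \<theta>^2 / 32, and half of it is left for the factor to which the induction
  applies.\<close>

primrec shrink :: "nat \<Rightarrow> real \<Rightarrow> real" where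
  "shrink 0 \<theta> = \<theta>"
| "shrink (Suc n) \<theta> = shrink n (\<theta>\<^sup>2 / 64)"

lemma shrink_bounds: "0 < \<theta> \<Longrightarrow> \<theta> \<le> 1 \<Longrightarrow> 0 < shrink n \<theta> \<and> shrink n \<theta> \<le> \<theta>"
proof (induction n arbitrary: \<theta>)
  case (Suc n)
  have le: "\<theta>\<^sup>2 / 64 \<le> \<theta>" using Suc.prems by (simp add: power2_eq_square mult_le_cancel_left1)
  have "0 < shrink n (\<theta>\<^sup>2 / 64) \<and> shrink n (\<theta>\<^sup>2 / 64) \<le> \<theta>\<^sup>2 / 64"
    using Suc.prems le by (intro Suc.IH) auto
  then show ?case using le by simp
qed simp

text \<open>The first \<theta> l / 4 terms alone suffice: as \<open>l\<close> is at most 2 L D, each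
  of them is still at least \<theta> L / 2.\<close>

lemma sum_truncated_ge:
  fixes \<theta> L D :: real
  assumes l: "1 \<le> l" "real l \<le> 2 * L * D" and \<theta>: "0 < \<theta>" "\<theta> \<le> 1" and LD: "0 < L" "0 < D"
  shows "real l * L * (\<theta>\<^sup>2 / 8) \<le> (\<Sum>b<l. max 0 (\<theta> * L - real b / D))"
proof -
  define m where "m = nat \<lceil>\<theta> / 4 * real l\<rceil>"
  have m_le: "m \<le> l"
  proof -
    have "\<theta> / 4 * real l \<le> 1 * real l" using \<theta> by (intro mult_right_mono) auto
    then have "\<lceil>\<theta> / 4 * real l\<rceil> \<le> int l" by (simp add: ceiling_le_iff)
    then show ?thesis unfolding m_def by linarith
  qed
  have m_ge: "\<theta> / 4 * real l \<le> real m" unfolding m_def by (rule real_nat_ceiling_ge)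
  have tm: "\<theta> * L / 2 \<le> max 0 (\<theta> * L - real b / D)" if "b < m" for b
  proof -
    have "int b < \<lceil>\<theta> / 4 * real l\<rceil>" using that unfolding m_def by linarith
    then have "real b < \<theta> / 4 * real l" by (simp add: less_ceiling_iff)
    also have "\<dots> \<le> \<theta> / 4 * (2 * L * D)" using l \<theta> by (intro mult_left_mono) auto
    finally have "real b / D \<le> \<theta> * L / 2" using LD by (simp add: field_simps)
    then have "\<theta> * L / 2 \<le> \<theta> * L - real b / D" by (simp add: field_simps)
    then show ?thesis by (rule max.coboundedI2)
  qed
  have "real l * L * (\<theta>\<^sup>2 / 8) = \<theta> / 4 * real l * (\<theta> * L / 2)" by (simp add: power2_eq_square)
  also have "\<dots> \<le> real m * (\<theta> * L / 2)" using m_ge \<theta> LD by (intro mult_right_mono) auto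
  also have "\<dots> = (\<Sum>b<m. \<theta> * L / 2)" by simp
  also have "\<dots> \<le> (\<Sum>b<m. max 0 (\<theta> * L - real b / D))" by (intro sum_mono tm) auto
  also have "\<dots> \<le> (\<Sum>b<l. max 0 (\<theta> * L - real b / D))" using m_le by (intro sum_mono2) auto
  finally show ?thesis .
qed

text \<open>Roth's lemma for blocks of variables: the variables of the last block are eliminated one at a time.
  The factor \<open>V\<close> of the Wronskian only involves variables of that block, where the one-block estimate
  \<open>one\<close> applies.\<close>

lemma zero_estimate:
  fixes p :: "nat \<Rightarrow> zphi" and Dv :: "nat \<Rightarrow> real" and blk :: "nat \<Rightarrow> nat"
  assumes finX: "finite X"
    and one: "\<And>b F L. F \<noteq> 0 \<Longrightarrow> 1 \<le> L \<Longrightarrow> (\<And>I. I \<in> keys F \<Longrightarrow> keys I \<subseteq> {c\<in>X. blk c = b}) \<Longrightarrow>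
        dg (\<lambda>c. L * Dv c) F \<Longrightarrow> sz F \<le> exp (L * H) \<Longrightarrow> \<not> van p (\<lambda>c. 1 / Dv c) (\<tau> * L) F"
    and sep: "\<And>c d. c \<in> X \<Longrightarrow> d \<in> X \<Longrightarrow> blk c < blk d \<Longrightarrow> K * Dv d \<le> Dv c"
    and Dv: "\<And>c. 1 \<le> Dv c" "\<And>c. Dv c \<le> Dm"
    and K: "0 < K"
    and F: "F \<noteq> 0" "\<And>I. I \<in> keys F \<Longrightarrow> keys I \<subseteq> S" "dg (\<lambda>c. L * Dv c) F" "sz F \<le> exp (L * h)"
    and S: "S \<subseteq> X" "card S = n" and L: "1 \<le> L"
    and h: "h + real n * (real (card X) + 2) * Dm \<le> H"
    and \<theta>: "0 < \<theta>" "\<theta> \<le> 1" "\<tau> \<le> shrink n \<theta>" "4 / K \<le> shrink n \<theta>"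
  shows "\<not> van p (\<lambda>c. 1 / Dv c) (\<theta> * L) F"
  using F S L h \<theta>
proof (induction n arbitrary: F S L h \<theta>)
  case 0
  have "finite S" using 0(5) finX by (rule finite_subset)
  then have "S = {}" using 0 by simp
  then have "keys I \<subseteq> {c\<in>X. blk c = 0}" if "I \<in> keys F" for I using 0(2)[OF that] by auto
  moreover have "sz F \<le> exp (L * H)"
  proof -
    have "L * h \<le> L * H" using 0 by (intro mult_left_mono) auto
    then have "exp (L * h) \<le> exp (L * H)" by simp
    then show ?thesis using 0(4) by linarith
  qed
  ultimately have "\<not> van p (\<lambda>c. 1 / Dv c) (\<tau> * L) F"
    using 0 by (intro one[of F L 0]) auto
  moreover have "\<tau> * L \<le> \<theta> * L" using 0 by (intro mult_right_mono) auto
  ultimately show ?case using van_mono by blast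
next
  case (Suc n)
  note F = Suc.prems(1-4) and S = Suc.prems(5,6) and L = Suc.prems(7) and h = Suc.prems(8) and \<theta> = Suc.prems(9-12)
  let ?w = "\<lambda>c. 1 / Dv c"
  have Dv0: "0 < Dv c" for c using Dv(1)[of c] by linarith
  have w0: "0 \<le> ?w c" for c using Dv0[of c] by simp
  have finS: "finite S" using S(1) finX by (rule finite_subset)
  have sh: "0 < shrink (Suc n) \<theta>" "shrink (Suc n) \<theta> \<le> \<theta>\<^sup>2 / 64" "shrink (Suc n) \<theta> \<le> \<theta>"
    and \<theta>2: "0 < \<theta>\<^sup>2 / 64" "\<theta>\<^sup>2 / 64 \<le> 1"
  proof -
    show "0 < \<theta>\<^sup>2 / 64" using \<theta> by simp
    have "\<theta>\<^sup>2 \<le> 1\<^sup>2" using \<theta> by (intro power_mono) auto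
    then show 1: "\<theta>\<^sup>2 / 64 \<le> 1" by simp
    show "shrink (Suc n) \<theta> \<le> \<theta>\<^sup>2 / 64" using shrink_bounds[of "\<theta>\<^sup>2 / 64" n] \<theta> 1 by simp
    show "0 < shrink (Suc n) \<theta>" "shrink (Suc n) \<theta> \<le> \<theta>" using shrink_bounds[of \<theta> "Suc n"] \<theta> by auto
  qed
  have S_ne: "S \<noteq> {}" using S by auto
  \<comment> \<open>The last block has the smallest degrees, so few derivatives are needed to
    eliminate a variable from it.\<close>
  define y where "y = arg_max_on blk S"
  have y: "y \<in> S" and y_max: "\<And>c. c \<in> S \<Longrightarrow> blk c \<le> blk y"
  proof -
    have "Max (blk ` S) \<in> blk ` S" using finS S_ne by (intro Max_in) auto
    then obtain c where c: "c \<in> S" "blk c = Max (blk ` S)" by auto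
    then have "is_arg_max blk (\<lambda>x. x \<in> S) c"
      unfolding is_arg_max_linorder using finS by auto
    then have "is_arg_max blk (\<lambda>x. x \<in> S) y"
      unfolding y_def arg_max_on_def arg_max_def by (rule someI)
    then show "y \<in> S" "\<And>c. c \<in> S \<Longrightarrow> blk c \<le> blk y" unfolding is_arg_max_linorder by auto
  qed
  \<comment> \<open>Only strictly earlier blocks: there one derivative has weight at most 1 / (K *
    Dv y). The other variables of the block of \<open>y\<close> remain in both factors.\<close>
  define A where "A = {c \<in> S. blk c < blk y}"
  have yA: "y \<notin> A" and finA: "finite A" using finS by (auto simp: A_def)
  define N where "N = nat \<lfloor>L * Dv y\<rfloor>"
  have LDy: "1 \<le> L * Dv y" using L Dv(1)[of y] mult_mono[of 1 L 1 "Dv y"] by simp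
  have N: "lookup I y \<le> N" if "I \<in> keys F" for I
  proof -
    have "real (lookup I y) \<le> L * Dv y" using F(3) that by (auto simp: dg_def)
    then show ?thesis unfolding N_def by (simp add: le_nat_floor)
  qed
  obtain l \<alpha> \<beta> \<iota> \<kappa> D where l: "1 \<le> l" "l \<le> Suc N"
    and \<alpha>: "\<forall>i<l. keys (\<alpha> i) \<subseteq> A \<and> wt (\<lambda>_. 1) (\<alpha> i) \<le> i"
    and \<beta>: "\<forall>i<l. keys (\<beta> i) \<subseteq> {y} \<and> wt (\<lambda>_. 1) (\<beta> i) \<le> i"
    and U0: "dt l (\<lambda>i b. opr (\<lambda>K. of_nat (bin K (\<alpha> i))) (slc (disj {y}) (Poly_Mapping.single y (\<kappa> b)) F)) \<noteq> 0"
    and V0: "dt l (\<lambda>a b. opr (\<lambda>K. of_nat (bin K (\<beta> b))) (slc (disj A) (\<iota> a) F)) \<noteq> 0"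
    and "D \<noteq> 0"
    and UV: "dt l (\<lambda>i b. opr (\<lambda>K. of_nat (bin K (\<alpha> i))) (slc (disj {y}) (Poly_Mapping.single y (\<kappa> b)) F))
     * dt l (\<lambda>a b. opr (\<lambda>K. of_nat (bin K (\<beta> b))) (slc (disj A) (\<iota> a) F))
     = D * dt l (\<lambda>i b. opr (\<lambda>K. of_nat (bin K (\<alpha> i)) * of_nat (bin K (\<beta> b))) F)"
    by (rule elimination[OF F(1) finA yA N], assumption, rule that, assumption+)
  note \<alpha> = \<alpha>[rule_format] and \<beta> = \<beta>[rule_format]
  define u where "u i b = opr (\<lambda>K. of_nat (bin K (\<alpha> i))) (slc (disj {y}) (Poly_Mapping.single y (\<kappa> b)) F)" for i b
  define v where "v a b = opr (\<lambda>K. of_nat (bin K (\<beta> b))) (slc (disj A) (\<iota> a) F)" for a b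
  define W where "W i b = opr (\<lambda>K. of_nat (bin K (\<alpha> i)) * of_nat (bin K (\<beta> b))) F" for i b
  define U where "U = dt l u"
  define V where "V = dt l v"
  have U0: "U \<noteq> 0" and V0: "V \<noteq> 0" and UV: "U * V = D * dt l W"
    using U0 V0 UV unfolding U_def V_def u_def v_def W_def by simp_all
  have l2: "real l \<le> 2 * L * Dv y"
  proof -
    have "real N \<le> L * Dv y" unfolding N_def using LDy by simp
    then show ?thesis using l(2) LDy by simp
  qed
  have Dm1: "1 \<le> Dm" using Dv[of 0] by linarith
  \<comment> \<open>Degrees and the logarithm of the length both grow by the factor \<open>l\<close>
    in the determinant, so the scale \<open>L\<close> becomes \<open>l * L\<close>, and
    \<open>h\<close> gains only a fixed amount per step.\<close>
  define L' where "L' = real l * L"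
  have L': "1 \<le> L'" using l(1) L unfolding L'_def using mult_mono[of 1 "real l" 1 L] by simp
  define h' where "h' = h + (real (card X) + 2) * Dm"
  have size: "sz (dt l f) \<le> exp (L' * h')"
    if f: "\<And>i j. i < l \<Longrightarrow> j < l \<Longrightarrow> \<exists>a P s. f i j = opr (\<lambda>K. of_nat (bin K a)) (slc P s F)"
    for f :: "nat \<Rightarrow> nat \<Rightarrow> zphi mpoly"
  proof -
    let ?B = "exp (real (card X) * (L * Dm)) * exp (L * h)"
    have "sz (f i j) \<le> ?B" if ij: "i < l" "j < l" for i j
    proof -
      obtain a P s where fij: "f i j = opr (\<lambda>K. of_nat (bin K a)) (slc P s F)" using f[OF ij] by blast
      have "sz (f i j) \<le> exp (real (card X) * (L * Dm)) * sz (slc P s F)"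
        unfolding fij
      proof (rule sz_opr_le)
        fix I assume "I \<in> keys (slc P s F)"
        then have I: "I + s \<in> keys F" by (simp add: keys_slc)
        have "keys I \<subseteq> keys (I + s)" by (auto simp: in_keys_iff lookup_add)
        then have "keys I \<subseteq> X" using F(2)[OF I] S(1) by auto
        moreover have "real (lookup I c) \<le> L * Dm" for c
        proof -
          have "real (lookup (I + s) c) \<le> L * Dv c" using F(3) I by (auto simp: dg_def)
          also have "\<dots> \<le> L * Dm" using L Dv(2) by (intro mult_left_mono) auto
          finally show ?thesis by (simp add: lookup_add)
        qed
        ultimately have "real (bin I a) \<le> exp (real (card X) * (L * Dm))"
          by (intro bin_le_exp finX)
        then show "nrm (of_nat (bin I a)) \<le> exp (real (card X) * (L * Dm))" by simp
      qed
      also have "\<dots> \<le> ?B" using sz_slc[of P s F] F(4) by (intro mult_left_mono) auto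
      finally show ?thesis .
    qed
    then have "sz (dt l f) \<le> fact l * ?B ^ l" by (rule sz_dt)
    moreover have "?B \<le> exp (real (card X) * (L * Dm) + L * h)" by (simp add: exp_add)
    moreover have "real l \<le> 2 * L * Dm"
      using l2 mult_left_mono[OF Dv(2)[of y], of "2 * L"] L by linarith
    ultimately have "sz (dt l f) \<le> exp (real l * (real (card X) * (L * Dm) + L * h + 2 * L * Dm))"
      by (intro fact_power_le) auto
    also have "real l * (real (card X) * (L * Dm) + L * h + 2 * L * Dm) = L' * h'"
      by (simp add: L'_def h'_def algebra_simps)
    finally show ?thesis .
  qed
  have sizeU: "sz U \<le> exp (L' * h')" and sizeV: "sz V \<le> exp (L' * h')"
    unfolding U_def V_def u_def v_def by (rule size, blast)+
  have dgF: "dg (\<lambda>c. L * Dv c) (slc P s F)" for P s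
    unfolding dg_def
  proof (intro ballI allI)
    fix I c assume "I \<in> keys (slc P s F)"
    then have "real (lookup (I + s) c) \<le> L * Dv c" using F(3) by (auto simp: dg_def keys_slc)
    then show "real (lookup I c) \<le> L * Dv c" by (simp add: lookup_add)
  qed
  have dgU: "dg (\<lambda>c. L' * Dv c) U" and dgV: "dg (\<lambda>c. L' * Dv c) V"
  proof -
    have "dg (\<lambda>c. real l * (L * Dv c)) U" unfolding U_def u_def by (intro dg_dt dg_opr dgF)
    then show "dg (\<lambda>c. L' * Dv c) U" by (simp add: L'_def mult.assoc)
    have "dg (\<lambda>c. real l * (L * Dv c)) V" unfolding V_def v_def by (intro dg_dt dg_opr dgF)
    then show "dg (\<lambda>c. L' * Dv c) V" by (simp add: L'_def mult.assoc)
  qed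
  have keys_entry: "keys I \<subseteq> S - B" if "I \<in> keys (opr Q (slc (disj B) s F))" for I Q B s
  proof -
    have I: "I \<in> keys (slc (disj B) s F)" using that by (rule subsetD[OF keys_opr])
    then have "I + s \<in> keys F" "disj B I" by (auto simp: keys_slc)
    moreover have "keys I \<subseteq> keys (I + s)" by (auto simp: in_keys_iff lookup_add)
    ultimately show ?thesis using F(2) by blast
  qed
  have keys_plus: "keys (a + b) \<subseteq> R" if "keys a \<subseteq> R" "keys b \<subseteq> R" for a b :: mon and R
    using that keys_add[of a b] by blast
  have keysU: "keys I \<subseteq> S - {y}" if "I \<in> keys U" for I
    by (rule keys_dt[where P = "\<lambda>I. keys I \<subseteq> S - {y}", OF _ _ _ that[unfolded U_def]])
       (use keys_plus keys_entry in \<open>auto simp: u_def\<close>)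
  have keysV: "keys I \<subseteq> {c \<in> X. blk c = blk y}" if "I \<in> keys V" for I
  proof -
    have "keys I \<subseteq> S - A"
      by (rule keys_dt[where P = "\<lambda>I. keys I \<subseteq> S - A", OF _ _ _ that[unfolded V_def]])
         (use keys_plus keys_entry in \<open>auto simp: v_def\<close>)
    show ?thesis
    proof
      fix x assume "x \<in> keys I"
      then have x: "x \<in> S" "x \<notin> A" using \<open>keys I \<subseteq> S - A\<close> by auto
      then have "blk x = blk y" using y_max[OF x(1)] by (simp add: A_def)
      then show "x \<in> {c \<in> X. blk c = blk y}" using x S(1) by auto
    qed
  qed
  have h'H: "h' \<le> H"
  proof -
    have "(real (card X) + 2) * Dm \<le> real (Suc n) * ((real (card X) + 2) * Dm)"
    proof -
      have "0 \<le> (real (card X) + 2) * Dm" using Dm1 by simp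
      then have "1 * ((real (card X) + 2) * Dm) \<le> real (Suc n) * ((real (card X) + 2) * Dm)"
        by (intro mult_right_mono) auto
      then show ?thesis by (simp only: mult_1)
    qed
    then show ?thesis using h unfolding h'_def mult.assoc by linarith
  qed
  have notV: "\<not> van p ?w (\<tau> * L') V"
  proof (rule one[OF V0 L' keysV dgV])
    have "L' * h' \<le> L' * H" using h'H L' by (intro mult_left_mono) auto
    then have "exp (L' * h') \<le> exp (L' * H)" by simp
    then show "sz V \<le> exp (L' * H)" using sizeV by linarith
  qed
  \<comment> \<open>\<open>U\<close> no longer contains \<open>y\<close>, so the induction
    hypothesis applies to it; \<open>V\<close> was settled by the estimate for one block.\<close>
  have notU: "\<not> van p ?w (\<theta>\<^sup>2 / 64 * L') U"
  proof (rule Suc.IH[OF U0 keysU dgU sizeU])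
    show "S - {y} \<subseteq> X" using S by auto
    show "card (S - {y}) = n" using S y finS by simp
    show "h' + real n * (real (card X) + 2) * Dm \<le> H" using h by (simp add: h'_def algebra_simps)
  qed (use L' \<theta>2 \<theta> in auto)
  show ?case
  proof
    assume vanF: "van p ?w (\<theta> * L) F"
    \<comment> \<open>The derivatives \<open>\<alpha> i\<close> have order below 2 L Dv y, each of
      weight at most 1 / (K Dv y); together they cost at most 2 L / K.\<close>
    define \<theta>' where "\<theta>' = \<theta> - 2 / K"
    have \<theta>': "\<theta> / 2 \<le> \<theta>'" "\<theta>' \<le> 1"
    proof -
      have "4 / K \<le> \<theta>" using \<theta> sh by linarith
      then show "\<theta> / 2 \<le> \<theta>'" by (simp add: \<theta>'_def)
      show "\<theta>' \<le> 1" using \<theta>(2) K divide_nonneg_pos[of 2 K] unfolding \<theta>'_def by linarith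
    qed
    \<comment> \<open>Column \<open>b\<close> also loses up to \<open>b\<close> derivatives in
      \<open>y\<close>; where this leaves a negative bound, 0 is used.\<close>
    define T where "T b = max 0 (\<theta>' * L - real b / Dv y)" for b :: nat
    have "van p ?w (T b) (W i b)" if ib: "i < l" "b < l" for i b
    proof -
      have "wt ?w (\<alpha> i) \<le> real i * (1 / (K * Dv y))"
      proof (rule wt_le)
        fix c assume "c \<in> keys (\<alpha> i)"
        then have "c \<in> A" using \<alpha> ib by blast
        then have "K * Dv y \<le> Dv c" using S(1) y by (intro sep) (auto simp: A_def)
        then show "?w c \<le> 1 / (K * Dv y)" using K Dv0[of y] by (intro frac_le mult_pos_pos) auto
      qed (use \<alpha> ib K Dv0[of y] in auto)
      also have "\<dots> \<le> (2 * L * Dv y) * (1 / (K * Dv y))"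
        using l2 ib K Dv0[of y] by (intro mult_right_mono) auto
      also have "\<dots> = 2 * L / K" using Dv0[of y] by simp
      finally have 1: "wt ?w (\<alpha> i) \<le> 2 * L / K" .
      have 2: "wt ?w (\<beta> b) \<le> real b * (1 / Dv y)"
        by (rule wt_le) (use \<beta> ib Dv0[of y] in \<open>auto simp: subset_iff\<close>)
      have "van p ?w (\<theta>' * L - real b / Dv y) (W i b)"
        unfolding W_def
      proof (rule van_opr[OF vanF ops_mult[OF ops_bin ops_bin]])
        show "\<theta>' * L - real b / Dv y \<le> \<theta> * L - (wt ?w (\<alpha> i) + wt ?w (\<beta> b))"
          using 1 2 by (simp add: \<theta>'_def algebra_simps)
      qed (use w0 in auto)
      moreover have "van p ?w 0 (W i b)" by (rule van_nonpos) (use w0 in auto)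
      ultimately show ?thesis by (simp add: T_def max_def)
    qed
    then have "van p ?w (\<Sum>b<l. T b) (dt l W)" by (rule van_dt)
    moreover have "van p ?w 0 D" by (rule van_nonpos) (use w0 in auto)
    ultimately have "van p ?w (0 + (\<Sum>b<l. T b)) (D * dt l W)" by (intro van_mult)
    \<comment> \<open>The index of the determinant exceeds what \<open>U\<close> and
      \<open>V\<close> can have together, with \<theta>^2 / 64 reserved for each of them.\<close>
    moreover have "\<theta>\<^sup>2 / 64 * L' + \<tau> * L' \<le> 0 + (\<Sum>b<l. T b)"
    proof -
      have "real l * L * (\<theta>'\<^sup>2 / 8) \<le> (\<Sum>b<l. T b)"
        unfolding T_def using l l2 \<theta>' \<theta> L Dv0[of y] by (intro sum_truncated_ge) auto
      moreover have "(\<theta> / 2)\<^sup>2 \<le> \<theta>'\<^sup>2" using \<theta>' \<theta> by (intro power_mono) auto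
      then have "\<theta>\<^sup>2 / 64 + \<tau> \<le> \<theta>'\<^sup>2 / 8" using \<theta>(3) sh by (simp add: power2_eq_square)
      then have "L' * (\<theta>\<^sup>2 / 64 + \<tau>) \<le> L' * (\<theta>'\<^sup>2 / 8)" using L' by (intro mult_left_mono) auto
      ultimately show ?thesis by (simp add: L'_def algebra_simps)
    qed
    ultimately have "van p ?w (\<theta>\<^sup>2 / 64 * L' + \<tau> * L') (U * V)" unfolding UV by (rule van_mono)
    from van_mult_cases[OF this] show False using notU notV by blast
  qed
qed

text \<open>Dirichlet's theorem supplies a further integer vector \<open>r\<close> near the line
  spanned by \<omega>. It is independent of the earlier ones if its product with their vector of
  cofactors is nonzero. This product is close to \<open>q\<close> times that of \<omega> with the
  cofactors, which does not vanish by independence.\<close>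

lemma integer_forms_near_line:
  fixes \<omega> :: "nat \<Rightarrow> real"
  assumes indep: "\<And>J :: nat \<Rightarrow> int. (\<Sum>j<n. \<omega> j * of_int (J j)) = 0 \<Longrightarrow> \<forall>j<n. J j = 0"
    and \<eta>: "0 < \<eta>"
  shows "k \<le> n \<Longrightarrow> \<exists>(a :: nat \<Rightarrow> nat \<Rightarrow> int) t :: nat \<Rightarrow> int. (\<forall>i<k. \<forall>j<n. \<bar>of_int (a i j) - of_int (t i) * \<omega> j\<bar> \<le> \<eta>) \<and>
    dt k a \<noteq> 0"
proof (induction k)
  case 0
  then show ?case by (intro exI) (auto simp: dt_eq_sum)
next
  case (Suc k)
  then obtain a :: "nat \<Rightarrow> nat \<Rightarrow> int" and t :: "nat \<Rightarrow> int"
    where a: "\<And>i j. i < k \<Longrightarrow> j < n \<Longrightarrow> \<bar>of_int (a i j) - of_int (t i) * \<omega> j\<bar> \<le> \<eta>" and nz: "dt k a \<noteq> 0"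
    by (metis Suc_leD)
  obtain g where g: "\<And>r. dt (Suc k) (a(k := r)) = (\<Sum>j<Suc k. r j * g j k)"
  proof -
    obtain g where "\<forall>b<Suc k. \<forall>r. dt (Suc k) (a(b := r)) = (\<Sum>j<Suc k. r j * g j b)"
      using dt_adj_ex[of "Suc k" a] by (elim exE conjE)
    then show thesis by (intro that[of g]) simp
  qed
  \<comment> \<open>The cofactors of the row to be added, padded by zeros; entry \<open>k\<close> is
    the previous minor, hence nonzero.\<close>
  define J where "J j = (if j \<le> k then g j k else 0)" for j
  have "dt (Suc k) (a(k := (\<lambda>j. if j = k then 1 else 0))) \<noteq> 0"
  proof
    assume "dt (Suc k) (a(k := (\<lambda>j. if j = k then 1 else 0))) = 0"
    then obtain v where v: "(\<exists>i<Suc k. v i \<noteq> 0) \<and>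
        (\<forall>i<Suc k. (\<Sum>j<Suc k. (a(k := (\<lambda>j. if j = k then 1 else 0))) i j * v j) = 0)"
      unfolding dt_eq_0_iff by (elim exE)
    have vk: "v k = 0" using conjunct2[OF v, rule_format, of k] by simp
    have "(\<exists>i<k. v i \<noteq> 0)" using conjunct1[OF v] vk less_Suc_eq by auto
    moreover have "\<forall>i<k. (\<Sum>j<k. a i j * v j) = 0"
    proof (intro allI impI)
      fix i assume "i < k"
      then show "(\<Sum>j<k. a i j * v j) = 0"
        using conjunct2[OF v, rule_format, of i] vk by simp
    qed
    ultimately have "dt k a = 0" unfolding dt_eq_0_iff by blast
    then show False using nz by simp
  qed
  moreover have "dt (Suc k) (a(k := (\<lambda>j. if j = k then 1 else 0))) = g k k" by (simp add: g)
  ultimately have gk: "g k k \<noteq> 0" by simp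
  define \<delta> where "\<delta> = (\<Sum>j<n. \<omega> j * of_int (J j))"
  have \<delta>: "\<delta> \<noteq> 0"
  proof
    assume "\<delta> = 0"
    then have "J k = 0" using indep[of J] Suc.prems by (simp add: \<delta>_def)
    then show False using gk by (simp add: J_def)
  qed
  define B where "B = (\<Sum>j<n. \<bar>real_of_int (J j)\<bar>)"
  \<comment> \<open>The first bound makes the new row as close to the line as required; the second
    makes the approximation error too small to cancel \<open>\<delta>\<close>.\<close>
  obtain N :: nat where N: "max (1 / \<eta>) (B / \<bar>\<delta>\<bar>) < real N" using reals_Archimedean2 by blast
  have N0: "0 < N" using N \<eta> by (smt (verit) divide_pos_pos max_less_iff_conj of_nat_0_less_iff)
  obtain q r where q: "0 < q" "\<And>j. j < n \<Longrightarrow> \<bar>of_int q * \<omega> j - of_int (r j)\<bar> < 1 / real N"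
    using Dirichlet_approx_simult[OF N0, of n \<omega>] by metis
  have "(\<Sum>j<n. r j * J j) \<noteq> 0"
  proof
    assume 0: "(\<Sum>j<n. r j * J j) = 0"
    have "of_int q * \<delta> = (\<Sum>j<n. (of_int q * \<omega> j - of_int (r j)) * of_int (J j))"
    proof -
      have "(\<Sum>j<n. (of_int q * \<omega> j - of_int (r j)) * of_int (J j)) = of_int q * \<delta> - of_int (\<Sum>j<n. r j * J j)"
        by (simp add: \<delta>_def left_diff_distrib sum_subtractf sum_distrib_left mult.assoc)
      then show ?thesis using 0 by simp
    qed
    then have "\<bar>of_int q * \<delta>\<bar> \<le> (\<Sum>j<n. \<bar>(of_int q * \<omega> j - of_int (r j)) * of_int (J j)\<bar>)"
      by simp
    also have "\<dots> \<le> (\<Sum>j<n. 1 / real N * \<bar>of_int (J j)\<bar>)"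
      unfolding abs_mult using q(2) by (intro sum_mono mult_right_mono) (auto intro: less_imp_le)
    also have "\<dots> = B / real N" by (simp add: B_def sum_divide_distrib)
    finally have "\<bar>of_int q\<bar> * \<bar>\<delta>\<bar> \<le> B / real N" by (simp add: abs_mult)
    moreover have "1 * \<bar>\<delta>\<bar> \<le> \<bar>of_int q\<bar> * \<bar>\<delta>\<bar>" using q(1) by (intro mult_right_mono) auto
    ultimately have "\<bar>\<delta>\<bar> \<le> B / real N" by simp
    then show False using N N0 \<delta> by (simp add: field_simps)
  qed
  moreover have "(\<Sum>j<n. r j * J j) = (\<Sum>j<Suc k. r j * g j k)"
  proof -
    have "(\<Sum>j<n. r j * J j) = (\<Sum>j<Suc k. r j * J j)"
      using Suc.prems by (intro sum.mono_neutral_right) (auto simp: J_def)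
    then show ?thesis by (simp add: J_def)
  qed
  ultimately have "dt (Suc k) (a(k := r)) \<noteq> 0" by (simp add: g)
  moreover have "\<bar>of_int ((a(k := r)) i j) - of_int ((t(k := q)) i) * \<omega> j\<bar> \<le> \<eta>" if "i < Suc k" "j < n" for i j
  proof (cases "i = k")
    case True
    have "1 / real N \<le> \<eta>" using N N0 \<eta> by (simp add: field_simps)
    then show ?thesis using True q(2)[OF that(2)] by (simp add: abs_minus_commute)
  next
    case False
    then show ?thesis using a that by simp
  qed
  ultimately show ?case by (intro exI[of _ "a(k := r)"] exI[of _ "t(k := q)"] conjI allI impI)
qed

section \<open>Zero estimate in a single block\<close>

lemma gphi_neq_0 [simp]: "gphi \<noteq> 0" using gphi_pos by linarith

text \<open>The product is r! times the binomial coefficient (m + r choose r). The factorial is kept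
  separate so that it can cancel later.\<close>

lemma prod_shift_le: "(\<Prod>k\<in>{1..r}. real m + real k) \<le> fact r * 2 ^ (m + r)"
proof -
  have "(\<Prod>k\<in>{1..r}. real m + real k) = fact (m + r) / fact m"
  proof (induction r)
    case (Suc r)
    have "{1..Suc r} = insert (Suc r) {1..r}" by auto
    then show ?case using Suc by (simp add: algebra_simps)
  qed simp
  also have "\<dots> = fact r * real ((m + r) choose r)"
    by (simp add: binomial_fact[of r "m + r"])
  also have "\<dots> \<le> fact r * 2 ^ (m + r)"
  proof (rule mult_left_mono)
    have "real ((m + r) choose r) \<le> real (2 ^ (m + r))"
      by (simp only: of_nat_le_iff binomial_le_pow2)
    then show "real ((m + r) choose r) \<le> 2 ^ (m + r)" by simp
  qed simp
  finally show ?thesis .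
qed

lemma prod_window_le:
  "(\<Prod>k\<in>{1..r}. \<bar>real_of_int x - real k\<bar> * \<bar>real_of_int x + real k\<bar>) \<le> (fact r)\<^sup>2 * 4 ^ (nat \<bar>x\<bar> + r)"
proof -
  let ?m = "nat \<bar>x\<bar>"
  have "(\<Prod>k\<in>{1..r}. \<bar>real_of_int x - real k\<bar> * \<bar>real_of_int x + real k\<bar>)
      \<le> (\<Prod>k\<in>{1..r}. (real ?m + real k) * (real ?m + real k))"
    by (intro prod_mono conjI mult_mono) auto
  also have "\<dots> = (\<Prod>k\<in>{1..r}. real ?m + real k)\<^sup>2" by (simp add: prod.distrib power2_eq_square)
  also have "\<dots> \<le> (fact r * 2 ^ (?m + r))\<^sup>2"
    by (intro power_mono prod_shift_le prod_nonneg) auto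
  also have "\<dots> = (fact r)\<^sup>2 * 4 ^ (?m + r)"
  proof -
    have "((2::real) ^ n)\<^sup>2 = 4 ^ n" for n by (simp add: power2_eq_square power_mult_distrib[symmetric])
    then show ?thesis by (simp only: power_mult_distrib)
  qed
  finally show ?thesis .
qed

text \<open>A polynomial in \<open>s\<close> variables with small coefficients cannot vanish to high order at the
  point \<open>gphi\<close> to the \<open>v\<close>, where \<open>v\<close> is nearly proportional to the generic direction \<open>\<omega>\<close>. Near the key
  \<open>I0\<close> of largest weight, all other keys are annihilated by the windows of the integer forms \<open>a i\<close>,
  which are nearly proportional to \<open>\<omega>\<close> and hence take few values there.\<close>

lemma one_block_estimate:
  fixes a :: "nat \<Rightarrow> nat \<Rightarrow> int" and \<omega> v :: "nat \<Rightarrow> real" and t :: "nat \<Rightarrow> real" and B :: real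
  assumes near: "\<And>i j. i < s \<Longrightarrow> j < s \<Longrightarrow> \<bar>of_int (a i j) - t i * \<omega> j\<bar> \<le> \<eta>"
    and indep: "\<And>J :: nat \<Rightarrow> int. (\<And>i. i < s \<Longrightarrow> (\<Sum>j<s. a i j * J j) = 0) \<Longrightarrow> \<forall>j<s. J j = 0"
    and bounds: "\<And>i. i < s \<Longrightarrow> \<bar>t i\<bar> \<le> B" "\<And>i j. i < s \<Longrightarrow> j < s \<Longrightarrow> \<bar>of_int (a i j)\<bar> \<le> B" "0 \<le> B"
    and \<tau>: "0 < \<tau>" "\<tau> \<le> 1" and \<eta>: "real s * \<eta> \<le> \<tau> / 3"
    and n: "0 < n" "3 * real s * (B + 1) \<le> \<tau> * n"
    and v: "\<And>j. j < s \<Longrightarrow> \<bar>v j - n * \<omega> j\<bar> \<le> 1"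
    and size: "real s * (real s * B + 1) * ln 4 + 2 * H < \<tau> / (3 * (B + 1)) * n * ln gphi"
    and p: "\<And>j. j < s \<Longrightarrow> emb1 (p (c0 + j)) = gphi powr v j"
    and D: "1 \<le> D" and w: "\<And>c. 0 \<le> w c" "\<And>j. j < s \<Longrightarrow> w (c0 + j) = 1 / D" and L: "1 \<le> L"
    and \<theta>: "(2 * real s + 1) * \<tau> \<le> \<theta>"
    and F: "F \<noteq> 0" "\<And>I. I \<in> keys F \<Longrightarrow> keys I \<subseteq> {c0..<c0 + s}"
      "\<And>I c. I \<in> keys F \<Longrightarrow> real (lookup I c) \<le> L * D" "sz F \<le> exp (L * D * H)"
  shows "\<not> van p w (\<theta> * L) F"
proof
  assume van: "van p w (\<theta> * L) F"
  define X where "X = L * D"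
  have X1: "1 \<le> X" using L D unfolding X_def using mult_mono[of 1 L 1 D] by simp
  \<comment> \<open>The logarithm of the monomial to base \<open>gphi\<close>. \<open>I0\<close>
    will be a dominant key, and all weights are compared with its weight.\<close>
  define V where "V I = (\<Sum>j<s. v j * real (lookup I (c0 + j)))" for I :: mon
  have pwV: "emb1 (pw p I) = gphi powr V I" if I: "I \<in> keys F" for I
  proof -
    have "pw p I = (\<Prod>c\<in>{c0..<c0 + s}. p c ^ lookup I c)" using F(2)[OF I] by (intro pw_superset) auto
    also have "\<dots> = (\<Prod>j<s. p (c0 + j) ^ lookup I (c0 + j))"
      by (rule prod.reindex_bij_witness[of _ "\<lambda>j. c0 + j" "\<lambda>c. c - c0"]) auto
    finally have "emb1 (pw p I) = (\<Prod>j<s. (gphi powr v j) ^ lookup I (c0 + j))" by (simp add: emb_prod p)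
    also have "\<dots> = (\<Prod>j<s. gphi powr (v j * real (lookup I (c0 + j))))"
      by (intro prod.cong refl) (simp add: powr_powr[symmetric] powr_realpow)
    also have "\<dots> = gphi powr V I" unfolding V_def by (simp add: powr_sum)
    finally show ?thesis .
  qed
  obtain I0 where I0: "I0 \<in> keys F" and I0_max: "\<And>I. I \<in> keys F \<Longrightarrow> V I \<le> V I0"
  proof -
    have ne: "V ` keys F \<noteq> {}" using F(1) by simp
    have "Max (V ` keys F) \<in> V ` keys F" using ne by (intro Max_in) auto
    then obtain I0 where "I0 \<in> keys F" "V I0 = Max (V ` keys F)" by auto
    then show thesis by (intro that[of I0]) auto
  qed
  define r where "r = nat \<lfloor>\<tau> * X\<rfloor>"
  have r: "real r \<le> \<tau> * X" unfolding r_def using \<tau> X1 by simp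
  define x where "x i I = (\<Sum>j<s. a i j * (int (lookup I (c0 + j)) - int (lookup I0 (c0 + j))))" for i and I :: mon
  \<comment> \<open>\<open>Q\<close> is nonzero at \<open>I0\<close>, where all forms vanish, and
    zero as soon as some form takes a nonzero value of absolute value at most \<open>r\<close>. The
    choice of \<open>r\<close> keeps its order 2 s r / D below \<theta> L.\<close>
  define Q where "Q I = (\<Prod>i<s. \<Prod>k\<in>{1..r}. (x i I - int k) * (x i I + int k))" for I
  have opsQ: "ops p w (\<Sum>i<s. \<Sum>k\<in>{1..r}. 1 / D + 1 / D) (\<lambda>I. of_int (Q I))"
  proof -
    have lin: "ops p w (1 / D) (\<lambda>I. of_int (x i I))" for i
    proof -
      have "of_int (x i I) = (\<Sum>j<s. of_int (a i j) * (of_nat (lookup I (c0 + j)) + - of_nat (lookup I0 (c0 + j))) :: zphi)" for I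
        by (simp add: x_def)
      moreover have "ops p w (1 / D) (\<lambda>I. of_int (a i j) * (of_nat (lookup I (c0 + j)) + - of_nat (lookup I0 (c0 + j))))"
        if "j < s" for j
      proof -
        have "ops p w (0 + w (c0 + j)) (\<lambda>I. of_int (a i j) * (of_nat (lookup I (c0 + j)) + - of_nat (lookup I0 (c0 + j))))"
          by (intro ops_mult ops_add ops_var ops_const w) auto
        then show ?thesis using w(2)[OF that] by simp
      qed
      ultimately show ?thesis using D by (simp only:) (intro ops_sum, auto)
    qed
    have "(\<lambda>I. of_int (Q I) :: zphi) = (\<lambda>I. \<Prod>i<s. \<Prod>k\<in>{1..r}. (of_int (x i I) + of_int (- int k)) * (of_int (x i I) + of_int (int k)))"
      unfolding Q_def by (simp add: fun_eq_iff)
    moreover have "ops p w (\<Sum>i<s. \<Sum>k\<in>{1..r}. 1 / D + 1 / D)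
      (\<lambda>I. \<Prod>i<s. \<Prod>k\<in>{1..r}. (of_int (x i I) + of_int (- int k)) * (of_int (x i I) + of_int (int k)))"
      using D by (intro ops_prod ops_mult ops_add lin ops_const) auto
    ultimately show ?thesis by (simp only:)
  qed
  have "(\<Sum>i<s. \<Sum>k\<in>{1..r}. 1 / D + 1 / D) < \<theta> * L"
  proof -
    have "(\<Sum>i<s. \<Sum>k\<in>{1..r}. 1 / D + 1 / D) = 2 * real s * real r / D" by simp
    also have "\<dots> \<le> 2 * real s * (\<tau> * X) / D" using r D by (intro divide_right_mono mult_left_mono) auto
    also have "\<dots> = 2 * real s * \<tau> * L" using D by (simp add: X_def)
    also have "\<dots> < (2 * real s + 1) * \<tau> * L" using \<tau> L by (intro mult_strict_right_mono) auto
    also have "\<dots> \<le> \<theta> * L" using \<theta> L by (intro mult_right_mono) auto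
    finally show ?thesis .
  qed
  from van_ops_sum_eq_0[OF van opsQ this]
  have "emb1 (\<Sum>I\<in>keys F. of_int (Q I) * lookup F I * pw p I) = 0" by simp
  then have sum0: "(\<Sum>I\<in>keys F. of_int (Q I) * emb1 (lookup F I) * gphi powr V I) = 0"
    by (simp add: emb_sum pwV)
  \<comment> \<open>The width of the strip of weights below that of \<open>I0\<close> in which all
    other keys will be annihilated by \<open>Q\<close>.\<close>
  define W where "W = \<tau> / (3 * (B + 1)) * X * n"
  have W0: "0 \<le> W" unfolding W_def using \<tau> bounds X1 n by simp
  have diff: "\<bar>real (lookup I (c0 + j)) - real (lookup I0 (c0 + j))\<bar> \<le> X" if "I \<in> keys F" for I j
  proof -
    have "real (lookup I (c0 + j)) \<le> X" "real (lookup I0 (c0 + j)) \<le> X"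
      using F(3) that I0 by (auto simp: X_def)
    then show ?thesis by linarith
  qed
  have x_le: "\<bar>real_of_int (x i I)\<bar> \<le> real s * B * X" if "I \<in> keys F" "i < s" for I i
  proof -
    have "\<bar>real_of_int (x i I)\<bar> \<le> (\<Sum>j<s. \<bar>real_of_int (a i j) * (real (lookup I (c0 + j)) - real (lookup I0 (c0 + j)))\<bar>)"
      unfolding x_def by (simp add: sum_abs)
    also have "\<dots> \<le> (\<Sum>j<s. B * X)"
      unfolding abs_mult
    proof (rule sum_mono)
      fix j assume "j \<in> {..<s}"
      then have "\<bar>real_of_int (a i j)\<bar> \<le> B" using bounds(2)[OF that(2), of j] by auto
      then show "\<bar>real_of_int (a i j)\<bar> * \<bar>real (lookup I (c0 + j)) - real (lookup I0 (c0 + j))\<bar> \<le> B * X"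
        using diff[OF that(1)] bounds(3) by (intro mult_mono) auto
    qed
    also have "\<dots> = real s * B * X" by simp
    finally show ?thesis .
  qed
  have strip: "Q I = 0" if I: "I \<in> keys F" "I \<noteq> I0" "V I0 - W \<le> V I" for I
  proof -
    let ?J = "\<lambda>j. real (lookup I (c0 + j)) - real (lookup I0 (c0 + j))"
    have "\<exists>i<s. x i I \<noteq> 0"
    proof (rule ccontr)
      assume "\<not> ?thesis"
      then have "\<forall>j<s. int (lookup I (c0 + j)) - int (lookup I0 (c0 + j)) = 0"
        by (intro indep) (auto simp: x_def)
      then have eq: "lookup I (c0 + j) = lookup I0 (c0 + j)" if "j < s" for j using that by simp
      have "I = I0"
      proof (intro poly_mapping_eqI)
        fix c
        show "lookup I c = lookup I0 c"
        proof (cases "c \<in> {c0..<c0 + s}")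
          case True
          then show ?thesis using eq[of "c - c0"] by auto
        next
          case False
          then have "c \<notin> keys I" "c \<notin> keys I0" using F(2) I I0 by blast+
          then show ?thesis by (simp add: in_keys_iff)
        qed
      qed
      then show False using I by simp
    qed
    \<comment> \<open>A form that does not vanish at the difference of \<open>I\<close> and
      \<open>I0\<close>. Its value has three errors, from the width of the strip, from
      \<open>v\<close> against \<open>n * \<omega>\<close>, and from the form against
      \<open>t i * \<omega>\<close>; each is at most \<tau> X / 3.\<close>
    then obtain i where i: "i < s" "x i I \<noteq> 0" by blast
    define \<rho> where "\<rho> = (\<Sum>j<s. \<omega> j * ?J j)"
    have VJ: "V I - V I0 = (\<Sum>j<s. v j * ?J j)"
      unfolding V_def by (simp add: sum_subtractf right_diff_distrib)
    have "n * \<rho> = (V I - V I0) - (\<Sum>j<s. (v j - n * \<omega> j) * ?J j)"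
      unfolding VJ \<rho>_def by (simp add: sum_distrib_left sum_subtractf[symmetric] algebra_simps)
    moreover have "\<bar>\<Sum>j<s. (v j - n * \<omega> j) * ?J j\<bar> \<le> real s * X"
    proof -
      have "\<bar>\<Sum>j<s. (v j - n * \<omega> j) * ?J j\<bar> \<le> (\<Sum>j<s. \<bar>v j - n * \<omega> j\<bar> * \<bar>?J j\<bar>)"
        unfolding abs_mult[symmetric] by (rule sum_abs)
      also have "\<dots> \<le> (\<Sum>j<s. 1 * X)" using diff[OF I(1)] v by (intro sum_mono mult_mono) auto
      finally show ?thesis by simp
    qed
    moreover have "\<bar>V I - V I0\<bar> \<le> W" using I0_max[OF I(1)] I(3) by linarith
    ultimately have "\<bar>n * \<rho>\<bar> \<le> W + real s * X" by linarith
    then have \<rho>: "\<bar>\<rho>\<bar> \<le> \<tau> / (3 * (B + 1)) * X + real s * X / n"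
      using n(1) by (simp add: abs_mult W_def field_simps)
    have "real_of_int (x i I) = t i * \<rho> + (\<Sum>j<s. (of_int (a i j) - t i * \<omega> j) * ?J j)"
      unfolding x_def \<rho>_def by (simp add: sum_distrib_left sum.distrib[symmetric] algebra_simps)
    moreover have "\<bar>\<Sum>j<s. (of_int (a i j) - t i * \<omega> j) * ?J j\<bar> \<le> \<tau> / 3 * X"
    proof -
      have "\<bar>\<Sum>j<s. (of_int (a i j) - t i * \<omega> j) * ?J j\<bar> \<le> (\<Sum>j<s. \<bar>of_int (a i j) - t i * \<omega> j\<bar> * \<bar>?J j\<bar>)"
        unfolding abs_mult[symmetric] by (rule sum_abs)
      also have "\<dots> \<le> (\<Sum>j<s. \<eta> * X)"
      proof (intro sum_mono mult_mono)
        fix j assume "j \<in> {..<s}"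
        then show "\<bar>of_int (a i j) - t i * \<omega> j\<bar> \<le> \<eta>" using near[OF i(1)] by auto
        then show "0 \<le> \<eta>" by linarith
      qed (use diff[OF I(1)] in auto)
      also have "\<dots> = real s * \<eta> * X" by simp
      also have "\<dots> \<le> \<tau> / 3 * X" using \<eta> X1 by (intro mult_right_mono) auto
      finally show ?thesis .
    qed
    moreover have "\<bar>t i * \<rho>\<bar> \<le> \<tau> / 3 * X + \<tau> / 3 * X"
    proof -
      have "\<bar>t i * \<rho>\<bar> \<le> (B + 1) * (\<tau> / (3 * (B + 1)) * X + real s * X / n)"
        unfolding abs_mult using bounds(1)[OF i(1)] \<rho> by (intro mult_mono) auto
      also have "\<dots> = (B + 1) * (\<tau> / (3 * (B + 1)) * X) + (B + 1) * (real s * X / n)"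
        by (rule distrib_left)
      also have "(B + 1) * (\<tau> / (3 * (B + 1)) * X) = \<tau> / 3 * X"
      proof -
        have "c * (\<tau> / (3 * c) * X) = \<tau> / 3 * X" if "c \<noteq> 0" for c :: real using that by simp
        moreover have "B + 1 \<noteq> 0" using bounds(3) by linarith
        ultimately show ?thesis by blast
      qed
      also have "(B + 1) * (real s * X / n) = (3 * real s * (B + 1)) / n * X / 3"
        by simp
      also have "\<tau> / 3 * X + (3 * real s * (B + 1)) / n * X / 3 \<le> \<tau> / 3 * X + \<tau> * X / 3"
      proof -
        have "(3 * real s * (B + 1)) / n \<le> \<tau>" using n by (simp add: field_simps)
        then have "(3 * real s * (B + 1)) / n * X \<le> \<tau> * X" using X1 by (intro mult_right_mono) auto
        then have "(3 * real s * (B + 1)) / n * X / 3 \<le> \<tau> * X / 3" by (rule divide_right_mono) simp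
        then show ?thesis by (rule add_left_mono)
      qed
      also have "\<tau> / 3 * X + \<tau> * X / 3 = \<tau> / 3 * X + \<tau> / 3 * X" by simp
      finally show ?thesis .
    qed
    ultimately have "\<bar>real_of_int (x i I)\<bar> \<le> \<tau> * X" by linarith
    then have "nat \<bar>x i I\<bar> \<le> r" unfolding r_def by (intro nat_mono) (simp add: le_floor_iff)
    then have k: "nat \<bar>x i I\<bar> \<in> {1..r}" using i(2) by simp
    have "(x i I - int (nat \<bar>x i I\<bar>)) * (x i I + int (nat \<bar>x i I\<bar>)) = 0" by (simp add: abs_if)
    then have "(\<Prod>k\<in>{1..r}. (x i I - int k) * (x i I + int k)) = 0" 
      by (intro prod_zero bexI[OF _ k]) simp_all
    then show "Q I = 0" unfolding Q_def using i(1) by (intro prod_zero) auto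
  qed
  \<comment> \<open>The value at \<open>I0\<close> contains the same factorials as the bound
    \<open>QI\<close>, so they cancel in the comparison and only \<open>exp C\<close> is
    lost.\<close>
  define q0 where "q0 = ((fact r)\<^sup>2 :: real) ^ s"
  have q0: "0 < q0" by (simp add: q0_def)
  have Q0: "\<bar>real_of_int (Q I0)\<bar> = q0"
  proof -
    have "real_of_int (Q I0) = (\<Prod>i<s. \<Prod>k\<in>{1..r}. (- real k) * real k)"
      by (simp add: Q_def x_def)
    also have "\<bar>\<dots>\<bar> = (\<Prod>i<s. \<Prod>k\<in>{1..r}. real k * real k)"
      by (simp only: abs_prod abs_mult abs_minus_cancel abs_of_nat)
    also have "\<dots> = q0" by (simp add: q0_def prod.distrib power2_eq_square fact_prod)
    finally show ?thesis .
  qed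
  define C where "C = real s * (real s * B + 1) * ln 4 * X"
  have QI: "\<bar>real_of_int (Q I)\<bar> \<le> q0 * exp C" if "I \<in> keys F" for I
  proof -
    have "\<bar>real_of_int (Q I)\<bar> = (\<Prod>i<s. \<Prod>k\<in>{1..r}. \<bar>real_of_int (x i I) - real k\<bar> * \<bar>real_of_int (x i I) + real k\<bar>)"
      by (simp only: Q_def of_int_prod of_int_mult of_int_diff of_int_add of_int_of_nat_eq abs_prod abs_mult)
    also have "\<dots> \<le> (\<Prod>i<s. (fact r)\<^sup>2 * exp ((real s * B + 1) * ln 4 * X))"
    proof (intro prod_mono conjI prod_nonneg)
      fix i assume i: "i \<in> {..<s}"
      have "(\<Prod>k\<in>{1..r}. \<bar>real_of_int (x i I) - real k\<bar> * \<bar>real_of_int (x i I) + real k\<bar>)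
          \<le> (fact r)\<^sup>2 * 4 ^ (nat \<bar>x i I\<bar> + r)" by (rule prod_window_le)
      also have "(4::real) ^ (nat \<bar>x i I\<bar> + r) = exp (real (nat \<bar>x i I\<bar> + r) * ln 4)"
        by (subst exp_of_nat_mult) simp
      also have "\<dots> \<le> exp ((real s * B + 1) * ln 4 * X)"
      proof -
        have "real (nat \<bar>x i I\<bar> + r) \<le> real s * B * X + \<tau> * X" using x_le[OF that, of i] i r by simp
        also have "\<dots> \<le> (real s * B + 1) * X" using \<tau> X1 by (simp add: algebra_simps)
        finally have "real (nat \<bar>x i I\<bar> + r) * ln 4 \<le> (real s * B + 1) * X * ln 4" by (intro mult_right_mono) auto
        then show ?thesis by (simp add: ac_simps)
      qed
      finally show "(\<Prod>k\<in>{1..r}. \<bar>real_of_int (x i I) - real k\<bar> * \<bar>real_of_int (x i I) + real k\<bar>)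
          \<le> (fact r)\<^sup>2 * exp ((real s * B + 1) * ln 4 * X)" by simp
    qed auto
    also have "\<dots> = q0 * exp C"
      by (simp add: q0_def C_def power_mult_distrib exp_of_nat_mult[symmetric] mult.assoc)
    finally show ?thesis .
  qed
  \<comment> \<open>The Liouville inequality bounds the dominant coefficient from below; this
    accounts for one of the two factors \<open>sz F\<close> in the final comparison.\<close>
  have f0: "1 \<le> \<bar>emb1 (lookup F I0)\<bar> * sz F"
  proof -
    have "1 \<le> \<bar>emb1 (lookup F I0)\<bar> * nrm (lookup F I0)" using I0 by (intro emb1_lower) (simp add: in_keys_iff)
    also have "\<dots> \<le> \<bar>emb1 (lookup F I0)\<bar> * sz F" by (intro mult_left_mono nrm_lookup_le_sz) auto
    finally show ?thesis .
  qed
  let ?T = "\<lambda>I. of_int (Q I) * emb1 (lookup F I) * gphi powr V I"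
  have "?T I0 = - (\<Sum>I\<in>keys F - {I0}. ?T I)"
    using sum0 I0 by (subst (asm) sum.remove[of _ I0]) auto
  then have "\<bar>?T I0\<bar> \<le> (\<Sum>I\<in>keys F - {I0}. \<bar>?T I\<bar>)" by simp
  also have "\<dots> \<le> (\<Sum>I\<in>keys F - {I0}. q0 * exp C * nrm (lookup F I) * gphi powr (V I0 - W))"
  proof (rule sum_mono)
    fix I assume I: "I \<in> keys F - {I0}"
    show "\<bar>?T I\<bar> \<le> q0 * exp C * nrm (lookup F I) * gphi powr (V I0 - W)"
    proof (cases "V I0 - W \<le> V I")
      case True
      then have "Q I = 0" using I by (intro strip) auto
      then show ?thesis using q0 by simp
    next
      case False
      have "\<bar>real_of_int (Q I)\<bar> * \<bar>emb1 (lookup F I)\<bar> * gphi powr V I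
          \<le> q0 * exp C * nrm (lookup F I) * gphi powr (V I0 - W)"
        using QI[of I] I False emb_le_nrm(1)[of "lookup F I"] gphi_bounds q0 by (intro mult_mono) auto
      then show ?thesis by (simp add: abs_mult)
    qed
  qed
  also have "\<dots> = (\<Sum>I\<in>keys F - {I0}. nrm (lookup F I)) * (q0 * exp C * gphi powr (V I0 - W))"
    unfolding sum_distrib_right by (intro sum.cong refl) simp
  also have "\<dots> \<le> sz F * (q0 * exp C * gphi powr (V I0 - W))"
    unfolding sz_def using q0 by (intro mult_right_mono sum_mono2) auto
  finally have main: "q0 * \<bar>emb1 (lookup F I0)\<bar> * gphi powr V I0 \<le> sz F * (q0 * exp C * gphi powr (V I0 - W))"
    by (simp add: abs_mult Q0)
  have "q0 * gphi powr (V I0 - W) * (\<bar>emb1 (lookup F I0)\<bar> * gphi powr W) \<le> q0 * gphi powr (V I0 - W) * (sz F * exp C)"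
  proof -
    have "gphi powr V I0 = gphi powr (V I0 - W) * gphi powr W" by (simp add: powr_add[symmetric])
    then show ?thesis
      using main by (simp only: ac_simps)
  qed
  moreover have "0 < q0 * gphi powr (V I0 - W)" using q0 by simp
  ultimately have "\<bar>emb1 (lookup F I0)\<bar> * gphi powr W \<le> sz F * exp C" by (simp only: mult_le_cancel_left_pos)
  then have "\<bar>emb1 (lookup F I0)\<bar> * gphi powr W * sz F \<le> sz F * exp C * sz F" by (intro mult_right_mono) auto
  moreover have "1 * gphi powr W \<le> \<bar>emb1 (lookup F I0)\<bar> * sz F * gphi powr W" using f0 by (intro mult_right_mono) auto
  moreover have "\<bar>emb1 (lookup F I0)\<bar> * sz F * gphi powr W = \<bar>emb1 (lookup F I0)\<bar> * gphi powr W * sz F"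
    by (simp only: ac_simps)
  ultimately have "gphi powr W \<le> sz F * exp C * sz F" by linarith
  also have "\<dots> \<le> exp (X * H) * exp C * exp (X * H)"
    using F(4) by (intro mult_mono) (auto simp: X_def)
  also have "\<dots> = exp (C + 2 * X * H)" by (simp add: exp_add[symmetric])
  finally have "exp (W * ln gphi) \<le> exp (C + 2 * X * H)" by (simp add: powr_def)
  then have "W * ln gphi \<le> C + 2 * X * H" by simp
  moreover have "C + 2 * X * H < W * ln gphi"
  proof -
    have "X * (real s * (real s * B + 1) * ln 4 + 2 * H) < X * (\<tau> / (3 * (B + 1)) * n * ln gphi)"
      using size X1 by (intro mult_strict_left_mono) auto
    then show ?thesis by (simp add: C_def W_def algebra_simps)
  qed
  ultimately show False by simp
qed

subsection \<open>The auxiliary polynomial\<close>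

lemma sum_PiE_single:
  fixes f :: "'b \<Rightarrow> real"
  assumes "finite A" "\<And>x. x \<in> A \<Longrightarrow> finite (B x)" "c \<in> A"
  shows "(\<Sum>g\<in>PiE A B. f (g c)) = (\<Sum>y\<in>B c. f y) * (\<Prod>x\<in>A - {c}. real (card (B x)))"
proof -
  have "(\<Sum>g\<in>PiE A B. f (g c)) = (\<Sum>g\<in>PiE A B. \<Prod>x\<in>A. if x = c then f (g x) else 1)"
    using assms by (intro sum.cong refl) (simp add: prod.remove[of A c])
  also have "\<dots> = (\<Prod>x\<in>A. \<Sum>y\<in>B x. if x = c then f y else 1)"
    by (rule prod_sum_PiE[symmetric]) (use assms in auto)
  also have "\<dots> = (\<Sum>y\<in>B c. f y) * (\<Prod>x\<in>A - {c}. real (card (B x)))"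
    using assms by (simp add: prod.remove[of A c])
  finally show ?thesis .
qed

lemma sum_PiE_pair_eq_0:
  fixes f h :: "'b \<Rightarrow> real"
  assumes "finite A" "\<And>x. x \<in> A \<Longrightarrow> finite (B x)" "c \<in> A" "d \<in> A" "c \<noteq> d" "(\<Sum>y\<in>B c. f y) = 0"
  shows "(\<Sum>g\<in>PiE A B. f (g c) * h (g d)) = 0"
proof -
  have "(\<Sum>g\<in>PiE A B. f (g c) * h (g d))
      = (\<Sum>g\<in>PiE A B. \<Prod>x\<in>A. if x = c then f (g x) else if x = d then h (g x) else 1)"
  proof (intro sum.cong refl)
    fix g
    have "(\<Prod>x\<in>A. if x = c then f (g x) else if x = d then h (g x) else 1)
        = f (g c) * (\<Prod>x\<in>A - {c}. if x = d then h (g x) else 1)"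
      using assms by (subst prod.remove[of A c]) (auto intro!: prod.cong)
    also have "(\<Prod>x\<in>A - {c}. if x = d then h (g x) else 1) = h (g d)"
      using assms by (subst prod.remove[of _ d]) auto
    finally show "f (g c) * h (g d) = (\<Prod>x\<in>A. if x = c then f (g x) else if x = d then h (g x) else 1)" by simp
  qed
  also have "\<dots> = (\<Prod>x\<in>A. \<Sum>y\<in>B x. if x = c then f y else if x = d then h y else 1)"
    by (rule prod_sum_PiE[symmetric]) (use assms in auto)
  also have "\<dots> = 0" using assms by (intro prod_zero bexI[of _ c]) auto
  finally show ?thesis .
qed

text \<open>Chebyshev's inequality for the uniform distribution on the product: coordinates are
  independent and centred, so the mixed terms of the second moment vanish.\<close>

lemma card_deviation_le:
  fixes y :: "'a \<Rightarrow> 'b \<Rightarrow> real"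
  assumes fin: "finite A" "\<And>x. x \<in> A \<Longrightarrow> finite (B x)"
    and mean: "\<And>c. c \<in> A \<Longrightarrow> (\<Sum>t\<in>B c. y c t) = 0"
    and bound: "\<And>c t. c \<in> A \<Longrightarrow> t \<in> B c \<Longrightarrow> \<bar>y c t\<bar> \<le> b"
    and \<kappa>: "0 \<le> \<kappa>"
  shows "real (card {g \<in> PiE A B. \<kappa> < \<bar>\<Sum>c\<in>A. y c (g c)\<bar>}) * \<kappa>\<^sup>2 \<le> real (card (PiE A B)) * (real (card A) * b\<^sup>2)"
proof -
  let ?S = "\<lambda>g. \<Sum>c\<in>A. y c (g c)"
  let ?X = "{g \<in> PiE A B. \<kappa> < \<bar>?S g\<bar>}"
  have finP: "finite (PiE A B)" using fin by (intro finite_PiE) auto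
  have "real (card ?X) * \<kappa>\<^sup>2 = (\<Sum>g\<in>?X. \<kappa>\<^sup>2)" by simp
  also have "\<dots> \<le> (\<Sum>g\<in>?X. (?S g)\<^sup>2)"
  proof (rule sum_mono)
    fix g assume "g \<in> ?X"
    then have "\<kappa>\<^sup>2 \<le> \<bar>?S g\<bar>\<^sup>2" using \<kappa> by (intro power_mono) auto
    then show "\<kappa>\<^sup>2 \<le> (?S g)\<^sup>2" by simp
  qed
  also have "\<dots> \<le> (\<Sum>g\<in>PiE A B. (?S g)\<^sup>2)" using finP by (intro sum_mono2) auto
  also have "\<dots> = (\<Sum>g\<in>PiE A B. \<Sum>c\<in>A. \<Sum>d\<in>A. y c (g c) * y d (g d))"
    by (simp add: power2_eq_square sum_product)
  also have "\<dots> = (\<Sum>c\<in>A. \<Sum>d\<in>A. \<Sum>g\<in>PiE A B. y c (g c) * y d (g d))"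
    by (subst sum.swap, intro sum.cong refl, rule sum.swap)
  also have "\<dots> = (\<Sum>c\<in>A. \<Sum>d\<in>A. if d = c then \<Sum>g\<in>PiE A B. y c (g c) * y c (g c) else 0)"
  proof (intro sum.cong refl)
    fix c d assume cd: "c \<in> A" "d \<in> A"
    show "(\<Sum>g\<in>PiE A B. y c (g c) * y d (g d)) = (if d = c then \<Sum>g\<in>PiE A B. y c (g c) * y c (g c) else 0)"
    proof (cases "d = c")
      case False
      then have "(\<Sum>g\<in>PiE A B. y c (g c) * y d (g d)) = 0"
        using fin mean cd by (intro sum_PiE_pair_eq_0) auto
      then show ?thesis using False by simp
    qed simp
  qed
  also have "\<dots> = (\<Sum>c\<in>A. \<Sum>g\<in>PiE A B. y c (g c) * y c (g c))" using fin by simp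
  also have "\<dots> \<le> (\<Sum>c\<in>A. \<Sum>g\<in>PiE A B. b\<^sup>2)"
  proof (intro sum_mono)
    fix c g assume "c \<in> A" "g \<in> PiE A B"
    then have "\<bar>y c (g c)\<bar> \<le> b" by (intro bound) auto
    then have "\<bar>y c (g c)\<bar>\<^sup>2 \<le> b\<^sup>2" by (intro power_mono) auto
    then show "y c (g c) * y c (g c) \<le> b\<^sup>2" by (simp add: power2_eq_square)
  qed
  also have "\<dots> = real (card (PiE A B)) * (real (card A) * b\<^sup>2)" by simp
  finally show ?thesis .
qed

text \<open>Markov's inequality for the number of coordinates that fall into their bad sets, whose
  mean is at most \<open>card A * \<rho>\<close>.\<close>

lemma card_many_bad_le:
  fixes Bd :: "'a \<Rightarrow> 'b set"
  assumes fin: "finite A" "\<And>x. x \<in> A \<Longrightarrow> finite (B x)"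
    and Bd: "\<And>c. c \<in> A \<Longrightarrow> Bd c \<subseteq> B c" "\<And>c. c \<in> A \<Longrightarrow> real (card (Bd c)) \<le> \<rho> * real (card (B c))"
  shows "real (card {g \<in> PiE A B. m \<le> card {c \<in> A. g c \<in> Bd c}}) * real m
    \<le> real (card (PiE A B)) * (real (card A) * \<rho>)"
proof -
  let ?n = "\<lambda>g. real (card {c \<in> A. g c \<in> Bd c})"
  let ?X = "{g \<in> PiE A B. m \<le> card {c \<in> A. g c \<in> Bd c}}"
  have finP: "finite (PiE A B)" using fin by (intro finite_PiE) auto
  have "real (card ?X) * real m = (\<Sum>g\<in>?X. real m)" by simp
  also have "\<dots> \<le> (\<Sum>g\<in>?X. ?n g)" by (intro sum_mono) auto
  also have "\<dots> \<le> (\<Sum>g\<in>PiE A B. ?n g)" using finP by (intro sum_mono2) auto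
  also have "\<dots> = (\<Sum>g\<in>PiE A B. \<Sum>c\<in>A. if g c \<in> Bd c then 1 else 0)"
    using fin by (intro sum.cong refl) (simp add: sum.If_cases Int_def)
  also have "\<dots> = (\<Sum>c\<in>A. \<Sum>g\<in>PiE A B. if g c \<in> Bd c then 1 else 0)" by (rule sum.swap)
  also have "\<dots> \<le> (\<Sum>c\<in>A. \<rho> * real (card (PiE A B)))"
  proof (rule sum_mono)
    fix c assume c: "c \<in> A"
    have "(\<Sum>g\<in>PiE A B. if g c \<in> Bd c then 1 else (0::real))
      = (\<Sum>y\<in>B c. if y \<in> Bd c then 1 else 0) * (\<Prod>x\<in>A - {c}. real (card (B x)))"
      using fin c by (rule sum_PiE_single)
    also have "(\<Sum>y\<in>B c. if y \<in> Bd c then 1 else (0::real)) = real (card (Bd c))"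
      using fin c Bd(1)[OF c] by (simp add: sum.If_cases Int_absorb1)
    also have "real (card (Bd c)) * (\<Prod>x\<in>A - {c}. real (card (B x)))
      \<le> \<rho> * real (card (B c)) * (\<Prod>x\<in>A - {c}. real (card (B x)))"
      using Bd(2)[OF c] by (intro mult_right_mono prod_nonneg) auto
    also have "\<dots> = \<rho> * real (card (PiE A B))"
      using fin c by (simp add: card_PiE prod.remove[of A c])
    finally show "(\<Sum>g\<in>PiE A B. if g c \<in> Bd c then 1 else (0::real)) \<le> \<rho> * real (card (PiE A B))" .
  qed
  also have "\<dots> = real (card (PiE A B)) * (real (card A) * \<rho>)" by simp
  finally show ?thesis .
qed

section \<open>Siegel's lemma over the golden integers\<close>

lemma zphi_coeffs_le:
  "\<bar>real_of_int (zphi_coeff z)\<bar> \<le> nrm z" "\<bar>real_of_int (zre z)\<bar> \<le> 3 * nrm z"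
proof -
  have s5: "2 \<le> gphi - gpsi"
  proof -
    have "gphi - gpsi = sqrt 5" by (simp add: gphi_def gpsi_def field_simps)
    moreover have "2 \<le> sqrt 5" by (rule real_le_rsqrt) simp
    ultimately show ?thesis by simp
  qed
  have "real_of_int (zphi_coeff z) * (gphi - gpsi) = emb1 z - emb2 z"
    by (simp add: emb1_def emb2_def algebra_simps)
  then have "\<bar>real_of_int (zphi_coeff z)\<bar> * (gphi - gpsi) = \<bar>emb1 z - emb2 z\<bar>"
    using s5 by (metis abs_mult abs_of_nonneg order_trans zero_le_numeral)
  moreover have "\<bar>emb1 z - emb2 z\<bar> \<le> 2 * nrm z" using emb_le_nrm[of z] by linarith
  moreover have "\<bar>real_of_int (zphi_coeff z)\<bar> * 2 \<le> \<bar>real_of_int (zphi_coeff z)\<bar> * (gphi - gpsi)"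
    using s5 by (intro mult_left_mono) auto
  ultimately show b: "\<bar>real_of_int (zphi_coeff z)\<bar> \<le> nrm z" by linarith
  have "\<bar>real_of_int (zphi_coeff z) * gphi\<bar> \<le> nrm z * 2"
    unfolding abs_mult using b gphi_bounds by (intro mult_mono) auto
  moreover have "real_of_int (zre z) = emb1 z - real_of_int (zphi_coeff z) * gphi"
    by (simp add: emb1_def)
  ultimately show "\<bar>real_of_int (zre z)\<bar> \<le> 3 * nrm z" using emb_le_nrm(1)[of z] by linarith
qed

lemma finite_nrm_ball:
  assumes "0 \<le> Y"
  shows "finite {z. nrm z \<le> Y}" "real (card {z. nrm z \<le> Y}) \<le> (6 * Y + 1)\<^sup>2"
proof -
  define k where "k = \<lfloor>3 * Y\<rfloor>"
  have k0: "0 \<le> k" using assms by (simp add: k_def)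
  let ?f = "\<lambda>(a, b). ZP a b"
  let ?R = "{-k..k} \<times> {-k..k}"
  have sub: "{z. nrm z \<le> Y} \<subseteq> ?f ` ?R"
  proof
    fix z assume "z \<in> {z. nrm z \<le> Y}"
    then have z: "nrm z \<le> Y" by simp
    have "\<bar>real_of_int (zphi_coeff z)\<bar> \<le> 3 * Y" "\<bar>real_of_int (zre z)\<bar> \<le> 3 * Y"
      using zphi_coeffs_le[of z] z nrm_nonneg[of z] by linarith+
    then have "\<bar>zphi_coeff z\<bar> \<le> k" "\<bar>zre z\<bar> \<le> k" unfolding k_def by (simp_all add: le_floor_iff)
    then have "(zre z, zphi_coeff z) \<in> ?R" by auto
    moreover have "z = ?f (zre z, zphi_coeff z)" by simp
    ultimately show "z \<in> ?f ` ?R" by blast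
  qed
  then show "finite {z. nrm z \<le> Y}" by (rule finite_subset) auto
  have "card {z. nrm z \<le> Y} \<le> card (?f ` ?R)" using sub by (intro card_mono) auto
  also have "\<dots> \<le> card ?R" by (intro card_image_le) auto
  also have "\<dots> = nat (2 * k + 1) * nat (2 * k + 1)" by (simp add: card_cartesian_product)
  finally have "real (card {z. nrm z \<le> Y}) \<le> real (nat (2 * k + 1)) * real (nat (2 * k + 1))"
    by (metis of_nat_le_iff of_nat_mult)
  also have "\<dots> = (2 * real_of_int k + 1)\<^sup>2" using k0 by (simp add: power2_eq_square)
  also have "\<dots> \<le> (6 * Y + 1)\<^sup>2"
  proof (rule power_mono)
    have "real_of_int k \<le> 3 * Y" by (simp add: k_def)
    then show "2 * real_of_int k + 1 \<le> 6 * Y + 1" by simp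
  qed (use k0 in simp)
  finally show "real (card {z. nrm z \<le> Y}) \<le> (6 * Y + 1)\<^sup>2" .
qed

text \<open>Pigeonhole. With integer unknowns in [0, X], every equation takes values of house at
  most u X H, where u is the number of unknowns; as 6 u H is at most X, that is about X^2 / 6. An
  element has two coordinates, so there are at most (X + 1)^4 values, which explains the factor
  4.\<close>

lemma siegel:
  fixes C :: "'u \<Rightarrow> 't \<Rightarrow> zphi"
  assumes fin: "finite U" "finite T" and card: "4 * card T < card U"
    and C: "\<And>u t. u \<in> U \<Longrightarrow> t \<in> T \<Longrightarrow> nrm (C u t) \<le> H" and H: "1 \<le> H"
  shows "\<exists>\<xi> :: 'u \<Rightarrow> int. (\<exists>u\<in>U. \<xi> u \<noteq> 0) \<and> (\<forall>u\<in>U. \<bar>of_int (\<xi> u)\<bar> \<le> 7 * real (card U) * H) \<and>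
    (\<forall>t\<in>T. (\<Sum>u\<in>U. of_int (\<xi> u) * C u t) = 0)"
proof -
  let ?u = "real (card U)"
  have u1: "1 \<le> ?u" using card by simp
  have uH: "1 \<le> ?u * H" using u1 H mult_mono[of 1 ?u 1 H] by simp
  define X where "X = nat \<lceil>6 * ?u * H\<rceil>"
  have X: "6 * ?u * H \<le> real X" "real X \<le> 7 * ?u * H"
  proof -
    show "6 * ?u * H \<le> real X" unfolding X_def by (rule real_nat_ceiling_ge)
    have "real X = real_of_int \<lceil>6 * ?u * H\<rceil>"
      unfolding X_def using uH by (intro of_nat_nat) (simp add: ceiling_mono) 
    also have "\<dots> \<le> 6 * ?u * H + 1" by linarith
    finally show "real X \<le> 7 * ?u * H" using uH by linarith
  qed
  have X1: "1 \<le> X" using X(1) uH by linarith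
  define P where "P = PiE U (\<lambda>_. {..X})"
  define Y where "Y = ?u * real X * H"
  have Y0: "0 \<le> Y" using H by (simp add: Y_def)
  define Z where "Z = {z. nrm z \<le> Y}"
  define \<Phi> where "\<Phi> g = restrict (\<lambda>t. \<Sum>u\<in>U. of_nat (g u) * C u t) T" for g :: "'u \<Rightarrow> nat"
  have \<Phi>: "\<Phi> ` P \<subseteq> PiE T (\<lambda>_. Z)"
  proof
    fix f assume "f \<in> \<Phi> ` P"
    then obtain g where g: "g \<in> P" "f = \<Phi> g" by blast
    have "nrm (\<Sum>u\<in>U. of_nat (g u) * C u t) \<le> Y" if t: "t \<in> T" for t
    proof -
      have "nrm (\<Sum>u\<in>U. of_nat (g u) * C u t) \<le> (\<Sum>u\<in>U. nrm (of_nat (g u) * C u t))" by (rule nrm_sum)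
      also have "\<dots> \<le> (\<Sum>u\<in>U. real X * H)"
      proof (rule sum_mono)
        fix u assume u: "u \<in> U"
        have "nrm (of_nat (g u) * C u t) \<le> real (g u) * nrm (C u t)" using nrm_mult[of "of_nat (g u)" "C u t"] by simp
        also have "\<dots> \<le> real X * H" using g u C[OF u t] by (intro mult_mono) (auto simp: P_def)
        finally show "nrm (of_nat (g u) * C u t) \<le> real X * H" .
      qed
      finally show ?thesis by (simp add: Y_def mult.assoc)
    qed
    then show "f \<in> PiE T (\<lambda>_. Z)" using g by (auto simp: \<Phi>_def Z_def)
  qed
  have finZ: "finite Z" unfolding Z_def using Y0 by (rule finite_nrm_ball)
  have cardZ: "card Z \<le> (X + 1) ^ 4"
  proof -
    have "real (card Z) \<le> (6 * Y + 1)\<^sup>2" unfolding Z_def using Y0 by (rule finite_nrm_ball)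
    also have "\<dots> \<le> ((real X + 1)\<^sup>2)\<^sup>2"
    proof (rule power_mono)
      have "6 * Y = (6 * ?u * H) * real X" by (simp add: Y_def)
      also have "\<dots> \<le> real X * real X" using X(1) by (intro mult_right_mono) auto
      finally show "6 * Y + 1 \<le> (real X + 1)\<^sup>2" by (simp add: power2_eq_square algebra_simps)
    qed (use Y0 in simp)
    also have "\<dots> = real ((X + 1) ^ 4)" by (simp add: power_mult[symmetric] add.commute)
    finally show ?thesis by (simp only: of_nat_le_iff)
  qed
  have "card (\<Phi> ` P) \<le> card (PiE T (\<lambda>_. Z))" using \<Phi> fin finZ by (intro card_mono finite_PiE) auto
  also have "\<dots> = card Z ^ card T" using fin by (simp add: card_PiE)
  also have "\<dots> \<le> ((X + 1) ^ 4) ^ card T" using cardZ by (rule power_mono) simp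
  also have "\<dots> = (X + 1) ^ (4 * card T)" by (simp add: power_mult)
  also have "\<dots> < (X + 1) ^ card U" using card X1 by (intro power_strict_increasing) auto
  also have "\<dots> = card P" using fin by (simp add: P_def card_PiE)
  finally have "\<not> inj_on \<Phi> P" by (rule pigeonhole)
  then obtain g g' where gg: "g \<in> P" "g' \<in> P" "\<Phi> g = \<Phi> g'" "g \<noteq> g'" by (auto simp: inj_on_def)
  define \<xi> where "\<xi> u = int (g u) - int (g' u)" for u
  have "\<exists>u\<in>U. g u \<noteq> g' u"
  proof (rule ccontr)
    assume "\<not> ?thesis"
    then have "g = g'" using gg by (intro PiE_ext[of g U "\<lambda>_. {..X}" g']) (auto simp: P_def)
    then show False using gg by simp
  qed
  then have "\<exists>u\<in>U. \<xi> u \<noteq> 0" by (auto simp: \<xi>_def)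
  moreover have "\<bar>of_int (\<xi> u)\<bar> \<le> 7 * ?u * H" if u: "u \<in> U" for u
  proof -
    have "g u \<le> X" "g' u \<le> X" using gg u by (auto simp: P_def)
    then have "\<bar>real_of_int (\<xi> u)\<bar> \<le> real X" by (simp add: \<xi>_def)
    then show ?thesis using X(2) by linarith
  qed
  moreover have "(\<Sum>u\<in>U. of_int (\<xi> u) * C u t) = 0" if t: "t \<in> T" for t
  proof -
    have "\<Phi> g t = \<Phi> g' t" using gg by simp
    then show ?thesis using t by (simp add: \<Phi>_def \<xi>_def left_diff_distrib sum_subtractf)
  qed
  ultimately show ?thesis by (intro exI[of _ \<xi>]) blast
qed

section \<open>Leading monomials\<close>

definition led :: "'a::zero mpoly \<Rightarrow> mon \<Rightarrow> bool" where
  "led G I \<longleftrightarrow> I \<in> keys G \<and> (\<forall>K\<in>keys G. K \<le> I)"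

lemma led_single: "a \<noteq> 0 \<Longrightarrow> led (Poly_Mapping.single I a) I"
  by (simp add: led_def)

lemma led_mult:
  fixes F G :: "'a::idom mpoly"
  assumes "led F I" "led G J"
  shows "led (F * G) (I + J)"
proof -
  have le: "K \<le> I" if "K \<in> keys F" for K using assms that by (auto simp: led_def)
  have le': "K \<le> J" if "K \<in> keys G" for K using assms that by (auto simp: led_def)
  have uniq: "k = I \<and> m = J" if "k \<in> keys F" "m \<in> keys G" "k + m = I + J" for k m
  proof (rule ccontr)
    assume "\<not> ?thesis"
    then have "k < I \<or> m < J" using le[OF that(1)] le'[OF that(2)] by auto
    then have "k + m < I + J"
      using le[OF that(1)] le'[OF that(2)] by (auto intro: add_less_le_mono add_le_less_mono)
    then show False using that by simp
  qed
  have IJ: "I \<in> keys F" "J \<in> keys G" using assms by (auto simp: led_def)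
  have "lookup (F * G) (I + J) = (\<Sum>k\<in>keys F. \<Sum>m\<in>keys G. if k = I then if m = J then lookup F I * lookup G J else 0 else 0)"
    unfolding lookup_mult_eq_sum by (intro sum.cong refl) (use uniq in \<open>auto simp: when_def\<close>)
  also have "\<dots> = lookup F I * lookup G J"
  proof -
    have "(\<Sum>m\<in>keys G. if k = I then if m = J then lookup F I * lookup G J else 0 else 0)
        = (if k = I then lookup F I * lookup G J else 0)" for k
      using IJ by (cases "k = I") (simp_all add: sum.delta)
    then show ?thesis using IJ by (simp add: sum.delta)
  qed
  finally have "I + J \<in> keys (F * G)" using IJ by (simp add: in_keys_iff)
  moreover have "K \<le> I + J" if "K \<in> keys (F * G)" for K
  proof -
    have "\<exists>a b. K = a + b \<and> a \<in> keys F \<and> b \<in> keys G" using keys_mult that by blast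
    then show ?thesis using le le' by (auto intro: add_mono)
  qed
  ultimately show ?thesis by (simp add: led_def)
qed

lemma led_prod:
  fixes F :: "'b \<Rightarrow> 'a::idom mpoly"
  assumes "\<And>x. x \<in> S \<Longrightarrow> led (F x) (I x)"
  shows "led (\<Prod>x\<in>S. F x) (\<Sum>x\<in>S. I x)"
  using assms
proof (induction S rule: infinite_finite_induct)
  case (insert x S)
  then show ?case by (simp add: led_mult)
qed (simp_all add: led_def)

text \<open>The q-adic counterpart of \<open>van\<close>: a derivative \<open>b\<close> may lose
  \<open>\<nu> b\<close> factors \<open>q\<close> out of \<open>e\<close>. Truncated subtraction
  makes the condition void once everything is lost.\<close>

definition dvq :: "nat \<Rightarrow> (mon \<Rightarrow> nat) \<Rightarrow> (nat \<Rightarrow> 'a) \<Rightarrow> nat \<Rightarrow> 'a::comm_ring_1 mpoly \<Rightarrow> bool" where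
  "dvq q \<nu> p e F \<longleftrightarrow> (\<forall>b. of_nat q ^ (e - \<nu> b) dvd ev p b F)"

lemma dvq_0 [simp]: "dvq q \<nu> p 0 F"
  by (simp add: dvq_def)

lemma dvq_mono: "dvq q \<nu> p e F \<Longrightarrow> e' \<le> e \<Longrightarrow> dvq q \<nu> p e' F"
  unfolding dvq_def by (meson diff_le_mono dvd_trans le_imp_power_dvd)

lemma dvq_sum: "(\<And>x. x \<in> S \<Longrightarrow> dvq q \<nu> p e (F x)) \<Longrightarrow> dvq q \<nu> p e (\<Sum>x\<in>S. F x)"
  by (auto simp: dvq_def ev_sum intro: dvd_sum)

lemma dvq_mult:
  assumes \<nu>: "\<And>a b. \<nu> (a + b) = \<nu> a + \<nu> b" and F: "dvq q \<nu> p e F" and G: "dvq q \<nu> p e' G"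
  shows "dvq q \<nu> p (e + e') (F * G)"
  unfolding dvq_def
proof
  fix b
  have "ev p b (F * G) = (\<Sum>k\<in>keys (tau p F). \<Sum>m\<in>keys (tau p G). ev p k F * ev p m G when k + m = b)"
    by (simp add: lookup_tau[symmetric] tau_mult lookup_mult_eq_sum)
  moreover have "of_nat q ^ (e + e' - \<nu> b) dvd (ev p k F * ev p m G when k + m = b)" for k m
  proof (cases "k + m = b")
    case True
    have "e + e' - \<nu> b \<le> (e - \<nu> k) + (e' - \<nu> m)" using True \<nu>[of k m] by simp
    then have "(of_nat q :: 'a) ^ (e + e' - \<nu> b) dvd of_nat q ^ ((e - \<nu> k) + (e' - \<nu> m))"
      by (rule le_imp_power_dvd)
    also have "\<dots> dvd ev p k F * ev p m G"
      unfolding power_add using F G by (intro mult_dvd_mono) (auto simp: dvq_def)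
    finally show ?thesis using True by simp
  qed simp
  ultimately show "of_nat q ^ (e + e' - \<nu> b) dvd ev p b (F * G)" by (auto intro!: dvd_sum)
qed

lemma dvq_prod:
  assumes \<nu>: "\<And>a b. \<nu> (a + b) = \<nu> a + \<nu> b" and "\<And>x. x \<in> S \<Longrightarrow> dvq q \<nu> p (e x) (F x)"
  shows "dvq q \<nu> p (\<Sum>x\<in>S. e x) (\<Prod>x\<in>S. F x)"
  using assms(2) by (induction S rule: infinite_finite_induct) (auto intro!: dvq_mult \<nu>)

lemma dvq_const_mult: "dvq q \<nu> p e F \<Longrightarrow> dvq q \<nu> p e (Poly_Mapping.single 0 a * F)"
proof -
  have "ev p b (Poly_Mapping.single 0 a * F) = a * ev p b F" for b
    by (simp add: lookup_tau[symmetric] tau_mult tau_single tmon_def)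
  then show "dvq q \<nu> p e F \<Longrightarrow> dvq q \<nu> p e (Poly_Mapping.single 0 a * F)"
    by (auto simp: dvq_def)
qed

text \<open>Only the value of \<open>P\<close> is known to be divisible. Giving each variable of its
  block the weight \<open>R\<close> makes any derivative inside the block lose all the divisibility,
  and derivatives in other variables give 0.\<close>

lemma dvd_ev_imp_dvq:
  fixes P :: "zphi mpoly"
  assumes keys: "\<And>I. I \<in> keys P \<Longrightarrow> keys I \<subseteq> C" and R: "\<And>c. c \<in> C \<Longrightarrow> Rv c = R"
    and q: "of_nat q ^ R dvd ev p 0 P"
  shows "dvq q (wt Rv) p R P"
  unfolding dvq_def
proof
  fix b :: mon
  consider "b = 0" | c where "c \<in> keys b" "c \<in> C" | "b \<noteq> 0" "keys b \<inter> C = {}" by blast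
  then show "of_nat q ^ (R - wt Rv b) dvd ev p b P"
  proof cases
    case 1
    then show ?thesis using q by simp
  next
    case 2
    have "R * 1 \<le> Rv c * lookup b c" using 2 R by (intro mult_mono) (auto simp: in_keys_iff)
    also have "\<dots> \<le> wt Rv b" unfolding wt_def
      using 2 member_le_sum[of c "keys b" "\<lambda>c. of_nat (lookup b c) * Rv c"] by (simp add: mult.commute)
    finally show ?thesis by simp
  next
    case 3
    have "bin I b = 0" if "I \<in> keys P" for I
      using 3 keys[OF that] by (intro bin_eq_0) (metis disjoint_iff keys_eq_empty subset_iff ex_in_conv)
    then have "ev p b P = 0" by (simp add: ev_def)
    then show ?thesis by simp
  qed
qed

text \<open>For each point \<open>g\<close> of a box of exponents there is a product
  \<open>G g\<close> with leading monomial \<open>mn g\<close>: in blocks with room for it, a power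
  of \<open>P h\<close> replaces part of the monomial. By Markov at least 7/8 of the points have
  \<open>m\<close> such blocks, hence enough divisibility by \<open>q\<close>. By Chebyshev at most
  1/8 of the monomials are too far from the centre. Siegel's lemma kills those, since 4 * (1/8) <
  7/8.\<close>

lemma auxiliary_polynomial:
  fixes d jj R :: "nat \<Rightarrow> nat" and P :: "nat \<Rightarrow> zphi mpoly" and v :: "nat \<Rightarrow> real"
  assumes m: "1 \<le> m" and s: "1 \<le> s"
    and d: "\<And>h. h < 2 * m \<Longrightarrow> 32 * s * Am * jj h \<le> d h"
    and P0: "\<And>h. h < 2 * m \<Longrightarrow> P h \<noteq> 0"
    and P: "\<And>h I. h < 2 * m \<Longrightarrow> I \<in> keys (P h) \<Longrightarrow> keys I \<subseteq> {h * s..<h * s + s}"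
      "\<And>h I c. h < 2 * m \<Longrightarrow> I \<in> keys (P h) \<Longrightarrow> lookup I c \<le> Am"
    and q: "\<And>h. h < 2 * m \<Longrightarrow> of_nat q ^ R h dvd ev p 0 (P h)"
    and r0: "\<And>h. h < 2 * m \<Longrightarrow> r0 \<le> R h * jj h"
    and v: "\<And>c. c < 2 * m * s \<Longrightarrow> \<bar>v c\<bar> * real (d (c div s)) \<le> \<beta>"
    and \<kappa>: "0 < \<kappa>" "8 * real (2 * m * s) * \<beta>\<^sup>2 \<le> \<kappa>\<^sup>2"
  defines "N \<equiv> \<Prod>c<2 * m * s. real (d (c div s)) + 1"
    and "Hh \<equiv> \<Prod>h<2 * m. sz (P h) ^ jj h"
  obtains F where "F \<noteq> 0" "\<forall>I\<in>keys F. keys I \<subseteq> {..<2 * m * s}"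
    "\<forall>I\<in>keys F. \<forall>c<2 * m * s. lookup I c \<le> d (c div s)"
    "sz F \<le> 7 * N\<^sup>2 * Hh\<^sup>2"
    "\<forall>I\<in>keys F. \<bar>wt v I - (\<Sum>c<2 * m * s. v c * real (d (c div s)) / 2)\<bar> \<le> \<kappa>"
    "dvq q (wt (\<lambda>c. if c < 2 * m * s then R (c div s) else 0)) p (m * r0) F"
proof -
  let ?n = "2 * m * s"
  let ?C = "\<lambda>h. {h * s..<h * s + s}"
  have div: "c div s = h" if "c \<in> ?C h" for c h
    using that s by (intro div_nat_eqI) (auto simp: mult.commute)
  have less: "c < ?n" if "c \<in> ?C h" "h < 2 * m" for c h
  proof -
    have "c < Suc h * s" using that(1) by simp
    also have "\<dots> \<le> 2 * m * s" using that(2) by (intro mult_right_mono) auto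
    finally show ?thesis .
  qed
  have inC: "c \<in> ?C (c div s)" for c
  proof -
    have "c div s * s + c mod s = c" "c mod s < s" using s by auto
    then have "c div s * s \<le> c" "c < c div s * s + s" by linarith+
    then show ?thesis by simp
  qed
  have div_less: "c div s < 2 * m" if "c < ?n" for c
    using that by (simp add: less_mult_imp_div_less)
  define B where "B c = {..d (c div s)}" for c
  define Box where "Box = PiE {..<?n} B"
  have finB: "finite (B c)" for c by (simp add: B_def)
  have finBox: "finite Box" unfolding Box_def using finB by (intro finite_PiE) auto
  have cardBox: "real (card Box) = N"
    by (simp add: Box_def card_PiE N_def B_def add.commute)
  have N1: "1 \<le> N" unfolding N_def by (intro prod_ge_1) auto
  define mn where "mn g = (\<Sum>c<?n. Poly_Mapping.single c (g c))" for g :: "nat \<Rightarrow> nat"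
  have lookup_mn: "lookup (mn g) c = (if c < ?n then g c else 0)" for g c
    by (simp add: mn_def lookup_sum lookup_single when_def)
  have mn_inj: "inj_on mn Box"
  proof (rule inj_onI)
    fix g g' assume gg: "g \<in> Box" "g' \<in> Box" "mn g = mn g'"
    have "g c = g' c" if "c < ?n" for c
      using arg_cong[OF gg(3), of "\<lambda>I. lookup I c"] that by (simp add: lookup_mn)
    then show "g = g'" using gg unfolding Box_def by (intro PiE_ext[of g "{..<?n}" B g']) auto
  qed
  have wt_mn: "wt v (mn g) = (\<Sum>c<?n. v c * real (g c))" for g
    by (subst wt_superset[of "{..<?n}"]) (auto simp: in_keys_iff lookup_mn mult.commute split: if_splits)
  \<comment> \<open>The lower bound lets the leading monomial of the power be divided out, the upper
    bound keeps the degree within \<open>d h\<close> after multiplication.\<close>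
  define good where "good h g \<longleftrightarrow> (\<forall>c\<in>?C h. Am * jj h \<le> g c \<and> g c + Am * jj h \<le> d h)" for h and g :: "nat \<Rightarrow> nat"
  define lam where "lam h = Max (keys (P h))" for h
  have ledP: "led (P h) (lam h)" if "h < 2 * m" for h
  proof -
    have "keys (P h) \<noteq> {}" using P0[OF that] by simp
    then show ?thesis unfolding led_def lam_def by (auto intro: Max_in)
  qed
  define lamj where "lamj h = (\<Sum>i<jj h. lam h)" for h
  have lookup_lamj: "lookup (lamj h) c = jj h * lookup (lam h) c" for h c
    unfolding lamj_def lookup_sum by simp
  have ledPj: "led (P h ^ jj h) (lamj h)" if "h < 2 * m" for h
    using led_prod[of "{..<jj h}" "\<lambda>_. P h" "\<lambda>_. lam h"] ledP[OF that] by (simp add: lamj_def)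
  have lam_keys: "keys (lam h) \<subseteq> ?C h" "lookup (lam h) c \<le> Am" if "h < 2 * m" for h c
    using P[OF that] ledP[OF that] by (auto simp: led_def)
  define bm where "bm h g = (\<Sum>c\<in>?C h. Poly_Mapping.single c (g c))" for h and g :: "nat \<Rightarrow> nat"
  have lookup_bm: "lookup (bm h g) c = (if c \<in> ?C h then g c else 0)" for h g c
    by (simp add: bm_def lookup_sum lookup_single when_def)
  have sum_bm: "(\<Sum>h<2 * m. bm h g) = mn g" for g
    unfolding bm_def mn_def by (rule sum.nat_group)
  \<comment> \<open>In both cases the leading monomial is \<open>bm h g\<close>; in good blocks it
    is the leading monomial of the power of \<open>P h\<close> that is traded against part of the
    monomial.\<close>
  define fac where "fac h g = (if good h g then P h ^ jj h * Poly_Mapping.single (bm h g - lamj h) 1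
      else Poly_Mapping.single (bm h g) 1)" for h g
  have bm_lamj: "lamj h + (bm h g - lamj h) = bm h g" if "h < 2 * m" "good h g" for h g
  proof (intro poly_mapping_eqI)
    fix c
    show "lookup (lamj h + (bm h g - lamj h)) c = lookup (bm h g) c"
    proof (cases "c \<in> ?C h")
      case True
      have "jj h * lookup (lam h) c \<le> jj h * Am" using lam_keys(2)[OF that(1)] by (rule mult_left_mono) simp
      also have "\<dots> \<le> g c" using that(2) True by (auto simp: good_def mult.commute)
      finally show ?thesis using True by (simp add: lookup_add lookup_minus lookup_bm lookup_lamj)
    next
      case False
      then have "lookup (lam h) c = 0" using lam_keys(1)[OF that(1)] by (auto simp: in_keys_iff)
      then show ?thesis using False by (simp add: lookup_add lookup_minus lookup_bm lookup_lamj)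
    qed
  qed
  have led_fac: "led (fac h g) (bm h g)" if "h < 2 * m" for h g
  proof (cases "good h g")
    case True
    have "led (P h ^ jj h * Poly_Mapping.single (bm h g - lamj h) 1) (lamj h + (bm h g - lamj h))"
      by (intro led_mult ledPj that led_single) simp
    then show ?thesis using True bm_lamj[OF that True] by (simp add: fac_def)
  qed (simp add: fac_def led_single)
  have dg_fac: "dg (\<lambda>c. if c \<in> ?C h then real (d h) else 0) (fac h g)" if h: "h < 2 * m" and g: "g \<in> Box" for h g
  proof (cases "good h g")
    case True
    have dgP: "dg (\<lambda>c. if c \<in> ?C h then real Am else 0) (P h)"
      unfolding dg_def
    proof (intro ballI allI)
      fix I c assume I: "I \<in> keys (P h)"
      have "lookup I c = 0" if "c \<notin> ?C h" using P(1)[OF h I] that by (auto simp: in_keys_iff)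
      then show "real (lookup I c) \<le> (if c \<in> ?C h then real Am else 0)" using P(2)[OF h I, of c] by simp
    qed
    have "dg (\<lambda>c. \<Sum>i<jj h. if c \<in> ?C h then real Am else 0) (\<Prod>i<jj h. P h)"
      by (intro dg_prod dgP)
    then have dgPj: "dg (\<lambda>c. real (jj h) * (if c \<in> ?C h then real Am else 0)) (P h ^ jj h)" by simp
    show ?thesis unfolding dg_def
    proof (intro ballI allI)
      fix I c assume "I \<in> keys (fac h g)"
      then have "I \<in> keys (P h ^ jj h * Poly_Mapping.single (bm h g - lamj h) 1)" using True by (simp add: fac_def)
      then have "\<exists>a b. I = a + b \<and> a \<in> keys (P h ^ jj h) \<and> b \<in> keys (Poly_Mapping.single (bm h g - lamj h) (1::zphi))"
        using keys_mult by blast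
      then obtain a where a: "I = a + (bm h g - lamj h)" "a \<in> keys (P h ^ jj h)" by auto
      have "real (lookup a c) \<le> real (jj h) * (if c \<in> ?C h then real Am else 0)"
        using dgPj a(2) unfolding dg_def by blast
      moreover have "lookup (bm h g - lamj h) c \<le> (if c \<in> ?C h then g c else 0)"
        by (simp add: lookup_minus lookup_bm)
      moreover have "g c + Am * jj h \<le> d h" if "c \<in> ?C h" using True that by (auto simp: good_def)
      then have "real (g c) + real Am * real (jj h) \<le> real (d h)" if "c \<in> ?C h"
        using that by (metis of_nat_add of_nat_le_iff of_nat_mult)
      ultimately show "real (lookup I c) \<le> (if c \<in> ?C h then real (d h) else 0)"
        unfolding a(1) lookup_add by (cases "c \<in> ?C h") (auto simp: mult.commute)
    qed
  next
    case False
    have "g c \<le> d h" if "c \<in> ?C h" for c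
    proof -
      have "c \<in> {..<?n}" using less[OF that h] by simp
      then have "g c \<in> B c" using g unfolding Box_def by (rule PiE_mem[rotated])
      then show ?thesis using div[OF that] by (simp add: B_def)
    qed
    then show ?thesis using False by (simp add: fac_def dg_def lookup_bm)
  qed
  have szP1: "1 \<le> sz (P h)" if "h < 2 * m" for h using P0[OF that] by (rule sz_ge_1)
  have sz_fac: "sz (fac h g) \<le> sz (P h) ^ jj h" if "h < 2 * m" for h g
  proof (cases "good h g")
    case True
    have "sz (fac h g) \<le> sz (P h ^ jj h) * sz (Poly_Mapping.single (bm h g - lamj h) 1)"
      using True by (simp only: fac_def if_True sz_mult)
    also have "\<dots> \<le> sz (P h) ^ jj h * 1" by (intro mult_mono sz_power) auto
    finally show ?thesis by simp
  next
    case False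
    then show ?thesis using szP1[OF that] by (simp add: fac_def)
  qed
  define G where "G g = (\<Prod>h<2 * m. fac h g)" for g
  have ledG: "led (G g) (mn g)" for g
    unfolding G_def sum_bm[symmetric] by (intro led_prod led_fac) auto
  have dgG: "real (lookup I c) \<le> (if c < ?n then real (d (c div s)) else 0)"
    if "g \<in> Box" "I \<in> keys (G g)" for g I c
  proof -
    have "dg (\<lambda>c. \<Sum>h<2 * m. if c \<in> ?C h then real (d h) else 0) (G g)"
      unfolding G_def using that(1) by (intro dg_prod dg_fac) auto
    then have "real (lookup I c) \<le> (\<Sum>h<2 * m. if c \<in> ?C h then real (d h) else 0)"
      using that(2) unfolding dg_def by blast
    also have "\<dots> = (\<Sum>h<2 * m. if h = c div s then real (d (c div s)) else 0)"
      using div inC by (intro sum.cong refl) auto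
    also have "\<dots> \<le> (if c < ?n then real (d (c div s)) else 0)"
    proof (cases "c < ?n")
      case False
      have "\<not> c div s < 2 * m"
      proof
        assume "c div s < 2 * m"
        then show False using less[OF inC] False by blast
      qed
      then show ?thesis using False by simp
    qed simp
    finally show ?thesis .
  qed
  have Hh1: "1 \<le> Hh" unfolding Hh_def using szP1 by (intro prod_ge_1 one_le_power) auto
  have szG: "sz (G g) \<le> Hh" for g
  proof -
    have "sz (G g) \<le> (\<Prod>h<2 * m. sz (fac h g))" unfolding G_def by (rule sz_prod)
    also have "\<dots> \<le> Hh" unfolding Hh_def using sz_fac by (intro prod_mono) auto
    finally show ?thesis .
  qed
  define Bd where "Bd c = {t \<in> B c. t < Am * jj (c div s) \<or> d (c div s) < t + Am * jj (c div s)}" for c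
  define U where "U = {g \<in> Box. card {c \<in> {..<?n}. g c \<in> Bd c} < m}"
  have finU: "finite U" using finBox by (simp add: U_def)
  have good_many: "m \<le> card {h \<in> {..<2 * m}. good h g}" if g: "g \<in> U" for g
  proof -
    let ?bad = "{h \<in> {..<2 * m}. \<not> good h g}"
    have "?bad \<subseteq> (\<lambda>c. c div s) ` {c \<in> {..<?n}. g c \<in> Bd c}"
    proof
      fix h assume "h \<in> ?bad"
      then have h: "h < 2 * m" "\<not> good h g" by auto
      then obtain c where c: "c \<in> ?C h" "\<not> (Am * jj h \<le> g c \<and> g c + Am * jj h \<le> d h)"
        by (auto simp: good_def)
      have "c < ?n" "c div s = h" using less[OF c(1) h(1)] div[OF c(1)] by auto
      moreover have "g c \<in> B c"
        using g \<open>c < ?n\<close> by (auto simp: U_def Box_def)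
      ultimately show "h \<in> (\<lambda>c. c div s) ` {c \<in> {..<?n}. g c \<in> Bd c}"
        using c(2) by (auto simp: Bd_def intro!: image_eqI[of _ _ c])
    qed
    then have "card ?bad \<le> card {c \<in> {..<?n}. g c \<in> Bd c}"
      using surj_card_le[of "{c \<in> {..<?n}. g c \<in> Bd c}" ?bad "\<lambda>c. c div s"] by simp
    then have "card ?bad < m" using g by (simp add: U_def)
    moreover have "card {h \<in> {..<2 * m}. good h g} + card ?bad = 2 * m"
    proof -
      have "card ({h \<in> {..<2 * m}. good h g} \<union> ?bad) = card {h \<in> {..<2 * m}. good h g} + card ?bad"
        by (intro card_Un_disjoint) auto
      moreover have "{h \<in> {..<2 * m}. good h g} \<union> ?bad = {..<2 * m}" by auto
      ultimately show ?thesis by simp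
    qed
    ultimately show ?thesis by linarith
  qed
  \<comment> \<open>A coordinate is bad with frequency at most 2 Am jj / (d + 1), at most 1 / (16 s)
    by the choice of degrees. So the mean number of bad coordinates is at most m / 8, and
    \<open>m\<close> of them occur for at most N / 8 points.\<close>
  have cardU: "7 / 8 * N \<le> real (card U)"
  proof -
    let ?V = "{g \<in> Box. m \<le> card {c \<in> {..<?n}. g c \<in> Bd c}}"
    have "real (card ?V) * real m \<le> real (card Box) * (real (card {..<?n}) * (1 / (16 * real s)))"
      unfolding Box_def
    proof (rule card_many_bad_le)
      fix c assume c: "c \<in> {..<?n}"
      show "Bd c \<subseteq> B c" by (auto simp: Bd_def)
      let ?h = "c div s" let ?k = "Am * jj (c div s)"
      have "Bd c \<subseteq> {..<?k} \<union> {d ?h - ?k<..d ?h}" by (auto simp: Bd_def B_def)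
      then have "card (Bd c) \<le> card ({..<?k} \<union> {d ?h - ?k<..d ?h})" by (intro card_mono) auto
      also have "\<dots> \<le> card {..<?k} + card {d ?h - ?k<..d ?h}" by (rule card_Un_le)
      also have "\<dots> \<le> 2 * ?k" by simp
      finally have "16 * s * card (Bd c) \<le> 16 * s * (2 * ?k)" by (intro mult_left_mono) auto
      also have "\<dots> = 32 * s * Am * jj ?h" by simp
      also have "\<dots> \<le> d ?h" using c by (intro d div_less) auto
      finally have "real (16 * s * card (Bd c)) \<le> real (d ?h)" by (simp only: of_nat_le_iff)
      then show "real (card (Bd c)) \<le> 1 / (16 * real s) * real (card (B c))"
        using s by (simp add: B_def field_simps)
    qed (use finB in auto)
    also have "\<dots> = N * (real m / 8)" using s by (simp add: cardBox)
    finally have "real (card ?V) * real m \<le> (N / 8) * real m" by simp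
    then have V: "real (card ?V) \<le> N / 8" using m by (simp add: mult_le_cancel_right)
    have "card Box = card (U \<union> ?V)" by (rule arg_cong[where f = card]) (auto simp: U_def)
    also have "\<dots> = card U + card ?V" using finBox by (intro card_Un_disjoint) (auto simp: U_def)
    finally show ?thesis using V cardBox by simp
  qed
  let ?ctr = "\<Sum>c<?n. v c * real (d (c div s)) / 2"
  \<comment> \<open>The unwanted monomials: those whose weight differs from the mean over the box by
    more than \<open>\<kappa>\<close>. Their coefficients are the linear equations.\<close>
  define T where "T = mn ` {g \<in> Box. \<kappa> < \<bar>\<Sum>c\<in>{..<?n}. v c * (real (g c) - real (d (c div s)) / 2)\<bar>}"
  have finT: "finite T" using finBox by (simp add: T_def)
  have cardT: "real (card T) \<le> N / 8"
  proof -
    let ?X = "{g \<in> Box. \<kappa> < \<bar>\<Sum>c\<in>{..<?n}. v c * (real (g c) - real (d (c div s)) / 2)\<bar>}"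
    have "real (card ?X) * \<kappa>\<^sup>2 \<le> real (card Box) * (real (card {..<?n}) * \<beta>\<^sup>2)"
      unfolding Box_def
    proof (rule card_deviation_le)
      fix c assume c: "c \<in> {..<?n}"
      have gauss: "2 * (\<Sum>t\<le>k. real t) = real k * (real k + 1)" for k :: nat
        by (induction k) (simp_all add: algebra_simps)
      have "(\<Sum>t\<in>B c. v c * (real t - real (d (c div s)) / 2))
        = v c * ((\<Sum>t\<le>d (c div s). real t) - real (card {..d (c div s)}) * (real (d (c div s)) / 2))"
        unfolding B_def by (simp add: sum_distrib_left[symmetric] sum_subtractf)
      also have "(\<Sum>t\<le>d (c div s). real t) - real (card {..d (c div s)}) * (real (d (c div s)) / 2) = 0"
        using gauss[of "d (c div s)"] by (simp add: algebra_simps)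
      finally show "(\<Sum>t\<in>B c. v c * (real t - real (d (c div s)) / 2)) = 0" by simp
    next
      fix c t assume ct: "c \<in> {..<?n}" "t \<in> B c"
      have "\<bar>v c * (real t - real (d (c div s)) / 2)\<bar> \<le> \<bar>v c\<bar> * real (d (c div s))"
        unfolding abs_mult using ct(2) by (intro mult_left_mono) (auto simp: B_def abs_le_iff)
      also have "\<dots> \<le> \<beta>" using ct v by auto
      finally show "\<bar>v c * (real t - real (d (c div s)) / 2)\<bar> \<le> \<beta>" .
    qed (use finB \<kappa> in auto)
    also have "\<dots> = N / 8 * (8 * real ?n * \<beta>\<^sup>2)" by (simp add: cardBox)
    also have "\<dots> \<le> N / 8 * \<kappa>\<^sup>2" using \<kappa> N1 by (intro mult_left_mono) auto
    finally have "real (card ?X) \<le> N / 8" using \<kappa>(1) by (simp add: mult_le_cancel_right)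
    moreover have "card T \<le> card ?X" unfolding T_def using finBox by (intro card_image_le) auto
    ultimately show ?thesis by linarith
  qed
  have cardTU: "4 * card T < card U"
  proof -
    have "4 * real (card T) < real (card U)" using cardT cardU N1 by linarith
    then show ?thesis by linarith
  qed
  obtain \<xi> :: "(nat \<Rightarrow> nat) \<Rightarrow> int" where \<xi>: "\<exists>g\<in>U. \<xi> g \<noteq> 0"
    "\<forall>g\<in>U. \<bar>of_int (\<xi> g)\<bar> \<le> 7 * real (card U) * Hh"
    "\<forall>t\<in>T. (\<Sum>g\<in>U. of_int (\<xi> g) * lookup (G g) t) = 0"
  proof -
    have "\<exists>\<xi> :: (nat \<Rightarrow> nat) \<Rightarrow> int. (\<exists>g\<in>U. \<xi> g \<noteq> 0) \<and> (\<forall>g\<in>U. \<bar>of_int (\<xi> g)\<bar> \<le> 7 * real (card U) * Hh) \<and>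
        (\<forall>t\<in>T. (\<Sum>g\<in>U. of_int (\<xi> g) * lookup (G g) t) = 0)"
      by (intro siegel finU finT cardTU Hh1) (rule order_trans[OF nrm_lookup_le_sz szG])
    then show thesis using that by blast
  qed
  define F where "F = (\<Sum>g\<in>U. Poly_Mapping.single 0 (of_int (\<xi> g)) * G g)"
  have lookup_F: "lookup F I = (\<Sum>g\<in>U. of_int (\<xi> g) * lookup (G g) I)" for I
    by (simp only: F_def lookup_sum lookup_const_mult)
  have UBox: "g \<in> Box" if "g \<in> U" for g using that by (simp add: U_def)
  have keysF: "\<exists>g\<in>U. I \<in> keys (G g)" if "I \<in> keys F" for I
  proof (rule ccontr)
    assume "\<not> ?thesis"
    then have "lookup F I = 0" unfolding lookup_F by (intro sum.neutral) (auto simp: in_keys_iff)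
    then show False using that by (simp add: in_keys_iff)
  qed
  have bound: "real (lookup I c) \<le> (if c < ?n then real (d (c div s)) else 0)" if "I \<in> keys F" for I c
    using keysF[OF that] dgG UBox by blast
  have keys_n: "keys I \<subseteq> {..<?n}" if "I \<in> keys F" for I
  proof
    fix c assume "c \<in> keys I"
    then have "0 < real (lookup I c)" by (simp add: in_keys_iff)
    then show "c \<in> {..<?n}" using bound[OF that, of c] by (auto split: if_splits)
  qed
  \<comment> \<open>The \<open>G g\<close> have distinct leading monomials; the greatest one with a
    nonzero coefficient \<open>\<xi> g\<close> survives.\<close>
  have F0: "F \<noteq> 0"
  proof -
    let ?S = "{g \<in> U. \<xi> g \<noteq> 0}"
    have fin: "finite (mn ` ?S)" and ne: "mn ` ?S \<noteq> {}" using finU \<xi>(1) by auto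
    have "Max (mn ` ?S) \<in> mn ` ?S" using fin ne by (rule Max_in)
    then obtain g where g: "g \<in> U" "\<xi> g \<noteq> 0" "mn g = Max (mn ` ?S)" by auto
    have "lookup F (mn g) = (\<Sum>g'\<in>U. if g' = g then of_int (\<xi> g) * lookup (G g) (mn g) else 0)"
      unfolding lookup_F
    proof (intro sum.cong refl)
      fix g' assume g': "g' \<in> U"
      show "of_int (\<xi> g') * lookup (G g') (mn g) = (if g' = g then of_int (\<xi> g) * lookup (G g) (mn g) else 0)"
      proof (cases "g' = g \<or> \<xi> g' = 0")
        case False
        have "mn g' \<le> mn g" unfolding g(3) using fin False g' by (intro Max_ge) auto
        moreover have "mn g' \<noteq> mn g" using mn_inj UBox[OF g'] UBox[OF g(1)] False by (auto dest: inj_onD)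
        ultimately have "\<not> mn g \<le> mn g'" by auto
        then have "mn g \<notin> keys (G g')" using ledG[of g'] by (auto simp: led_def)
        then show ?thesis using False by (simp add: in_keys_iff)
      qed auto
    qed
    also have "\<dots> = of_int (\<xi> g) * lookup (G g) (mn g)" using finU g by simp
    also have "\<dots> \<noteq> 0" using ledG[of g] g by (simp add: led_def in_keys_iff)
    finally show ?thesis by auto
  qed
  have szF: "sz F \<le> 7 * N\<^sup>2 * Hh\<^sup>2"
  proof -
    have cU: "real (card U) \<le> N" unfolding cardBox[symmetric] using finBox by (simp add: U_def card_mono)
    have "sz F \<le> (\<Sum>g\<in>U. sz (Poly_Mapping.single 0 (of_int (\<xi> g)) * G g))" unfolding F_def by (rule sz_sum)
    also have "\<dots> \<le> (\<Sum>g\<in>U. 7 * N * Hh * Hh)"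
    proof (rule sum_mono)
      fix g assume g: "g \<in> U"
      have "sz (Poly_Mapping.single 0 (of_int (\<xi> g)) * G g) \<le> \<bar>of_int (\<xi> g)\<bar> * sz (G g)"
        using sz_mult[of "Poly_Mapping.single 0 (of_int (\<xi> g))" "G g"] by (simp only: sz_single nrm_of_int)
      also have "\<dots> \<le> (7 * N * Hh) * Hh"
      proof (rule mult_mono)
        have "7 * real (card U) * Hh \<le> 7 * N * Hh" using cU Hh1 by (intro mult_right_mono) auto
        then show "\<bar>of_int (\<xi> g)\<bar> \<le> 7 * N * Hh" using \<xi>(2) g by (meson order_trans)
      qed (use szG N1 Hh1 in auto)
      finally show "sz (Poly_Mapping.single 0 (of_int (\<xi> g)) * G g) \<le> 7 * N * Hh * Hh" .
    qed
    also have "\<dots> = real (card U) * (7 * N * Hh * Hh)" by simp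
    also have "\<dots> \<le> N * (7 * N * Hh * Hh)" using cU N1 Hh1 by (intro mult_right_mono) auto
    finally show ?thesis by (simp add: power2_eq_square mult.assoc mult.left_commute)
  qed
  have weights: "\<bar>wt v I - ?ctr\<bar> \<le> \<kappa>" if I: "I \<in> keys F" for I
  proof (rule ccontr)
    assume neg: "\<not> ?thesis"
    define g where "g = restrict (\<lambda>c. lookup I c) {..<?n}"
    have "lookup I c \<le> d (c div s)" if "c < ?n" for c using bound[OF I, of c] that by simp
    then have gBox: "g \<in> Box" unfolding Box_def g_def B_def by (intro restrict_PiE_iff[THEN iffD2]) auto
    have Ig: "I = mn g"
    proof (intro poly_mapping_eqI)
      fix c
      have "lookup I c = 0" if "\<not> c < ?n" using bound[OF I, of c] that by simp
      then show "lookup I c = lookup (mn g) c" by (simp add: lookup_mn g_def)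
    qed
    have "wt v I - ?ctr = (\<Sum>c\<in>{..<?n}. v c * (real (g c) - real (d (c div s)) / 2))"
      unfolding Ig wt_mn by (simp add: sum_subtractf right_diff_distrib)
    then have "I \<in> T" using neg gBox Ig by (auto simp: T_def)
    then have "lookup F I = 0" using \<xi>(3) by (simp add: lookup_F)
    then show False using I by (simp add: in_keys_iff)
  qed
  let ?R = "\<lambda>c. if c < ?n then R (c div s) else 0"
  have dvF: "dvq q (wt ?R) p (m * r0) F"
    unfolding F_def
  proof (intro dvq_sum dvq_const_mult)
    fix g assume g: "g \<in> U"
    let ?e = "\<lambda>h. if good h g then R h * jj h else 0"
    have "dvq q (wt ?R) p (\<Sum>h<2 * m. ?e h) (G g)"
      unfolding G_def
    proof (rule dvq_prod)
      show "wt ?R (a + b) = wt ?R a + wt ?R b" for a b by (rule wt_add)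
      fix h assume "h \<in> {..<2 * m}"
      then have h: "h < 2 * m" by simp
      have "dvq q (wt ?R) p (R h) (P h)"
        by (rule dvd_ev_imp_dvq[where C = "?C h"]) (use P(1)[OF h] q[OF h] div less[OF _ h] in auto)
      then have "dvq q (wt ?R) p (\<Sum>i<jj h. R h) (\<Prod>i<jj h. P h)"
        by (intro dvq_prod wt_add)
      then have "dvq q (wt ?R) p (R h * jj h + 0) (P h ^ jj h * Poly_Mapping.single (bm h g - lamj h) 1)"
        by (intro dvq_mult wt_add dvq_0) (simp add: mult.commute)
      then show "dvq q (wt ?R) p (?e h) (fac h g)" by (simp add: fac_def)
    qed
    \<comment> \<open>At least \<open>m\<close> of the blocks are good, and each of them contributes
      at least \<open>r0\<close>.\<close>
    moreover have "m * r0 \<le> (\<Sum>h<2 * m. ?e h)"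
    proof -
      have "m * r0 \<le> card {h \<in> {..<2 * m}. good h g} * r0" using good_many[OF g] by (rule mult_right_mono) simp
      also have "\<dots> = (\<Sum>h\<in>{h \<in> {..<2 * m}. good h g}. r0)" by simp
      also have "\<dots> \<le> (\<Sum>h\<in>{h \<in> {..<2 * m}. good h g}. R h * jj h)" using r0 by (intro sum_mono) auto
      also have "\<dots> = (\<Sum>h<2 * m. ?e h)" by (rule sum.inter_filter) simp
      finally show ?thesis .
    qed
    ultimately show "dvq q (wt ?R) p (m * r0) (G g)" by (rule dvq_mono)
  qed
  show thesis
  proof (rule that[OF F0 _ _ szF _ dvF], safe)
    show "c < ?n" if "I \<in> keys F" "c \<in> keys I" for I c using keys_n that by blast
    show "lookup I c \<le> d (c div s)" if "I \<in> keys F" "c < ?n" for I c using bound[OF that(1), of c] that(2) by simp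
    show "\<bar>wt v I - ?ctr\<bar> \<le> \<kappa>" if "I \<in> keys F" for I using that by (rule weights)
  qed
qed

subsection \<open>Units of the golden field\<close>

text \<open>Integer powers of the unit \<phi>; the second branch uses that its inverse is \<phi> -
  1.\<close>

definition upow :: "int \<Rightarrow> zphi" where
  "upow n = (if 0 \<le> n then ZP 0 1 ^ nat n else ZP (- 1) 1 ^ nat (- n))"

lemma gphi_minus_1: "gphi - 1 = inverse gphi"
  using gphi_sq gphi_pos by (simp add: field_simps)

lemma emb_upow: "emb1 (upow n) = gphi powr of_int n" "\<bar>emb2 (upow n)\<bar> = gphi powr - of_int n"
proof -
  have g: "gphi ^ k = gphi powr of_nat k" "inverse gphi ^ k = gphi powr - of_nat k" for k
    by (simp_all add: powr_realpow powr_minus power_inverse)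
  have e: "emb1 (ZP 0 1) = gphi" "emb1 (ZP (- 1) 1) = inverse gphi"
    "\<bar>emb2 (ZP 0 1)\<bar> = inverse gphi" "\<bar>emb2 (ZP (- 1) 1)\<bar> = gphi"
    using gphi_minus_1 gphi_pos positive_imp_inverse_positive[OF gphi_pos]
    by (simp_all only: emb1_def emb2_def gpsi_eq zphi.sel)
  show "emb1 (upow n) = gphi powr of_int n" by (auto simp: upow_def e g)
  show "\<bar>emb2 (upow n)\<bar> = gphi powr - of_int n" by (auto simp: upow_def e g power_abs)
qed

text \<open>Lets identities between units be checked as identities between real powers.\<close>

lemma emb1_inj: "emb1 x = emb1 y \<Longrightarrow> x = y"
proof (rule ccontr)
  assume "emb1 x = emb1 y" "x \<noteq> y"
  moreover have "emb1 ((x - y) + y) = emb1 (x - y) + emb1 y" by (simp only: emb_add)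
  ultimately have "emb1 (x - y) = 0" by simp
  then show False using emb1_lower[of "x - y"] \<open>x \<noteq> y\<close> by simp
qed

lemma upow_add: "upow (a + b) = upow a * upow b"
  by (rule emb1_inj) (simp add: emb_upow powr_add)

lemma upow_0 [simp]: "upow 0 = 1"
  by (simp add: upow_def)

lemma emb_pw_upow:
  assumes I: "keys I \<subseteq> S" and p: "\<And>c. c \<in> S \<Longrightarrow> p c = upow (v c)"
  shows "emb1 (pw p I) = gphi powr wt (\<lambda>c. of_int (v c)) I"
    "\<bar>emb2 (pw p I)\<bar> = gphi powr - wt (\<lambda>c. of_int (v c)) I"
proof -
  have pc: "p c = upow (v c)" if "c \<in> keys I" for c using that I p by blast
  have "emb1 (pw p I) = (\<Prod>c\<in>keys I. (gphi powr of_int (v c)) ^ lookup I c)"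
    by (simp add: pw_def emb_prod pc emb_upow)
  also have "\<dots> = gphi powr wt (\<lambda>c. of_int (v c)) I"
    by (simp add: wt_def powr_sum powr_power mult.commute)
  finally show "emb1 (pw p I) = gphi powr wt (\<lambda>c. of_int (v c)) I" .
  have "\<bar>emb2 (pw p I)\<bar> = (\<Prod>c\<in>keys I. (gphi powr - of_int (v c)) ^ lookup I c)"
    by (simp add: pw_def emb_prod pc emb_upow abs_prod power_abs)
  also have "\<dots> = gphi powr - wt (\<lambda>c. of_int (v c)) I"
    by (simp add: wt_def powr_sum powr_power mult.commute sum_negf[symmetric])
  finally show "\<bar>emb2 (pw p I)\<bar> = gphi powr - wt (\<lambda>c. of_int (v c)) I" .
qed

text \<open>The centre \<open>ctr\<close> enters the two embeddings with opposite signs and cancels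
  in the norm; only the spread \<open>\<kappa>\<close> remains.\<close>

lemma norm_ev_le:
  fixes F :: "zphi mpoly"
  assumes S: "finite S" and p: "\<And>c. c \<in> S \<Longrightarrow> p c = upow (v c)"
    and F: "\<And>I. I \<in> keys F \<Longrightarrow> keys I \<subseteq> S" "\<And>I c. I \<in> keys F \<Longrightarrow> real (lookup I c) \<le> d"
    and wt: "\<And>I. I \<in> keys F \<Longrightarrow> \<bar>wt (\<lambda>c. of_int (v c)) I - ctr\<bar> \<le> \<kappa>"
  shows "\<bar>emb1 (ev p b F)\<bar> * \<bar>emb2 (ev p b F)\<bar> \<le> (sz F * exp (real (card S) * d))\<^sup>2 * gphi powr (2 * \<kappa>)"
proof -
  let ?e = "exp (real (card S) * d)"
  have bin: "real (bin I b) \<le> ?e" if "I \<in> keys F" for I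
    using S F that by (intro bin_le_exp) auto
  have summand: "\<bar>x\<bar> * (\<bar>y\<bar> * real (bin I b)) \<le> nrm (lookup F I) * (gphi powr g * ?e)"
    if "I \<in> keys F" "\<bar>x\<bar> \<le> nrm (lookup F I)" "\<bar>y\<bar> \<le> gphi powr g" for I x y g
    using that bin by (intro mult_mono) auto
  have 1: "\<bar>emb1 (ev p b F)\<bar> \<le> sz F * (gphi powr (ctr + \<kappa>) * ?e)"
  proof -
    have "\<bar>emb1 (ev p b F)\<bar> \<le> (\<Sum>I\<in>keys F. \<bar>emb1 (lookup F I)\<bar> * (\<bar>emb1 (pw p I)\<bar> * real (bin I b)))"
      unfolding ev_def emb_sum by (rule order_trans[OF sum_abs]) (simp add: abs_mult)
    also have "\<dots> \<le> (\<Sum>I\<in>keys F. nrm (lookup F I) * (gphi powr (ctr + \<kappa>) * ?e))"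
    proof (intro sum_mono summand emb_le_nrm)
      fix I assume I: "I \<in> keys F"
      have "gphi powr wt (\<lambda>c. of_int (v c)) I \<le> gphi powr (ctr + \<kappa>)"
        using wt[OF I] gphi_bounds by (intro powr_mono) auto
      then show "\<bar>emb1 (pw p I)\<bar> \<le> gphi powr (ctr + \<kappa>)"
        by (simp add: emb_pw_upow(1)[OF F(1)[OF I] p])
    qed
    finally show ?thesis by (simp add: sz_def sum_distrib_right)
  qed
  have 2: "\<bar>emb2 (ev p b F)\<bar> \<le> sz F * (gphi powr (\<kappa> - ctr) * ?e)"
  proof -
    have "\<bar>emb2 (ev p b F)\<bar> \<le> (\<Sum>I\<in>keys F. \<bar>emb2 (lookup F I)\<bar> * (\<bar>emb2 (pw p I)\<bar> * real (bin I b)))"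
      unfolding ev_def emb_sum by (rule order_trans[OF sum_abs]) (simp add: abs_mult)
    also have "\<dots> \<le> (\<Sum>I\<in>keys F. nrm (lookup F I) * (gphi powr (\<kappa> - ctr) * ?e))"
    proof (intro sum_mono summand emb_le_nrm)
      fix I assume I: "I \<in> keys F"
      have "gphi powr - wt (\<lambda>c. of_int (v c)) I \<le> gphi powr (\<kappa> - ctr)"
        using wt[OF I] gphi_bounds by (intro powr_mono) auto
      then show "\<bar>emb2 (pw p I)\<bar> \<le> gphi powr (\<kappa> - ctr)"
        by (simp add: emb_pw_upow(2)[OF F(1)[OF I] p])
    qed
    finally show ?thesis by (simp add: sz_def sum_distrib_right)
  qed
  have "\<bar>emb1 (ev p b F)\<bar> * \<bar>emb2 (ev p b F)\<bar>
      \<le> (sz F * (gphi powr (ctr + \<kappa>) * ?e)) * (sz F * (gphi powr (\<kappa> - ctr) * ?e))"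
    using 1 2 by (intro mult_mono) auto
  also have "\<dots> = (sz F * ?e)\<^sup>2 * (gphi powr (ctr + \<kappa>) * gphi powr (\<kappa> - ctr))"
    by (simp add: power2_eq_square mult_ac)
  also have "gphi powr (ctr + \<kappa>) * gphi powr (\<kappa> - ctr) = gphi powr (2 * \<kappa>)"
    by (simp add: powr_add[symmetric])
  finally show ?thesis .
qed

text \<open>The rational integer \<open>q\<close> has norm q^2, and the cofactor has norm at least 1
  in absolute value.\<close>

lemma norm_ge_of_dvd:
  assumes "z \<noteq> 0" "of_nat q ^ M dvd z"
  shows "real q ^ (2 * M) \<le> \<bar>emb1 z\<bar> * \<bar>emb2 z\<bar>"
proof -
  obtain y where y: "z = of_nat q ^ M * y" using assms(2) by (elim dvdE)
  have "y \<noteq> 0" using assms(1) y by auto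
  then have "1 \<le> \<bar>emb1 y\<bar> * \<bar>emb2 y\<bar>" using emb_norm_ge_1[of y] by (simp add: abs_mult)
  have pw: "real q ^ (2 * M) = real q ^ M * real q ^ M" by (simp add: mult_2 power_add)
  have "real q ^ (2 * M) * 1 \<le> real q ^ (2 * M) * (\<bar>emb1 y\<bar> * \<bar>emb2 y\<bar>)"
    using \<open>1 \<le> _\<close> by (intro mult_left_mono) auto
  also have "\<dots> = \<bar>emb1 z\<bar> * \<bar>emb2 z\<bar>"
    unfolding pw by (simp add: y abs_mult mult_ac)
  finally show ?thesis by simp
qed

text \<open>Combines the estimate for one block with the elimination of blocks. Block
  \<open>h\<close> has degree E / n h, so its contribution to sizes is of order E, independently of
  \<open>h\<close>. It matters that \<open>K\<close>, \<open>H\<close> and \<open>N0\<close> are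
  fixed before the solutions \<open>n\<close>, \<open>v\<close> and the polynomial are
  chosen.\<close>

lemma blocks_zero_estimate:
  fixes \<omega> :: "nat \<Rightarrow> real"
  assumes indep: "\<And>J :: nat \<Rightarrow> int. (\<Sum>j<s. \<omega> j * of_int (J j)) = 0 \<Longrightarrow> \<forall>j<s. J j = 0"
    and s: "1 \<le> s" and r: "1 \<le> r" and \<theta>: "0 < \<theta>" "\<theta> \<le> 1"
  obtains K H N0 :: real where "1 \<le> K" "0 < H" "H \<le> 1" "1 \<le> N0"
    "\<forall>n v E p F. (\<forall>h<r. N0 \<le> n h) \<longrightarrow> (\<forall>g<r. \<forall>h<g. K * n h \<le> n g) \<longrightarrow> (\<forall>h<r. n h \<le> E) \<longrightarrow>
      (\<forall>h<r. \<forall>j<s. \<bar>of_int (v (h * s + j)) - n h * \<omega> j\<bar> \<le> 1) \<longrightarrow> (\<forall>c<r * s. p c = upow (v c)) \<longrightarrow>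
      F \<noteq> 0 \<longrightarrow> (\<forall>I\<in>keys F. keys I \<subseteq> {..<r * s} \<and> (\<forall>c<r * s. real (lookup I c) \<le> E / n (c div s))) \<longrightarrow>
      sz F \<le> exp (H * E) \<longrightarrow>
      (\<exists>b. wt (\<lambda>c. 1 / (if c < r * s then E / n (c div s) else 1)) b < \<theta> \<and> ev p b F \<noteq> 0)"
proof -
  define \<tau> where "\<tau> = shrink (r * s) \<theta>"
  have \<tau>: "0 < \<tau>" "\<tau> \<le> 1" using shrink_bounds[OF \<theta>, of "r * s"] \<theta> by (auto simp: \<tau>_def)
  \<comment> \<open>The estimate for one block loses a factor 2 s + 1 in the index.\<close>
  define \<tau>1 where "\<tau>1 = \<tau> / (2 * real s + 1)"
  have \<tau>1: "0 < \<tau>1" "\<tau>1 \<le> 1" "(2 * real s + 1) * \<tau>1 = \<tau>"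
    using \<tau> s by (auto simp: \<tau>1_def field_simps)
  define \<eta> where "\<eta> = \<tau>1 / (3 * real s)"
  have \<eta>: "0 < \<eta>" "real s * \<eta> = \<tau>1 / 3" using \<tau>1 s by (auto simp: \<eta>_def field_simps)
  obtain a :: "nat \<Rightarrow> nat \<Rightarrow> int" and t :: "nat \<Rightarrow> int"
    where near: "\<And>i j. i < s \<Longrightarrow> j < s \<Longrightarrow> \<bar>of_int (a i j) - of_int (t i) * \<omega> j\<bar> \<le> \<eta>" and det: "dt s a \<noteq> 0"
    using integer_forms_near_line[OF indep \<eta>(1) order_refl] by blast
  have inj: "\<forall>j<s. J j = 0" if J: "\<And>i. i < s \<Longrightarrow> (\<Sum>j<s. a i j * J j) = 0" for J :: "nat \<Rightarrow> int"
  proof (rule ccontr)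
    assume "\<not> ?thesis"
    then have "dt s a = 0" unfolding dt_eq_0_iff using J by blast
    then show False using det by simp
  qed
  define B where "B = (\<Sum>i<s. \<bar>real_of_int (t i)\<bar>) + (\<Sum>i<s. \<Sum>j<s. \<bar>real_of_int (a i j)\<bar>)"
  have B0: "0 \<le> B" by (auto simp: B_def intro!: add_nonneg_nonneg sum_nonneg)
  have Bt: "\<bar>real_of_int (t i)\<bar> \<le> B" if "i < s" for i
  proof -
    have "\<bar>real_of_int (t i)\<bar> \<le> (\<Sum>i<s. \<bar>real_of_int (t i)\<bar>)"
      by (rule member_le_sum[of i "{..<s}" "\<lambda>i. \<bar>real_of_int (t i)\<bar>"]) (use that in auto)
    moreover have "0 \<le> (\<Sum>i<s. \<Sum>j<s. \<bar>real_of_int (a i j)\<bar>)" by (intro sum_nonneg) auto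
    ultimately show ?thesis unfolding B_def by linarith
  qed
  have Ba: "\<bar>real_of_int (a i j)\<bar> \<le> B" if "i < s" "j < s" for i j
  proof -
    have "\<bar>real_of_int (a i j)\<bar> \<le> (\<Sum>j<s. \<bar>real_of_int (a i j)\<bar>)"
      by (rule member_le_sum[of j "{..<s}" "\<lambda>j. \<bar>real_of_int (a i j)\<bar>"]) (use that in auto)
    moreover have "\<dots> \<le> (\<Sum>i<s. \<Sum>j<s. \<bar>real_of_int (a i j)\<bar>)"
      by (rule member_le_sum[of i "{..<s}" "\<lambda>i. \<Sum>j<s. \<bar>real_of_int (a i j)\<bar>"])
        (use that in \<open>auto intro!: sum_nonneg\<close>)
    moreover have "0 \<le> (\<Sum>i<s. \<bar>real_of_int (t i)\<bar>)" by (intro sum_nonneg) auto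
    ultimately show ?thesis unfolding B_def by linarith
  qed
  have lng: "0 < ln gphi" "ln gphi \<le> 1"
    using gphi_bounds ln_le_minus_one[of gphi] by auto
  define G where "G = \<tau>1 / (3 * (B + 1)) * ln gphi"
  have G0: "0 < G" using \<tau>1 B0 lng by (simp add: G_def)
  have G1: "G \<le> 1"
  proof -
    have "\<tau>1 / (3 * (B + 1)) \<le> 1" using \<tau>1 B0 by (simp add: field_simps)
    then have "\<tau>1 / (3 * (B + 1)) * ln gphi \<le> 1 * 1" using lng by (intro mult_mono) auto
    then show ?thesis by (simp add: G_def)
  qed
  \<comment> \<open>A block estimate may be used with length parameter 2 H n, which takes half of
    the available G n; the other half absorbs the term with ln 4 once \<open>n\<close> is at least
    \<open>N0\<close>.\<close>
  define H where "H = G / 8"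
  have H: "0 < H" "H \<le> 1" using G0 G1 by (auto simp: H_def)
  define K where "K = 4 / \<tau>"
  have K: "1 \<le> K" "4 / K = \<tau>" using \<tau> by (auto simp: K_def field_simps)
  \<comment> \<open>One summand for each requirement below. The last one keeps the growth of lengths
    during the eliminations within H E, so that they stay below 2 H E.\<close>
  define N0 where "N0 = 1 + 3 * real s * (B + 1) / \<tau>1 + (real s * (real s * B + 1) * ln 4) * 2 / G
    + real (r * s) * (real (r * s) + 2) / H"
  have parts: "0 \<le> 3 * real s * (B + 1) / \<tau>1" "0 \<le> (real s * (real s * B + 1) * ln 4) * 2 / G"
    "0 \<le> real (r * s) * (real (r * s) + 2) / H"
    using \<tau>1 B0 G0 H by auto
  have N0: "1 \<le> N0" "3 * real s * (B + 1) \<le> \<tau>1 * N0" "real s * (real s * B + 1) * ln 4 < G / 2 * N0"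
    "real (r * s) * (real (r * s) + 2) \<le> H * N0"
  proof -
    show "1 \<le> N0" using parts by (simp add: N0_def)
    have "3 * real s * (B + 1) / \<tau>1 \<le> N0" using parts by (simp add: N0_def)
    then show "3 * real s * (B + 1) \<le> \<tau>1 * N0" using \<tau>1 by (simp add: field_simps)
    have "(real s * (real s * B + 1) * ln 4) * 2 / G < N0" using parts unfolding N0_def by linarith
    then show "real s * (real s * B + 1) * ln 4 < G / 2 * N0" using G0 by (simp add: field_simps)
    have "real (r * s) * (real (r * s) + 2) / H \<le> N0" using parts unfolding N0_def by linarith
    then show "real (r * s) * (real (r * s) + 2) \<le> H * N0" using H by (simp add: field_simps)
  qed
  show thesis
  proof (rule that[OF K(1) H N0(1)], intro allI impI)
    fix n :: "nat \<Rightarrow> real" and v :: "nat \<Rightarrow> int" and E :: real and p :: "nat \<Rightarrow> zphi" and F :: "zphi mpoly"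
    assume a: "\<forall>h<r. N0 \<le> n h" "\<forall>g<r. \<forall>h<g. K * n h \<le> n g" "\<forall>h<r. n h \<le> E"
      "\<forall>h<r. \<forall>j<s. \<bar>of_int (v (h * s + j)) - n h * \<omega> j\<bar> \<le> 1" "\<forall>c<r * s. p c = upow (v c)" "F \<noteq> 0"
      "\<forall>I\<in>keys F. keys I \<subseteq> {..<r * s} \<and> (\<forall>c<r * s. real (lookup I c) \<le> E / n (c div s))" "sz F \<le> exp (H * E)"
    note n = a(1)[rule_format] and gap = a(2)[rule_format] and E = a(3)[rule_format] and v = a(4)[rule_format]
      and p = a(5)[rule_format]
    have F: "F \<noteq> 0" "\<And>I. I \<in> keys F \<Longrightarrow> keys I \<subseteq> {..<r * s}"
        "\<And>I c. I \<in> keys F \<Longrightarrow> c < r * s \<Longrightarrow> real (lookup I c) \<le> E / n (c div s)" "sz F \<le> exp (H * E)"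
      using a by auto
    \<comment> \<open>The value 1 outside the finite set of variables only keeps all degrees at
      least 1.\<close>
    define Dv where "Dv c = (if c < r * s then E / n (c div s) else 1)" for c
    have n1: "1 \<le> n h" if "h < r" for h using n[OF that] N0(1) by linarith
    have E1: "N0 \<le> E" "0 < E" using n[of 0] E[of 0] r N0(1) by linarith+
    have div_less: "c div s < r" if "c < r * s" for c using that by (simp add: less_mult_imp_div_less)
    have Dv1: "1 \<le> Dv c" for c
    proof (cases "c < r * s")
      case True
      then show ?thesis using E[OF div_less[OF True]] n1[OF div_less[OF True]] by (simp add: Dv_def)
    qed (simp add: Dv_def)
    have DvM: "Dv c \<le> E / N0" for c
    proof (cases "c < r * s")
      case True
      then have "E / n (c div s) \<le> E / N0"
        using n[OF div_less[OF True]] N0(1) E1 by (intro divide_left_mono mult_pos_pos) auto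
      then show ?thesis using True by (simp add: Dv_def)
    next
      case False
      then show ?thesis using E1 N0(1) by (simp add: Dv_def)
    qed
    have "\<not> van p (\<lambda>c. 1 / Dv c) (\<theta> * 1) F"
    proof (rule zero_estimate[where X = "{..<r * s}" and S = "{..<r * s}" and n = "r * s" and blk = "\<lambda>c. c div s"
          and K = K and Dm = "E / N0" and h = "H * E" and H = "2 * H * E" and \<tau> = \<tau>])
      fix b :: nat and F :: "zphi mpoly" and L :: real
      assume F: "F \<noteq> 0" and L: "1 \<le> L" and keysF: "\<And>I. I \<in> keys F \<Longrightarrow> keys I \<subseteq> {c \<in> {..<r * s}. c div s = b}"
        and dgF: "dg (\<lambda>c. L * Dv c) F" and szF: "sz F \<le> exp (L * (2 * H * E))"
      \<comment> \<open>A block number out of range contains no variables, so any real block, here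
        block 0, serves for it.\<close>
      define h where "h = (if b < r then b else 0)"
      have h: "h < r" using r by (simp add: h_def)
      have blk: "c \<in> {h * s..<h * s + s}" "c < r * s" "c div s = h" if "I \<in> keys F" "c \<in> keys I" for I c
      proof -
        have c: "c < r * s" "c div s = b" using keysF[OF that(1)] that(2) by auto
        then show "c < r * s" "c div s = h" using div_less[OF c(1)] by (auto simp: h_def)
        have "c div s * s + c mod s = c" "c mod s < s" using s by auto
        then have "c div s * s \<le> c" "c < c div s * s + s" by linarith+
        then show "c \<in> {h * s..<h * s + s}" using \<open>c div s = h\<close> by simp
      qed
      have inblk: "h * s + j < r * s" "(h * s + j) div s = h" if "j < s" for j
      proof -
        have "h * s + j < Suc h * s" using that by simp
        also have "\<dots> \<le> r * s" using h by (intro mult_right_mono) auto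
        finally show "h * s + j < r * s" .
        show "(h * s + j) div s = h" using that by simp
      qed
      show "\<not> van p (\<lambda>c. 1 / Dv c) (\<tau> * L) F"
      proof (rule one_block_estimate[where a = a and t = "\<lambda>i. of_int (t i)" and \<omega> = \<omega> and \<eta> = \<eta> and B = B
            and \<tau> = \<tau>1 and n = "n h" and D = "E / n h" and H = "2 * H * n h" and ?c0.0 = "h * s"
            and v = "\<lambda>j. of_int (v (h * s + j))" and s = s])
        show "3 * real s * (B + 1) \<le> \<tau>1 * n h"
          using N0(2) mult_left_mono[OF n[OF h], of \<tau>1] \<tau>1 by linarith
        have "real s * (real s * B + 1) * ln 4 < G / 2 * n h"
          using N0(3) mult_left_mono[OF n[OF h], of "G / 2"] G0 by linarith
        moreover have "2 * (2 * H * n h) = G / 2 * n h" by (simp add: H_def)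
        moreover have "\<tau>1 / (3 * (B + 1)) * n h * ln gphi = G * n h" by (simp add: G_def)
        ultimately show "real s * (real s * B + 1) * ln 4 + 2 * (2 * H * n h) < \<tau>1 / (3 * (B + 1)) * n h * ln gphi"
          by linarith
        show "emb1 (p (h * s + j)) = gphi powr of_int (v (h * s + j))" if "j < s" for j
          using inblk[OF that] by (simp add: p emb_upow)
        show "1 \<le> E / n h" using E[OF h] n1[OF h] by simp
        show "0 \<le> 1 / Dv c" for c using Dv1[of c] by simp
        show "1 / Dv (h * s + j) = 1 / (E / n h)" if "j < s" for j
          using inblk[OF that] by (simp add: Dv_def)
        show "keys I \<subseteq> {h * s..<h * s + s}" if "I \<in> keys F" for I using blk(1)[OF that] by blast
        show "real (lookup I c) \<le> L * (E / n h)" if "I \<in> keys F" for I c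
        proof (cases "c \<in> keys I")
          case True
          have "real (lookup I c) \<le> L * Dv c" using dgF that by (auto simp: dg_def)
          then show ?thesis using blk(2,3)[OF that True] by (simp add: Dv_def)
        next
          case False
          then show ?thesis using L E1 n1[OF h] by (simp add: in_keys_iff)
        qed
        show "sz F \<le> exp (L * (E / n h) * (2 * H * n h))"
          using szF n1[OF h] by (simp add: mult_ac)
        show "0 < n h" using n1[OF h] by simp
      qed (use near inj Bt Ba B0 \<tau>1 \<eta> v[OF h] L F in auto)
    next
      fix c d assume cd: "c \<in> {..<r * s}" "d \<in> {..<r * s}" "c div s < d div s"
      have "K * n (c div s) \<le> n (d div s)" using cd div_less by (intro gap) auto
      then have "K * E * n (c div s) \<le> E * n (d div s)" using E1 mult_left_mono[of "K * n (c div s)" "n (d div s)" E]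
        by (simp add: mult_ac)
      moreover have "0 < n (c div s)" "0 < n (d div s)"
        using n1[OF div_less, of c] n1[OF div_less, of d] cd by auto
      ultimately show "K * Dv d \<le> Dv c" using cd by (simp add: Dv_def field_simps)
    next
      show "dg (\<lambda>c. 1 * Dv c) F" unfolding dg_def
      proof (intro ballI allI)
        fix I c assume I: "I \<in> keys F"
        show "real (lookup I c) \<le> 1 * Dv c"
        proof (cases "c < r * s")
          case False
          then have "lookup I c = 0" using F(2)[OF I] by (auto simp: in_keys_iff)
          then show ?thesis using Dv1[of c] by simp
        qed (use F(3)[OF I] in \<open>simp add: Dv_def\<close>)
      qed
      have "real (r * s) * (real (r * s) + 2) * (E / N0) \<le> (H * N0) * (E / N0)"
        using N0 E1 by (intro mult_right_mono) auto
      also have "\<dots> = H * E" using N0(1) by simp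
      finally show "H * E + real (r * s) * (real (card {..<r * s}) + 2) * (E / N0) \<le> 2 * H * E"
        unfolding card_lessThan by linarith
    qed (use Dv1 DvM K F \<theta> \<tau>_def in auto)
    then show "\<exists>b. wt (\<lambda>c. 1 / (if c < r * s then E / n (c div s) else 1)) b < \<theta> \<and> ev p b F \<noteq> 0"
      unfolding van_def Dv_def by simp
  qed
qed

subsection \<open>Values divisible by a high prime power\<close>

text \<open>Solutions are taken from \<open>avail\<close> with rapidly growing \<open>n\<close>, one
  per block. The zero estimate gives a nonzero derivative of the auxiliary polynomial with norm at
  most exp (4 E + 2 \<kappa>), where \<kappa> grows like the square root of the number of blocks,
  yet divisible by a power of \<open>q\<close> whose exponent grows linearly with it.\<close>

lemma no_highly_divisible_forms:
  fixes \<omega> :: "nat \<Rightarrow> real"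
  assumes indep: "\<And>J :: nat \<Rightarrow> int. (\<Sum>j<s. \<omega> j * of_int (J j)) = 0 \<Longrightarrow> \<forall>j<s. J j = 0"
    and s: "1 \<le> s" and Am: "1 \<le> Am" and q: "2 \<le> q" and \<epsilon>: "0 < \<epsilon>" and C: "0 < C"
    and avail: "\<And>\<delta> n0. 0 < \<delta> \<Longrightarrow> \<exists>n v R. n0 \<le> n \<and> (\<forall>j<s. \<bar>of_int (v j) - real n * \<omega> j\<bar> \<le> 1) \<and>
      \<epsilon> * real n \<le> real R \<and> real R \<le> C * real n \<and>
      (\<forall>h. \<exists>P. P \<noteq> 0 \<and> (\<forall>I\<in>keys P. keys I \<subseteq> {h * s..<h * s + s} \<and> (\<forall>c. lookup I c \<le> Am)) \<and>
        sz P \<le> exp (\<delta> * real n) \<and>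
        (\<forall>p. (\<forall>j<s. p (h * s + j) = upow (v j)) \<longrightarrow> of_nat q ^ R dvd ev p 0 P))"
  shows False
proof -
  \<comment> \<open>The ratio of the power \<open>jj h\<close> of a polynomial to the degree
    \<open>d h\<close> of its block, up to rounding.\<close>
  define \<tau> where "\<tau> = 1 / (32 * real s * real Am)"
  have sA: "1 \<le> real s * real Am" using s Am mult_mono[of 1 "real s" 1 "real Am"] by simp
  have \<tau>: "0 < \<tau>" "\<tau> \<le> 1" using sA by (auto simp: \<tau>_def mult.assoc)
  define \<Omega> where "\<Omega> = (\<Sum>j<s. \<bar>\<omega> j\<bar>)"
  have \<Omega>0: "0 \<le> \<Omega>" by (simp add: \<Omega>_def sum_nonneg)
  have \<Omega>: "\<bar>\<omega> j\<bar> \<le> \<Omega>" if "j < s" for j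
    unfolding \<Omega>_def by (rule member_le_sum[of j "{..<s}" "\<lambda>j. \<bar>\<omega> j\<bar>"]) (use that in auto)
  define \<kappa>0 where "\<kappa>0 = 8 * real s * (\<Omega> + 1)"
  have \<kappa>0: "0 < \<kappa>0" using s \<Omega>0 by (simp add: \<kappa>0_def)
  \<comment> \<open>Makes \<mu>^2 \<epsilon> \<tau> exceed 32 + 32 \<kappa>0 \<mu>, the inequality
    contradicted at the end.\<close>
  obtain \<mu> :: nat where \<mu>: "(4 + 4 * \<kappa>0) * 8 / (\<epsilon> * \<tau>) < real \<mu>" using reals_Archimedean2 by blast
  have "0 < (4 + 4 * \<kappa>0) * 8 / (\<epsilon> * \<tau>)" using \<kappa>0 \<epsilon> \<tau> by simp
  then have \<mu>1: "1 \<le> \<mu>" using \<mu> by linarith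
  \<comment> \<open>Chosen so that the square root of 2 m, which governs the deviation, is the
    integer 2 \<mu>.\<close>
  define m where "m = 2 * \<mu>\<^sup>2"
  have m1: "1 \<le> m" using \<mu>1 by (simp add: m_def)
  define r where "r = 2 * m"
  have r1: "1 \<le> r" using m1 by (simp add: r_def)
  \<comment> \<open>A derivative of index below \<theta> loses at most C \<theta> E factors
    \<open>q\<close>, that is \<epsilon> \<tau> E / 16, half of the lower bound for
    \<open>r0\<close>.\<close>
  define \<theta> where "\<theta> = min 1 (\<epsilon> * \<tau> / (16 * C))"
  have \<theta>: "0 < \<theta>" "\<theta> \<le> 1" "C * \<theta> \<le> \<epsilon> * \<tau> / 16"
  proof -
    show "0 < \<theta>" "\<theta> \<le> 1" using \<epsilon> \<tau> C by (auto simp: \<theta>_def)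
    have "C * \<theta> \<le> C * (\<epsilon> * \<tau> / (16 * C))" using C by (intro mult_left_mono) (auto simp: \<theta>_def)
    then show "C * \<theta> \<le> \<epsilon> * \<tau> / 16" using C by simp
  qed
  obtain K H N0 :: real where K: "1 \<le> K" and H: "0 < H" "H \<le> 1" and N0: "1 \<le> N0" and
    zest: "\<forall>n v E p F. (\<forall>h<r. N0 \<le> n h) \<longrightarrow> (\<forall>g<r. \<forall>h<g. K * n h \<le> n g) \<longrightarrow> (\<forall>h<r. n h \<le> E) \<longrightarrow>
      (\<forall>h<r. \<forall>j<s. \<bar>of_int (v (h * s + j)) - n h * \<omega> j\<bar> \<le> 1) \<longrightarrow> (\<forall>c<r * s. p c = upow (v c)) \<longrightarrow>
      F \<noteq> 0 \<longrightarrow> (\<forall>I\<in>keys F. keys I \<subseteq> {..<r * s} \<and> (\<forall>c<r * s. real (lookup I c) \<le> E / n (c div s))) \<longrightarrow>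
      sz F \<le> exp (H * E) \<longrightarrow>
      (\<exists>b. wt (\<lambda>c. 1 / (if c < r * s then E / n (c div s) else 1)) b < \<theta> \<and> ev p b F \<noteq> 0)"
    by (rule blocks_zero_estimate[OF indep s r1 \<theta>(1,2)])
  define N1 where "N1 = nat \<lceil>N0 + 2 * (3 + 2 * real (r * s)) / H\<rceil>"
  have N1: "N0 \<le> real N1" "3 + 2 * real (r * s) \<le> H / 2 * real N1"
  proof -
    have le: "N0 + 2 * (3 + 2 * real (r * s)) / H \<le> real N1" unfolding N1_def by (rule real_nat_ceiling_ge)
    have "0 \<le> 2 * (3 + 2 * real (r * s)) / H" using H by simp
    then show "N0 \<le> real N1" using le by linarith
    have "2 * (3 + 2 * real (r * s)) / H \<le> real N1" using le N0 by linarith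
    then show "3 + 2 * real (r * s) \<le> H / 2 * real N1" using H by (simp add: field_simps)
  qed
  have N1r: "real (r * s) \<le> real N1"
  proof -
    have "H / 2 * real N1 \<le> 1 * real N1" using H by (intro mult_right_mono) auto
    then show ?thesis using N1(2) by linarith
  qed
  \<comment> \<open>The powers of the polynomials \<open>P h\<close> enter the length of
    \<open>F\<close> by at most exp (4 m \<delta> E), which is exp (H E / 2).\<close>
  define \<delta> where "\<delta> = H / (8 * real m)"
  have \<delta>0: "0 < \<delta>" using H m1 by (simp add: \<delta>_def)
  define W where "W n v R h P \<longleftrightarrow> P \<noteq> 0 \<and> (\<forall>I\<in>keys P. keys I \<subseteq> {h * s..<h * s + s} \<and> (\<forall>c. lookup I c \<le> Am)) \<and>
        sz P \<le> exp (\<delta> * real n) \<and>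
        (\<forall>p. (\<forall>j<s. p (h * s + j) = upow (v j)) \<longrightarrow> of_nat q ^ R dvd ev p 0 P)"
    for n :: nat and v :: "nat \<Rightarrow> int" and R h :: nat and P :: "zphi mpoly"
  have "\<forall>n0. \<exists>n v R. n0 \<le> n \<and> (\<forall>j<s. \<bar>of_int (v j) - real n * \<omega> j\<bar> \<le> 1) \<and>
      \<epsilon> * real n \<le> real R \<and> real R \<le> C * real n \<and> (\<forall>h. \<exists>P. W n v R h P)"
    using avail[OF \<delta>0] unfolding W_def by blast
  then obtain nn V RR where nn: "\<And>n0. n0 \<le> nn n0" and V: "\<And>n0 j. j < s \<Longrightarrow> \<bar>of_int (V n0 j) - real (nn n0) * \<omega> j\<bar> \<le> 1"
    and RR: "\<And>n0. \<epsilon> * real (nn n0) \<le> real (RR n0)" "\<And>n0. real (RR n0) \<le> C * real (nn n0)"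
    and ex: "\<And>n0 h. \<exists>P. W (nn n0) (V n0) (RR n0) h P" by metis
  define PP where "PP n0 h = (SOME P. W (nn n0) (V n0) (RR n0) h P)" for n0 h
  have PP: "W (nn n0) (V n0) (RR n0) h (PP n0 h)" for n0 h
    unfolding PP_def using ex by (rule someI_ex)
  \<comment> \<open>Thresholds for the successive solutions: each is requested beyond
    \<open>K\<close> times the previous \<open>n\<close>.\<close>
  define x where "x h = ((\<lambda>y. nat \<lceil>K * real (nn y)\<rceil>) ^^ h) N1" for h
  define n where "n h = real (nn (x h))" for h
  have nx: "real (x h) \<le> n h" for h unfolding n_def using nn by simp
  have xS: "K * n h \<le> real (x (Suc h))" for h
    unfolding n_def by (simp add: x_def real_nat_ceiling_ge)
  have x0: "x 0 = N1" by (simp add: x_def)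
  have n0: "0 \<le> n h" for h by (simp add: n_def)
  have Kn: "n h \<le> K * n h" for h using mult_right_mono[OF K n0[of h]] by simp
  have n_mono: "n h \<le> n (Suc h)" for h using Kn[of h] xS[of h] nx[of "Suc h"] by linarith
  have n_le: "n h \<le> n g" if "h \<le> g" for h g using n_mono that by (rule lift_Suc_mono_le)
  have gap: "K * n h \<le> n g" if "h < g" for h g
  proof -
    have "n (Suc h) \<le> n g" using that by (intro n_le) simp
    then show ?thesis using xS[of h] nx[of "Suc h"] by linarith
  qed
  have nN1: "real N1 \<le> n h" for h using n_le[of 0 h] nx[of 0] x0 by simp
  have npos: "0 < n h" for h using nN1[of h] N1 N0 by linarith
  \<comment> \<open>Large enough that rounding to integers costs at most a factor 2 in the degrees
    \<open>d h\<close>, the powers \<open>jj h\<close> and the exponent \<open>r0\<close>.\<close>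
  define E where "E = (\<Sum>h<r. 4 * n h / \<tau>) + 8 / (\<epsilon> * \<tau>)"
  have E4: "4 * n h \<le> \<tau> * E" if "h < r" for h
  proof -
    have "4 * n h / \<tau> \<le> (\<Sum>h<r. 4 * n h / \<tau>)"
      by (rule member_le_sum[of h "{..<r}" "\<lambda>h. 4 * n h / \<tau>"]) (use that \<tau> n0 in auto)
    moreover have "0 \<le> 8 / (\<epsilon> * \<tau>)" using \<epsilon> \<tau> by simp
    ultimately have "4 * n h / \<tau> \<le> E" unfolding E_def by linarith
    then show ?thesis using \<tau> by (simp add: field_simps)
  qed
  have E8: "8 \<le> \<epsilon> * \<tau> * E"
  proof -
    have "0 \<le> (\<Sum>h<r. 4 * n h / \<tau>)" using \<tau> n0 by (intro sum_nonneg) auto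
    then have "8 / (\<epsilon> * \<tau>) \<le> E" unfolding E_def by linarith
    then show ?thesis using \<epsilon> \<tau> by (simp add: field_simps)
  qed
  have E0: "0 < E"
  proof (rule ccontr)
    assume "\<not> 0 < E"
    then have "\<epsilon> * \<tau> * E \<le> 0" using \<epsilon> \<tau> by (intro mult_nonneg_nonpos) auto
    then show False using E8 by linarith
  qed
  have \<tau>E: "\<tau> * E \<le> E" using mult_right_mono[OF \<tau>(2), of E] E0 by simp
  have nE: "4 * n h \<le> E" if "h < r" for h using E4[OF that] \<tau>E by linarith
  have N1E: "real N1 \<le> E" using nN1[of 0] nE[of 0] n0[of 0] r1 by linarith
  have ENn: "E / n h \<le> E / real N1" for h
    using nN1 E0 npos N1 N0 by (intro divide_left_mono mult_pos_pos) auto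
  define d where "d h = nat \<lfloor>E / n h\<rfloor>" for h
  define jj where "jj h = d h div (32 * s * Am)" for h
  define r0 where "r0 = nat \<lfloor>\<epsilon> * \<tau> * E / 4\<rfloor>"
  have d_le: "real (d h) \<le> E / n h" for h
    using E0 npos[of h] unfolding d_def by (simp add: less_imp_le)
  have d_nE: "real (d h) * n h \<le> E" for h using d_le[of h] npos[of h] by (simp add: field_simps)
  have d_ge: "E / (2 * n h) \<le> real (d h)" if "h < r" for h
  proof -
    have "E / n h - 1 \<le> real (d h)" unfolding d_def by linarith
    moreover have "2 \<le> E / n h" using nE[OF that] npos[of h] by (simp add: field_simps)
    ultimately show ?thesis by simp
  qed
  have jj_d: "32 * s * Am * jj h \<le> d h" for h by (simp add: jj_def)
  have jj_le: "real (jj h) * n h \<le> E" for h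
  proof -
    have "real (jj h) \<le> real (d h)" by (simp add: jj_def)
    then have "real (jj h) * n h \<le> real (d h) * n h" using n0 by (intro mult_right_mono) auto
    then show ?thesis using d_nE[of h] by linarith
  qed
  have jj_ge: "\<tau> * E \<le> 4 * n h * real (jj h)" if "h < r" for h
  proof -
    have "d h < (jj h + 1) * (32 * s * Am)"
      unfolding jj_def using s Am dividend_less_div_times[of "32 * s * Am" "d h"] by (simp add: algebra_simps)
    then have "real (d h) < real ((jj h + 1) * (32 * s * Am))" by (simp only: of_nat_less_iff)
    then have "\<tau> * real (d h) \<le> real (jj h) + 1" using s Am by (simp add: \<tau>_def divide_le_eq algebra_simps)
    moreover have "\<tau> * (E / (2 * n h)) \<le> \<tau> * real (d h)" using d_ge[OF that] \<tau> by (intro mult_left_mono) auto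
    ultimately have "\<tau> * (E / (2 * n h)) \<le> real (jj h) + 1" by linarith
    then have "\<tau> * E \<le> 2 * n h * (real (jj h) + 1)" using npos[of h] by (simp add: field_simps)
    then show ?thesis using E4[OF that] by (simp add: algebra_simps)
  qed
  have r0_le: "r0 \<le> RR (x h) * jj h" if "h < r" for h
  proof -
    have "real r0 \<le> \<epsilon> * (\<tau> * E) / 4"
      using of_nat_floor[of "\<epsilon> * \<tau> * E / 4"] E8 by (simp add: r0_def mult.assoc)
    also have "\<dots> \<le> \<epsilon> * (4 * n h * real (jj h)) / 4"
      using jj_ge[OF that] \<epsilon> by (intro divide_right_mono mult_left_mono) auto
    also have "\<dots> = (\<epsilon> * n h) * real (jj h)" by simp
    also have "\<dots> \<le> real (RR (x h)) * real (jj h)" using RR(1)[of "x h"] by (intro mult_right_mono) (auto simp: n_def)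
    finally show ?thesis by (metis of_nat_le_iff of_nat_mult)
  qed
  have r0_ge: "\<epsilon> * \<tau> * E / 8 \<le> real r0"
    using E8 unfolding r0_def by linarith
  define vv where "vv c = V (x (c div s)) (c mod s)" for c
  define p where "p c = upow (vv c)" for c
  have pW: "\<forall>j<s. p (h * s + j) = upow (V (x h) j)" for h by (simp add: p_def vv_def)
  \<comment> \<open>A coordinate deviates by at most \<beta>, and \<kappa> is a multiple of sqrt (2
    m) * \<beta> large enough for Chebyshev's inequality.\<close>
  define \<kappa> where "\<kappa> = \<kappa>0 * (2 * real \<mu>) * E"
  define \<beta> where "\<beta> = (\<Omega> + 1) * E"
  have \<kappa>: "0 < \<kappa>" "8 * real (2 * m * s) * \<beta>\<^sup>2 \<le> \<kappa>\<^sup>2"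
  proof -
    show "0 < \<kappa>" using \<kappa>0 \<mu>1 E0 by (simp add: \<kappa>_def)
    have "\<kappa>\<^sup>2 = 8 * real s * (8 * real (2 * m * s) * \<beta>\<^sup>2)"
      by (simp add: \<kappa>_def \<kappa>0_def \<beta>_def m_def power2_eq_square algebra_simps)
    moreover have "1 * (8 * real (2 * m * s) * \<beta>\<^sup>2) \<le> 8 * real s * (8 * real (2 * m * s) * \<beta>\<^sup>2)"
      using s by (intro mult_right_mono) auto
    ultimately show "8 * real (2 * m * s) * \<beta>\<^sup>2 \<le> \<kappa>\<^sup>2" by simp
  qed
  have v\<beta>: "\<bar>of_int (vv c)\<bar> * real (d (c div s)) \<le> \<beta>" for c
  proof -
    let ?h = "c div s" and ?j = "c mod s"
    have j: "?j < s" using s by simp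
    have "\<bar>n ?h * \<omega> ?j\<bar> \<le> n ?h * \<Omega>" unfolding abs_mult using \<Omega>[OF j] n0 by (intro mult_mono) auto
    moreover have "\<bar>of_int (vv c) - n ?h * \<omega> ?j\<bar> \<le> 1" using V[OF j, of "x ?h"] by (simp add: vv_def n_def)
    moreover have "1 \<le> n ?h" using nN1[of ?h] N1 N0 by linarith
    ultimately have "\<bar>of_int (vv c)\<bar> \<le> (\<Omega> + 1) * n ?h" by (simp add: algebra_simps)
    then have "\<bar>of_int (vv c)\<bar> * real (d ?h) \<le> ((\<Omega> + 1) * n ?h) * real (d ?h)" by (intro mult_right_mono) auto
    also have "\<dots> \<le> (\<Omega> + 1) * E" using d_nE[of ?h] \<Omega>0 by (simp add: mult.assoc mult.commute[of "n ?h"] mult_left_mono)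
    finally show ?thesis by (simp add: \<beta>_def)
  qed
  define R where "R h = RR (x h)" for h
  define P where "P h = PP (x h) h" for h
  have P: "P h \<noteq> 0" "\<And>I. I \<in> keys (P h) \<Longrightarrow> keys I \<subseteq> {h * s..<h * s + s}" "\<And>I c. I \<in> keys (P h) \<Longrightarrow> lookup I c \<le> Am"
    "sz (P h) \<le> exp (\<delta> * n h)" "of_nat q ^ R h dvd ev p 0 (P h)" for h
    using PP[of "x h" h] pW[of h] unfolding W_def P_def R_def n_def by blast+
  have r0_le': "r0 \<le> R h * jj h" if "h < 2 * m" for h using r0_le[of h] that by (simp add: R_def r_def)
  let ?ctr = "\<Sum>c<2 * m * s. of_int (vv c) * real (d (c div s)) / 2"
  let ?N = "\<Prod>c<2 * m * s. real (d (c div s)) + 1" and ?H = "\<Prod>h<2 * m. sz (P h) ^ jj h"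
  let ?Rv = "\<lambda>c. if c < 2 * m * s then R (c div s) else 0"
  obtain F where F0: "F \<noteq> 0" and F1: "\<forall>I\<in>keys F. keys I \<subseteq> {..<2 * m * s}"
    and F2: "\<forall>I\<in>keys F. \<forall>c<2 * m * s. lookup I c \<le> d (c div s)"
    and szF0: "sz F \<le> 7 * ?N\<^sup>2 * ?H\<^sup>2"
    and ctr: "\<forall>I\<in>keys F. \<bar>wt (\<lambda>c. of_int (vv c)) I - ?ctr\<bar> \<le> \<kappa>"
    and dvF: "dvq q (wt ?Rv) p (m * r0) F"
    by (rule auxiliary_polynomial[of m s Am jj d P q R p r0 "\<lambda>c. of_int (vv c)" \<beta> \<kappa>,
          OF m1 s jj_d P(1) P(2) P(3) P(5) r0_le' v\<beta> \<kappa>])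
  note F = F0 F1[rule_format] F2[rule_format]
  have szF: "sz F \<le> exp (H * E)"
  proof -
    have "?N \<le> (\<Prod>c<2 * m * s. exp (E / real N1))"
    proof (intro prod_mono conjI)
      fix c
      have "real (d (c div s)) + 1 \<le> exp (real (d (c div s)))" using exp_ge_add_one_self[of "real (d (c div s))"] by linarith
      also have "\<dots> \<le> exp (E / real N1)" using d_le[of "c div s"] ENn[of "c div s"] by simp
      finally show "real (d (c div s)) + 1 \<le> exp (E / real N1)" .
    qed auto
    also have "\<dots> = exp (real (r * s) * (E / real N1))" by (simp add: exp_of_nat_mult[symmetric] r_def)
    finally have N: "?N \<le> exp (real (r * s) * (E / real N1))" .
    have "?H \<le> (\<Prod>h<2 * m. exp (\<delta> * E))"
    proof (intro prod_mono conjI)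
      fix h
      have "sz (P h) ^ jj h \<le> exp (\<delta> * n h) ^ jj h" using P(4) by (intro power_mono) auto
      also have "\<dots> = exp (\<delta> * (real (jj h) * n h))" by (simp add: exp_of_nat_mult[symmetric] mult_ac)
      also have "\<dots> \<le> exp (\<delta> * E)" using jj_le[of h] \<delta>0 by simp
      finally show "sz (P h) ^ jj h \<le> exp (\<delta> * E)" .
    qed auto
    also have "\<dots> = exp (real (2 * m) * (\<delta> * E))" by (simp only: prod_constant card_lessThan exp_of_nat_mult)
    finally have Hh: "?H \<le> exp (real (2 * m) * (\<delta> * E))" .
    have e7: "(7::real) \<le> exp 3"
    proof -
      have "(2::real) ^ 3 \<le> exp 1 ^ 3" using exp_ge_add_one_self[of 1] by (intro power_mono) auto
      then show ?thesis by (simp add: exp_of_nat_mult[symmetric])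
    qed
    have nn': "0 \<le> ?N" "0 \<le> ?H" by (auto intro!: prod_nonneg)
    have "sz F \<le> exp 3 * (exp (real (r * s) * (E / real N1)))\<^sup>2 * (exp (real (2 * m) * (\<delta> * E)))\<^sup>2"
      by (rule order_trans[OF szF0], intro mult_mono power_mono N Hh e7 nn') auto
    also have "\<dots> = exp (3 + 2 * (real (r * s) * (E / real N1)) + 2 * (real (2 * m) * (\<delta> * E)))"
      by (simp only: exp_add exp_double)
    also have "\<dots> \<le> exp (H * E)"
    proof -
      have "2 * (real (2 * m) * (\<delta> * E)) = H / 2 * E" using m1 by (simp add: \<delta>_def)
      moreover have "3 + 2 * (real (r * s) * (E / real N1)) \<le> H / 2 * E"
      proof -
        have N1p: "0 < real N1" using N1 N0 by linarith
        have "1 \<le> E / real N1" using N1E N1p by simp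
        then have "3 + 2 * (real (r * s) * (E / real N1)) \<le> (3 + 2 * real (r * s)) * (E / real N1)"
          unfolding distrib_right mult.assoc by linarith
        also have "\<dots> \<le> (H / 2 * real N1) * (E / real N1)" using N1(2) E0 by (intro mult_right_mono) auto
        also have "\<dots> = H / 2 * E" using N1p by simp
        finally show ?thesis .
      qed
      moreover have "H / 2 * E + H / 2 * E = H * E" by simp
      ultimately show ?thesis unfolding exp_le_cancel_iff by linarith
    qed
    finally show ?thesis .
  qed
  have lookF: "real (lookup I c) \<le> E / n (c div s)" if "I \<in> keys F" "c < r * s" for I c
    using F(3)[OF that(1), of c] that(2) d_le[of "c div s"] by (simp add: r_def)
  have "\<exists>b. wt (\<lambda>c. 1 / (if c < r * s then E / n (c div s) else 1)) b < \<theta> \<and> ev p b F \<noteq> 0"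
  proof (rule zest[rule_format, of n E vv p F])
    show "N0 \<le> n h" for h using nN1[of h] N1 by linarith
    show "n h \<le> E" if "h < r" for h using nE[OF that] n0[of h] by linarith
    show "\<bar>of_int (vv (h * s + j)) - n h * \<omega> j\<bar> \<le> 1" if "j < s" for h j
      using V[OF that, of "x h"] that by (simp add: vv_def n_def)
    show "keys I \<subseteq> {..<r * s} \<and> (\<forall>c<r * s. real (lookup I c) \<le> E / n (c div s))" if "I \<in> keys F" for I
      using F(2)[OF that] lookF[OF that] by (simp add: r_def)
  qed (use gap F(1) szF in \<open>auto simp: p_def\<close>)
  then obtain b where b: "wt (\<lambda>c. 1 / (if c < r * s then E / n (c div s) else 1)) b < \<theta>" "ev p b F \<noteq> 0" by blast
  \<comment> \<open>By \<open>RR\<close>, the q-adic weight R of a variable is at most C n, and 1 /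
    (E / n) is its weight in the zero estimate; so the loss is at most C E times the index.\<close>
  have \<nu>: "real (wt ?Rv b) \<le> \<epsilon> * \<tau> * E / 16"
  proof -
    have "real (wt ?Rv b) = (\<Sum>c\<in>keys b. real (lookup b c) * real (?Rv c))" by (simp add: wt_def)
    also have "\<dots> \<le> (\<Sum>c\<in>keys b. real (lookup b c) * (C * E * (1 / (if c < r * s then E / n (c div s) else 1))))"
    proof (intro sum_mono mult_left_mono)
      fix c
      show "real (?Rv c) \<le> C * E * (1 / (if c < r * s then E / n (c div s) else 1))"
        using RR(2)[of "x (c div s)"] E0 C by (simp add: R_def n_def r_def)
    qed auto
    also have "\<dots> = C * E * wt (\<lambda>c. 1 / (if c < r * s then E / n (c div s) else 1)) b"
      unfolding wt_def sum_distrib_left by (intro sum.cong refl) simp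
    also have "\<dots> \<le> C * E * \<theta>" using b(1) C E0 by (intro mult_left_mono) auto
    also have "\<dots> = (C * \<theta>) * E" by simp
    also have "\<dots> \<le> \<epsilon> * \<tau> / 16 * E" using \<theta>(3) E0 by (intro mult_right_mono) auto
    finally show ?thesis by simp
  qed
  \<comment> \<open>The loss is paid once, whereas the divisibility comes from \<open>m\<close>
    blocks.\<close>
  define M where "M = m * r0 - wt ?Rv b"
  have M: "real m * (\<epsilon> * \<tau> * E) / 16 \<le> real M"
  proof -
    have "real m * (\<epsilon> * \<tau> * E / 8) \<le> real m * real r0" using r0_ge by (intro mult_left_mono) auto
    moreover have "1 * (\<epsilon> * \<tau> * E / 16) \<le> real m * (\<epsilon> * \<tau> * E / 16)"
      using m1 E8 by (intro mult_right_mono) auto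
    moreover have "real m * real r0 - real (wt ?Rv b) \<le> real M" unfolding M_def of_nat_mult[symmetric] by linarith
    ultimately show ?thesis using \<nu> by simp
  qed
  have "of_nat q ^ M dvd ev p b F" using dvF unfolding dvq_def M_def by blast
  then have "real q ^ (2 * M) \<le> \<bar>emb1 (ev p b F)\<bar> * \<bar>emb2 (ev p b F)\<bar>" using b(2) by (intro norm_ge_of_dvd)
  also have "\<dots> \<le> (sz F * exp (real (card {..<r * s}) * (E / real N1)))\<^sup>2 * gphi powr (2 * \<kappa>)"
  proof (rule norm_ev_le[where v = vv and ctr = ?ctr])
    show "real (lookup I c) \<le> E / real N1" if "I \<in> keys F" for I c
    proof (cases "c < r * s")
      case True
      then show ?thesis using lookF[OF that True] ENn[of "c div s"] by linarith
    next
      case False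
      then have "lookup I c = 0" using F(2)[OF that] by (auto simp: in_keys_iff r_def)
      then show ?thesis using E0 by simp
    qed
  qed (use F ctr in \<open>auto simp: p_def r_def\<close>)
  also have "\<dots> \<le> (exp E * exp E)\<^sup>2 * exp (2 * \<kappa>)"
  proof (intro mult_mono power_mono)
    have "H * E \<le> 1 * E" using H E0 by (intro mult_right_mono) auto
    then have "exp (H * E) \<le> exp E" by simp
    then show "sz F \<le> exp E" using szF by linarith
    have "real (r * s) * (E / real N1) \<le> real N1 * (E / real N1)" using N1r E0 by (intro mult_right_mono) auto
    then show "exp (real (card {..<r * s}) * (E / real N1)) \<le> exp E" using N1 N0 by simp
    have "ln gphi \<le> 1" using gphi_bounds ln_le_minus_one[of gphi] by simp
    then have "2 * \<kappa> * ln gphi \<le> 2 * \<kappa> * 1" using \<kappa>(1) by (intro mult_left_mono) auto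
    then show "gphi powr (2 * \<kappa>) \<le> exp (2 * \<kappa>)" by (simp add: powr_def)
  qed auto
  also have "\<dots> = exp (4 * E + 2 * \<kappa>)" by (simp add: power2_eq_square exp_add[symmetric])
  finally have up: "real q ^ (2 * M) \<le> exp (4 * E + 2 * \<kappa>)" .
  have "exp (real M) = exp 1 ^ M" by (simp add: exp_of_nat_mult[symmetric])
  also have "\<dots> \<le> 4 ^ M" using exp_le by (intro power_mono) auto
  also have "\<dots> = (2::real) ^ (2 * M)" by (simp add: power_mult)
  also have "\<dots> \<le> real q ^ (2 * M)" using q by (intro power_mono) auto
  also note up
  finally have "real M \<le> 4 * E + 2 * \<kappa>" by simp
  then have "real m * (\<epsilon> * \<tau> * E) / 16 \<le> 4 * E + 2 * \<kappa>" using M by linarith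
  then have "real \<mu> * real \<mu> * (\<epsilon> * \<tau>) * E \<le> (32 + 32 * \<kappa>0 * real \<mu>) * E"
    by (simp add: m_def \<kappa>_def power2_eq_square algebra_simps)
  then have "real \<mu> * real \<mu> * (\<epsilon> * \<tau>) \<le> 32 + 32 * \<kappa>0 * real \<mu>" using E0 by simp
  also have "\<dots> \<le> (32 + 32 * \<kappa>0) * real \<mu>" using \<mu>1 by (simp add: algebra_simps)
  finally have "real \<mu> * (real \<mu> * (\<epsilon> * \<tau>)) \<le> real \<mu> * (32 + 32 * \<kappa>0)" by (simp add: mult_ac)
  then have "real \<mu> * (\<epsilon> * \<tau>) \<le> 32 + 32 * \<kappa>0" using \<mu>1 by simp
  moreover have "32 + 32 * \<kappa>0 < real \<mu> * (\<epsilon> * \<tau>)" using \<mu> \<epsilon> \<tau> by (simp add: field_simps)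
  ultimately show False by linarith
qed

subsection \<open>Sums of Fibonacci numbers\<close>

text \<open>Binet's formula multiplied by \<open>ZP (- 1) 2\<close>, the square root of 5. The
  conjugate power is (-1)^n times the inverse unit power.\<close>

lemma binet_zphi: "ZP (- 1) 2 * of_nat (fib n) = upow (int n) - (- 1) ^ n * upow (- int n)"
proof (induction n rule: fib.induct)
  case 2
  then show ?case by (simp add: upow_def minus_zphi_def uminus_zphi_def times_zphi_def one_zphi_def)
next
  case (3 n)
  have e: "upow (int (Suc (Suc n))) = upow (int n) * upow 2" "upow (int (Suc n)) = upow (int n) * upow 1"
    "upow (- int (Suc (Suc n))) = upow (- int n) * upow (- 2)" "upow (- int (Suc n)) = upow (- int n) * upow (- 1)"
    by (simp_all add: upow_add[symmetric] algebra_simps)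
  have e2: "upow 2 = upow 1 + 1" "upow (- 2) = 1 - upow (- 1)"
    by (simp_all add: upow_def power2_eq_square numeral_2_eq_2 plus_zphi_def minus_zphi_def times_zphi_def one_zphi_def)
  have "ZP (- 1) 2 * of_nat (fib (Suc (Suc n))) = ZP (- 1) 2 * of_nat (fib (Suc n)) + ZP (- 1) 2 * of_nat (fib n)"
    by (simp add: distrib_left)
  also have "\<dots> = upow (int n) * (upow 1 + 1) - (- 1) ^ n * (upow (- int n) * (1 - upow (- 1)))"
    unfolding 3 e by (simp add: algebra_simps)
  also have "\<dots> = upow (int (Suc (Suc n))) - (- 1) ^ Suc (Suc n) * upow (- int (Suc (Suc n)))"
    unfolding e e2 by simp
  finally show ?case .
qed simp

lemma nrm_upow: "nrm (upow r) \<le> gphi powr \<bar>of_int r\<bar>"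
proof -
  have "gphi powr of_int r \<le> gphi powr \<bar>of_int r\<bar>" "gphi powr - of_int r \<le> gphi powr \<bar>of_int r\<bar>"
    using gphi_bounds by (intro powr_mono; simp)+
  then show ?thesis by (simp add: nrm_def emb_upow)
qed

lemma upow_neq_0 [simp]: "upow r \<noteq> 0"
proof
  assume "upow r = 0"
  then have "emb1 (upow r) = emb1 0" by simp
  then show False using gphi_pos by (simp add: emb_upow)
qed

lemma upow_sum: "upow (\<Sum>x\<in>S. f x) = (\<Prod>x\<in>S. upow (f x))"
  by (induction S rule: infinite_finite_induct) (simp_all add: upow_add)

lemma upow_power: "upow r ^ n = upow (int n * r)"
  by (induction n) (simp_all add: upow_add algebra_simps)

text \<open>Each index is an integer combination of the \<open>v j\<close> plus a small remainder.
  Binet's formula then writes the sum, up to a unit and the square root of 5, as a value at the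
  units \<open>upow (v j)\<close>; the remainders only enter the coefficients.\<close>

lemma fibonacci_sum_form:
  fixes e :: "nat \<Rightarrow> nat" and a :: "nat \<Rightarrow> nat \<Rightarrow> int" and v :: "nat \<Rightarrow> int"
  assumes a: "\<And>i j. i < k \<Longrightarrow> j < s \<Longrightarrow> \<bar>a i j\<bar> \<le> int A"
    and \<rho>: "\<And>i. i < k \<Longrightarrow> \<bar>real_of_int (int (e i) - (\<Sum>j<s. a i j * v j))\<bar> \<le> \<rho>"
    and N: "(\<Sum>i<k. fib (e i)) \<noteq> 0" "q ^ R dvd (\<Sum>i<k. fib (e i))"
  shows "\<exists>P. P \<noteq> 0 \<and> (\<forall>I\<in>keys P. keys I \<subseteq> {h * s..<h * s + s} \<and> (\<forall>c. lookup I c \<le> 2 * A)) \<and>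
    sz P \<le> 2 * real k * gphi powr \<rho> \<and>
    (\<forall>p. (\<forall>j<s. p (h * s + j) = upow (v j)) \<longrightarrow> of_nat q ^ R dvd ev p 0 P)"
proof -
  define r where "r i = int (e i) - (\<Sum>j<s. a i j * v j)" for i
  \<comment> \<open>The exponents \<open>a i j\<close> and their negatives both occur. Shifting all
    of them by \<open>A\<close> makes them natural and multiplies the value by one common
    unit.\<close>
  define mo where "mo g i = (\<Sum>j<s. Poly_Mapping.single (h * s + j) (nat (int A + g * a i j)))" for g :: int and i
  have lookup_mo: "lookup (mo g i) (h * s + j) = nat (int A + g * a i j)" if "j < s" for g i j
    using that by (simp add: mo_def lookup_sum lookup_single when_def)
  have lookup_mo_0: "lookup (mo g i) c = 0" if "c \<notin> {h * s..<h * s + s}" for g i c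
  proof -
    have "h * s + j \<noteq> c" if "j < s" for j using \<open>c \<notin> _\<close> that by auto
    then show ?thesis by (simp add: mo_def lookup_sum lookup_single when_def)
  qed
  have keys_mo: "keys (mo g i) \<subseteq> {h * s..<h * s + s}" for g i
    using lookup_mo_0 by (metis in_keys_iff subsetI)
  have mo_le: "lookup (mo g i) c \<le> 2 * A" if "\<bar>g\<bar> \<le> 1" "i < k" for g i c
  proof (cases "c \<in> {h * s..<h * s + s}")
    case True
    define j where "j = c - h * s"
    have j: "j < s" "c = h * s + j" using True by (auto simp: j_def)
    have "\<bar>g * a i j\<bar> \<le> 1 * int A" unfolding abs_mult using that a j by (intro mult_mono) auto
    then show ?thesis unfolding j(2) lookup_mo[OF j(1)] by linarith
  qed (use lookup_mo_0 in auto)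
  define P where "P = (\<Sum>i<k. Poly_Mapping.single (mo 1 i) (upow (r i)) +
    Poly_Mapping.single (mo (- 1) i) (- ((- 1) ^ e i * upow (- r i))))"
  have keysP: "\<exists>i<k. I = mo 1 i \<or> I = mo (- 1) i" if "I \<in> keys P" for I
  proof (rule ccontr)
    assume "\<not> ?thesis"
    then have "lookup P I = 0"
      by (auto simp: P_def lookup_sum lookup_add lookup_single when_def intro!: sum.neutral)
    then show False using that by (simp add: in_keys_iff)
  qed
  have szP: "sz P \<le> 2 * real k * gphi powr \<rho>"
  proof -
    have "sz P \<le> (\<Sum>i<k. sz (Poly_Mapping.single (mo 1 i) (upow (r i)) +
      Poly_Mapping.single (mo (- 1) i) (- ((- 1) ^ e i * upow (- r i)))))" unfolding P_def by (rule sz_sum)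
    also have "\<dots> \<le> (\<Sum>i<k. 2 * gphi powr \<rho>)"
    proof (rule sum_mono)
      fix i assume i: "i \<in> {..<k}"
      have "gphi powr \<bar>of_int (r i)\<bar> \<le> gphi powr \<rho>" "gphi powr \<bar>of_int (- r i)\<bar> \<le> gphi powr \<rho>"
        using \<rho>[of i] i gphi_bounds unfolding r_def by (intro powr_mono; simp)+
      then have n: "nrm (upow (r i)) \<le> gphi powr \<rho>" "nrm (upow (- r i)) \<le> gphi powr \<rho>"
        using nrm_upow[of "r i"] nrm_upow[of "- r i"] by linarith+
      have "nrm (- ((- 1) ^ e i * upow (- r i))) = nrm (upow (- r i))"
        by (cases "even (e i)") simp_all
      then show "sz (Poly_Mapping.single (mo 1 i) (upow (r i)) +
          Poly_Mapping.single (mo (- 1) i) (- ((- 1) ^ e i * upow (- r i)))) \<le> 2 * gphi powr \<rho>"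
        using sz_add[of "Poly_Mapping.single (mo 1 i) (upow (r i))" "Poly_Mapping.single (mo (- 1) i) (- ((- 1) ^ e i * upow (- r i)))"] n
        by simp
    qed
    finally show ?thesis by simp
  qed
  have evP: "ev p 0 P = upow (int A * (\<Sum>j<s. v j)) * (ZP (- 1) 2 * of_nat (\<Sum>i<k. fib (e i)))"
    if p: "\<forall>j<s. p (h * s + j) = upow (v j)" for p
  proof -
    have pw: "pw p (mo g i) = upow (int A * (\<Sum>j<s. v j)) * upow (g * (\<Sum>j<s. a i j * v j))"
      if gi: "\<bar>g\<bar> \<le> 1" "i < k" for g i
    proof -
      have "pw p (mo g i) = (\<Prod>c\<in>{h * s..<h * s + s}. p c ^ lookup (mo g i) c)"
        using keys_mo by (intro pw_superset) auto
      also have "\<dots> = (\<Prod>j<s. p (h * s + j) ^ lookup (mo g i) (h * s + j))"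
        by (rule prod.reindex_bij_witness[of _ "\<lambda>j. h * s + j" "\<lambda>c. c - h * s"]) auto
      also have "\<dots> = (\<Prod>j<s. upow ((int A + g * a i j) * v j))"
      proof (intro prod.cong refl)
        fix j assume j: "j \<in> {..<s}"
        have "\<bar>g * a i j\<bar> \<le> 1 * int A" unfolding abs_mult using gi a j by (intro mult_mono) auto
        then show "p (h * s + j) ^ lookup (mo g i) (h * s + j) = upow ((int A + g * a i j) * v j)"
          using j p by (simp add: lookup_mo upow_power)
      qed
      also have "\<dots> = upow (\<Sum>j<s. (int A + g * a i j) * v j)" by (simp add: upow_sum)
      also have "(\<Sum>j<s. (int A + g * a i j) * v j) = int A * (\<Sum>j<s. v j) + g * (\<Sum>j<s. a i j * v j)"
        by (simp add: algebra_simps sum.distrib sum_distrib_left)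
      finally show ?thesis by (simp add: upow_add)
    qed
    have "ev p 0 P = (\<Sum>i<k. upow (r i) * pw p (mo 1 i) - (- 1) ^ e i * upow (- r i) * pw p (mo (- 1) i))"
      by (simp add: P_def ev_sum ev_add)
    also have "\<dots> = (\<Sum>i<k. upow (int A * (\<Sum>j<s. v j)) * (ZP (- 1) 2 * of_nat (fib (e i))))"
    proof (intro sum.cong refl)
      fix i assume "i \<in> {..<k}"
      then have i: "i < k" by simp
      have 1: "upow (r i) * upow (\<Sum>j<s. a i j * v j) = upow (int (e i))"
        and 2: "upow (- r i) * upow (- (\<Sum>j<s. a i j * v j)) = upow (- int (e i))"
        by (simp_all add: upow_add[symmetric] r_def)
      have "upow (r i) * pw p (mo 1 i) - (- 1) ^ e i * upow (- r i) * pw p (mo (- 1) i)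
        = upow (int A * (\<Sum>j<s. v j)) * (upow (r i) * upow (\<Sum>j<s. a i j * v j)
          - (- 1) ^ e i * (upow (- r i) * upow (- (\<Sum>j<s. a i j * v j))))"
        using pw[of 1 i] pw[of "- 1" i] i by (simp add: algebra_simps)
      then show "upow (r i) * pw p (mo 1 i) - (- 1) ^ e i * upow (- r i) * pw p (mo (- 1) i)
        = upow (int A * (\<Sum>j<s. v j)) * (ZP (- 1) 2 * of_nat (fib (e i)))"
        unfolding 1 2 binet_zphi .
    qed
    finally show ?thesis by (simp add: sum_distrib_left)
  qed
  \<comment> \<open>No cancellation of monomials needs to be excluded: the value at a suitable point
    is already nonzero.\<close>
  have "P \<noteq> 0"
  proof
    assume "P = 0"
    then have "ZP (- 1) 2 * of_nat (\<Sum>i<k. fib (e i)) = 0"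
      using evP[of "\<lambda>c. upow (v (c - h * s))"] by simp
    moreover have "ZP (- 1) 2 \<noteq> 0" by (simp add: zero_zphi_def)
    ultimately show False using N(1) by (metis mult_eq_0_iff of_nat_eq_0_iff)
  qed
  moreover have "of_nat q ^ R dvd ev p 0 P" if "\<forall>j<s. p (h * s + j) = upow (v j)" for p
  proof -
    obtain y where "(\<Sum>i<k. fib (e i)) = q ^ R * y" using N(2) by (elim dvdE)
    then show ?thesis unfolding evP[OF that] by (simp only: of_nat_mult of_nat_power) simp
  qed
  ultimately show ?thesis using keysP keys_mo mo_le szP by (intro exI[of _ P]) fastforce
qed

section \<open>The limiting direction of the indices\<close>

lemma common_convergent_subsequence:
  fixes y :: "nat \<Rightarrow> nat \<Rightarrow> real"
  assumes "\<And>i t. y i t \<in> {0..1}"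
  shows "\<exists>\<sigma> \<theta>. strict_mono \<sigma> \<and> (\<forall>i<k. (\<lambda>t. y i (\<sigma> t)) \<longlonglongrightarrow> \<theta> i)"
proof (induction k)
  case 0
  then show ?case by (intro exI[of _ id]) (simp add: strict_mono_def)
next
  case (Suc k)
  then obtain \<sigma> :: "nat \<Rightarrow> nat" and \<theta> where \<sigma>: "strict_mono \<sigma>" and lim: "\<And>i. i < k \<Longrightarrow> (\<lambda>t. y i (\<sigma> t)) \<longlonglongrightarrow> \<theta> i" by blast
  have "seq_compact {0..1::real}" by (rule compact_imp_seq_compact[OF compact_Icc])
  then obtain l and \<rho> :: "nat \<Rightarrow> nat" where \<rho>: "strict_mono \<rho>" "((\<lambda>t. y k (\<sigma> t)) \<circ> \<rho>) \<longlonglongrightarrow> l"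
    using assms by (elim seq_compactE[of _ "\<lambda>t. y k (\<sigma> t)"]) auto
  have "(\<lambda>t. y i (\<sigma> (\<rho> t))) \<longlonglongrightarrow> (\<theta>(k := l)) i" if "i < Suc k" for i
  proof (cases "i = k")
    case True
    then show ?thesis using \<rho>(2) by (simp add: comp_def)
  next
    case False
    then show ?thesis using LIMSEQ_subseq_LIMSEQ[OF lim[of i] \<rho>(1)] that by (simp add: comp_def)
  qed
  moreover have "strict_mono (\<sigma> \<circ> \<rho>)" using \<sigma> \<rho>(1) by (rule strict_mono_o)
  ultimately show ?case by (intro exI[of _ "\<sigma> \<circ> \<rho>"] exI[of _ "\<theta>(k := l)"]) (simp add: comp_def)
qed

text \<open>Take a generating family with as few members as possible. A relation among them would
  allow one to be eliminated after dividing the others by its coefficient.\<close>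

lemma integer_basis:
  fixes \<theta> :: "nat \<Rightarrow> real"
  obtains s :: nat and \<omega> :: "nat \<Rightarrow> real" and a :: "nat \<Rightarrow> nat \<Rightarrow> int"
  where "\<forall>i<k. \<theta> i = (\<Sum>j<s. of_int (a i j) * \<omega> j)"
    "\<forall>J :: nat \<Rightarrow> int. (\<Sum>j<s. \<omega> j * of_int (J j)) = 0 \<longrightarrow> (\<forall>j<s. J j = 0)"
proof -
  define G where "G s \<longleftrightarrow> (\<exists>(\<omega> :: nat \<Rightarrow> real) (a :: nat \<Rightarrow> nat \<Rightarrow> int). \<forall>i<k. \<theta> i = (\<Sum>j<s. of_int (a i j) * \<omega> j))" for s
  have "\<theta> i = (\<Sum>j<k. of_int (if j = i then 1 else 0) * \<theta> j)" if "i < k" for i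
  proof -
    have "(\<Sum>j<k. of_int (if j = i then 1 else 0) * \<theta> j) = (\<Sum>j<k. if j = i then \<theta> j else 0)"
      by (intro sum.cong) auto
    then show ?thesis using that by simp
  qed
  then have "G k" unfolding G_def
    by (intro exI[of _ \<theta>] exI[of _ "\<lambda>i j. if j = i then 1 else 0"]) blast
  define s where "s = (LEAST s. G s)"
  have "G s" unfolding s_def using \<open>G k\<close> by (rule LeastI)
  have min: "\<not> G s'" if "s' < s" for s' using that unfolding s_def by (rule not_less_Least)
  obtain \<omega> a where a: "\<And>i. i < k \<Longrightarrow> \<theta> i = (\<Sum>j<s. of_int (a i j :: int) * \<omega> j)"
    using \<open>G s\<close> unfolding G_def by blast
  have "\<forall>j<s. J j = 0" if J: "(\<Sum>j<s. \<omega> j * of_int (J j)) = 0" for J :: "nat \<Rightarrow> int"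
  proof (rule ccontr)
    assume "\<not> ?thesis"
    then obtain j0 where j0: "j0 < s" "J j0 \<noteq> 0" by blast
    \<comment> \<open>Renumbers the indices below \<open>s\<close> other than \<open>j0\<close> as
      0, ..., s - 2: the last index takes the place of \<open>j0\<close>.\<close>
    define \<pi> where "\<pi> j = (if j = j0 then s - 1 else j)" for j
    have re: "(\<Sum>j<s - 1. f (\<pi> j)) = (\<Sum>j\<in>{..<s} - {j0}. f j)" for f :: "nat \<Rightarrow> real"
      by (rule sum.reindex_bij_witness[of _ "\<lambda>j. if j = s - 1 then j0 else j" \<pi>])
        (use j0 in \<open>auto simp: \<pi>_def split: if_splits\<close>)
    have \<omega>0: "\<omega> j0 * of_int (J j0) = - (\<Sum>j\<in>{..<s} - {j0}. \<omega> j * of_int (J j))"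
      using J j0 by (simp add: sum.remove[of _ j0])
    have "\<theta> i = (\<Sum>j<s - 1. of_int (a i (\<pi> j) * J j0 - a i j0 * J (\<pi> j)) * (\<omega> (\<pi> j) / of_int (J j0)))"
      if "i < k" for i
    proof -
      have "(\<Sum>j<s - 1. of_int (a i (\<pi> j) * J j0 - a i j0 * J (\<pi> j)) * (\<omega> (\<pi> j) / of_int (J j0)))
        = (\<Sum>j\<in>{..<s} - {j0}. of_int (a i j * J j0 - a i j0 * J j) * (\<omega> j / of_int (J j0)))" by (rule re)
      also have "\<dots> = (\<Sum>j\<in>{..<s} - {j0}. of_int (a i j) * \<omega> j - of_int (a i j0) / of_int (J j0) * (\<omega> j * of_int (J j)))"
        using j0 by (intro sum.cong refl) (simp add: field_simps)
      also have "\<dots> = (\<Sum>j\<in>{..<s} - {j0}. of_int (a i j) * \<omega> j) - of_int (a i j0) / of_int (J j0) * (\<Sum>j\<in>{..<s} - {j0}. \<omega> j * of_int (J j))"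
        by (simp add: sum_subtractf sum_distrib_left)
      also have "(\<Sum>j\<in>{..<s} - {j0}. \<omega> j * of_int (J j)) = - (\<omega> j0 * of_int (J j0))" using \<omega>0 by simp
      also have "(\<Sum>j\<in>{..<s} - {j0}. of_int (a i j) * \<omega> j) - of_int (a i j0) / of_int (J j0) * - (\<omega> j0 * of_int (J j0))
        = (\<Sum>j<s. of_int (a i j) * \<omega> j)" using j0 by (simp add: sum.remove[of _ j0])
      finally show ?thesis using a[OF that] by simp
    qed
    then have "G (s - 1)" unfolding G_def
      by (intro exI[of _ "\<lambda>j. \<omega> (\<pi> j) / of_int (J j0)"] exI[of _ "\<lambda>i j. a i (\<pi> j) * J j0 - a i j0 * J (\<pi> j)"]) blast
    then show False using min[of "s - 1"] j0 by simp
  qed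
  then show thesis using a that by blast
qed

lemma gphi_power_le_fib: "gphi ^ n \<le> gphi * real (fib (Suc n))"
proof (induction n rule: fib.induct)
  case 1
  then show ?case using gphi_bounds by simp
next
  case 2
  then show ?case by simp
next
  case (3 n)
  have "gphi ^ Suc (Suc n) = gphi * gphi * gphi ^ n" by simp
  also have "\<dots> = gphi ^ Suc n + gphi ^ n" unfolding gphi_sq by (simp add: algebra_simps)
  finally show ?case using 3 by (simp add: algebra_simps)
qed

lemma fib_le_two_power: "fib n \<le> 2 ^ n"
proof (induction n rule: fib.induct)
  case (3 n)
  have "(2::nat) ^ n \<le> 2 ^ Suc n" by simp
  then have "fib (Suc (Suc n)) \<le> 2 ^ Suc n + 2 ^ Suc n" using 3 by simp
  then show ?case by simp
qed simp_all

lemma fibonacci_sums_not_highly_divisible: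
  fixes \<epsilon> :: real and k q :: nat
  assumes q: "2 \<le> q" and \<epsilon>: "0 < \<epsilon>"
    and large: "\<And>n0. \<exists>(e :: nat \<Rightarrow> nat) R. n0 \<le> (\<Sum>i<k. fib (e i)) \<and> q ^ R dvd (\<Sum>i<k. fib (e i)) \<and>
      real (\<Sum>i<k. fib (e i)) powr \<epsilon> \<le> real q ^ R"
  shows False
proof -
  \<comment> \<open>The bound exceeds any sum of \<open>k\<close> Fibonacci numbers with indices at
    most \<open>t\<close>, so the largest index is forced to exceed \<open>t\<close>.\<close>
  have "\<forall>t. \<exists>(e :: nat \<Rightarrow> nat) R. k * 2 ^ t + 1 \<le> (\<Sum>i<k. fib (e i)) \<and> q ^ R dvd (\<Sum>i<k. fib (e i)) \<and>
      real (\<Sum>i<k. fib (e i)) powr \<epsilon> \<le> real q ^ R" using large by blast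
  then obtain e :: "nat \<Rightarrow> nat \<Rightarrow> nat" and R where e: "\<And>t. k * 2 ^ t + 1 \<le> (\<Sum>i<k. fib (e t i))"
    and R: "\<And>t. q ^ R t dvd (\<Sum>i<k. fib (e t i))" "\<And>t. real (\<Sum>i<k. fib (e t i)) powr \<epsilon> \<le> real q ^ R t" by metis
  define N where "N t = (\<Sum>i<k. fib (e t i))" for t
  have N1: "1 \<le> N t" for t using e[of t] by (simp add: N_def)
  have k0: "0 < k" using N1[of 0] by (cases k) (auto simp: N_def)
  define M where "M t = Max (e t ` {..<k})" for t
  have eM: "e t i \<le> M t" if "i < k" for t i unfolding M_def using that by (intro Max_ge) auto
  have "M t \<in> e t ` {..<k}" for t unfolding M_def using k0 by (intro Max_in) auto
  then have ex_top: "\<exists>i<k. e t i = M t" for t by (metis imageE lessThan_iff)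
  have N_le: "N t \<le> k * 2 ^ M t" for t
  proof -
    have "fib (e t i) \<le> 2 ^ M t" if "i < k" for i
    proof -
      have "fib (e t i) \<le> 2 ^ e t i" by (rule fib_le_two_power)
      also have "\<dots> \<le> 2 ^ M t" using eM[OF that] by (intro power_increasing) auto
      finally show ?thesis .
    qed
    then have "N t \<le> (\<Sum>i<k. 2 ^ M t)" unfolding N_def by (intro sum_mono) auto
    then show ?thesis by simp
  qed
  have M_gt: "t < M t" for t
  proof (rule ccontr)
    assume "\<not> ?thesis"
    then have "k * 2 ^ M t \<le> k * 2 ^ t" by simp
    then show False using N_le[of t] e[of t] unfolding N_def by linarith
  qed
  define y where "y i t = (if i < k then real (e t i) / real (M t) else 0)" for i t
  have y01: "y i t \<in> {0..1}" for i t
    using eM[of i t] M_gt[of t] by (auto simp: y_def field_simps)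
  obtain \<sigma> :: "nat \<Rightarrow> nat" and \<theta> where \<sigma>: "strict_mono \<sigma>" and lim: "\<And>i. i < k \<Longrightarrow> (\<lambda>t. y i (\<sigma> t)) \<longlonglongrightarrow> \<theta> i"
    using common_convergent_subsequence[of y k, OF y01] by blast
  \<comment> \<open>One normalised index is always 1. Hence the limits are not all zero, and the
    basis chosen below is not empty.\<close>
  have sum\<theta>: "1 \<le> (\<Sum>i<k. \<theta> i)"
  proof (rule LIMSEQ_le_const)
    show "(\<lambda>t. \<Sum>i<k. y i (\<sigma> t)) \<longlonglongrightarrow> (\<Sum>i<k. \<theta> i)" by (intro tendsto_sum lim) simp
    have "1 \<le> (\<Sum>i<k. y i t)" for t
    proof -
      obtain i where i: "i < k" "e t i = M t" using ex_top by blast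
      then have "y i t = 1" using M_gt[of t] by (simp add: y_def)
      moreover have "y i t \<le> (\<Sum>i<k. y i t)"
        by (rule member_le_sum[of i "{..<k}" "\<lambda>i. y i t"]) (use i y01 in auto)
      ultimately show ?thesis by simp
    qed
    then show "\<exists>n0. \<forall>t\<ge>n0. 1 \<le> (\<Sum>i<k. y i (\<sigma> t))" by blast
  qed
  obtain s :: nat and \<omega> :: "nat \<Rightarrow> real" and a :: "nat \<Rightarrow> nat \<Rightarrow> int"
    where a': "\<forall>i<k. \<theta> i = (\<Sum>j<s. of_int (a i j) * \<omega> j)"
      and indep': "\<forall>J :: nat \<Rightarrow> int. (\<Sum>j<s. \<omega> j * of_int (J j)) = 0 \<longrightarrow> (\<forall>j<s. J j = 0)"
    by (rule integer_basis)
  note a = a'[rule_format]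
  have indep: "\<forall>j<s. J j = 0" if "(\<Sum>j<s. \<omega> j * of_int (J j)) = 0" for J :: "nat \<Rightarrow> int"
    using indep' that by blast
  have s: "1 \<le> s"
  proof (rule ccontr)
    assume "\<not> 1 \<le> s"
    then have "s = 0" by simp
    then have "\<theta> i = 0" if "i < k" for i using a[OF that] by simp
    then show False using sum\<theta> by simp
  qed
  define A where "A = nat (\<Sum>i<k. \<Sum>j<s. \<bar>a i j\<bar>) + 1"
  have sumA: "(\<Sum>j<s. \<bar>a i j\<bar>) \<le> int A" if "i < k" for i
  proof -
    have "(\<Sum>j<s. \<bar>a i j\<bar>) \<le> (\<Sum>i<k. \<Sum>j<s. \<bar>a i j\<bar>)"
      by (rule member_le_sum[of i "{..<k}" "\<lambda>i. \<Sum>j<s. \<bar>a i j\<bar>"]) (use that in \<open>auto intro: sum_nonneg\<close>)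
    then show ?thesis unfolding A_def by linarith
  qed
  have aA: "\<bar>a i j\<bar> \<le> int A" if "i < k" "j < s" for i j
  proof -
    have "\<bar>a i j\<bar> \<le> (\<Sum>j<s. \<bar>a i j\<bar>)"
      by (rule member_le_sum[of j "{..<s}" "\<lambda>j. \<bar>a i j\<bar>"]) (use that in auto)
    then show ?thesis using sumA[OF that(1)] by simp
  qed
  have lng: "0 < ln gphi" "ln gphi \<le> 1" using gphi_bounds ln_le_minus_one[of gphi] by auto
  have lnq: "0 < ln (real q)" using q by simp
  \<comment> \<open>The sum is at least \<open>fib (M t)\<close>, so its logarithm is at least (M -
    2) ln gphi, which is at least half of M ln gphi once M is 4 or more.\<close>
  define \<epsilon>2 where "\<epsilon>2 = \<epsilon> * ln gphi / (2 * ln (real q))"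
  have R_ge: "\<epsilon>2 * real (M t) \<le> real (R t)" if "4 \<le> M t" for t
  proof -
    obtain i where i: "i < k" "e t i = M t" using ex_top by blast
    have "fib (e t i) \<le> N t" unfolding N_def
      by (rule member_le_sum[of i "{..<k}" "\<lambda>i. fib (e t i)"]) (use i in auto)
    then have fN: "fib (M t) \<le> N t" using i by simp
    have "gphi ^ (M t - 1) \<le> gphi * real (fib (M t))" using gphi_power_le_fib[of "M t - 1"] that by simp
    also have "\<dots> \<le> gphi * real (N t)" using fN by simp
    finally have "ln (gphi ^ (M t - 1)) \<le> ln (gphi * real (N t))" using N1[of t] by (subst ln_le_cancel_iff) auto
    then have "real (M t - 1) * ln gphi \<le> ln gphi + ln (real (N t))"
      using N1[of t] by (simp add: ln_realpow ln_mult)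
    then have "(real (M t) - 2) * ln gphi \<le> ln (real (N t))" using that by (simp add: of_nat_diff algebra_simps)
    moreover have "real (M t) / 2 * ln gphi \<le> (real (M t) - 2) * ln gphi" using that lng by (intro mult_right_mono) auto
    ultimately have "real (M t) / 2 * ln gphi \<le> ln (real (N t))" by linarith
    then have "\<epsilon> * (real (M t) / 2 * ln gphi) \<le> \<epsilon> * ln (real (N t))" using \<epsilon> by (intro mult_left_mono) auto
    also have "\<dots> = ln (real (N t) powr \<epsilon>)" using N1[of t] by (simp add: ln_powr)
    also have "\<dots> \<le> ln (real q ^ R t)" using R(2)[of t] N1[of t] q by (subst ln_le_cancel_iff) (auto simp: N_def[symmetric])
    also have "\<dots> = real (R t) * ln (real q)" using q by (simp add: ln_realpow)
    finally show ?thesis using lnq by (simp add: \<epsilon>2_def field_simps)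
  qed
  have R_le: "real (R t) \<le> (real k + 1) * real (M t)" for t
  proof -
    have "(2::nat) ^ R t \<le> q ^ R t" using q by (intro power_mono) auto
    also have "\<dots> \<le> N t" using R(1)[of t] N1[of t] by (intro dvd_imp_le) (auto simp: N_def)
    also have "\<dots> \<le> k * 2 ^ M t" by (rule N_le)
    also have "\<dots> \<le> 2 ^ k * 2 ^ M t" by (intro mult_right_mono) (auto simp: less_imp_le)
    finally have "(2::nat) ^ R t \<le> 2 ^ (k + M t)" by (simp add: power_add)
    then have "R t \<le> k + M t" by simp
    also have "\<dots> \<le> (k + 1) * M t" using M_gt[of t] by simp
    finally show ?thesis by (metis of_nat_1 of_nat_add of_nat_le_iff of_nat_mult)
  qed
  show False
  proof (rule no_highly_divisible_forms[OF indep s _ q])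
    show "1 \<le> 2 * A" by (simp add: A_def)
    show "0 < \<epsilon>2" using \<epsilon> lng lnq by (simp add: \<epsilon>2_def)
    show "0 < real k + 1" by simp
  next
    fix \<delta> :: real and n0 :: nat assume \<delta>: "0 < \<delta>"
    obtain T :: nat where T: "4 * real A / \<delta> + 4 * ln (2 * real k) / \<delta> < real T" using reals_Archimedean2 by blast
    have T1: "4 * real A / \<delta> < real T" "4 * ln (2 * real k) / \<delta> < real T"
    proof -
      have "0 \<le> 4 * real A / \<delta>" "0 \<le> 4 * ln (2 * real k) / \<delta>" using \<delta> k0 by auto
      then show "4 * real A / \<delta> < real T" "4 * ln (2 * real k) / \<delta> < real T" using T by linarith+
    qed
    have "eventually (\<lambda>t. \<forall>i\<in>{..<k}. \<bar>y i (\<sigma> t) - \<theta> i\<bar> < \<delta> / 4) sequentially"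
    proof (rule eventually_ball_finite; safe)
      fix i assume "i < k"
      then show "eventually (\<lambda>t. \<bar>y i (\<sigma> t) - \<theta> i\<bar> < \<delta> / 4) sequentially"
        using tendstoD[OF lim, of i "\<delta> / 4"] \<delta> by (simp add: dist_real_def)
    qed
    then have "eventually (\<lambda>t. (\<forall>i\<in>{..<k}. \<bar>y i (\<sigma> t) - \<theta> i\<bar> < \<delta> / 4) \<and> T + n0 + 4 \<le> t) sequentially"
      using eventually_ge_at_top by (rule eventually_conj)
    then obtain t where t: "\<forall>i<k. \<bar>y i (\<sigma> t) - \<theta> i\<bar> < \<delta> / 4" "T + n0 + 4 \<le> t"
      unfolding eventually_sequentially by (metis lessThan_iff order_refl)
    define n where "n = M (\<sigma> t)"
    have nt: "t < n" using M_gt[of "\<sigma> t"] seq_suble[OF \<sigma>, of t] by (simp add: n_def)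
    have n: "real T \<le> real n" "n0 \<le> n" "4 \<le> n" using nt t(2) by auto
    \<comment> \<open>Rounding keeps the units integral powers while the limits \<theta> stay exact
      combinations of \<omega>.\<close>
    define v where "v j = \<lfloor>real n * \<omega> j\<rfloor>" for j
    have v: "\<bar>of_int (v j) - real n * \<omega> j\<bar> \<le> 1" for j unfolding v_def by linarith
    have nA: "real A \<le> \<delta> / 4 * real n" "ln (2 * real k) \<le> \<delta> / 4 * real n"
    proof -
      have "4 * real A / \<delta> \<le> real n" "4 * ln (2 * real k) / \<delta> \<le> real n" using T1 n(1) by linarith+
      then show "real A \<le> \<delta> / 4 * real n" "ln (2 * real k) \<le> \<delta> / 4 * real n" using \<delta> by (simp_all add: field_simps)
    qed
    \<comment> \<open>Two errors, each at most \<delta> n / 4: the convergence of the normalised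
      indices, and the rounding of \<open>v\<close>, which costs at most \<open>A\<close>.\<close>
    have rest: "\<bar>real_of_int (int (e (\<sigma> t) i) - (\<Sum>j<s. a i j * v j))\<bar> \<le> \<delta> / 2 * real n" if i: "i < k" for i
    proof -
      have "real_of_int (int (e (\<sigma> t) i) - (\<Sum>j<s. a i j * v j))
        = (real (e (\<sigma> t) i) - real n * \<theta> i) - (\<Sum>j<s. of_int (a i j) * (of_int (v j) - real n * \<omega> j))"
        by (simp add: a[OF i] right_diff_distrib sum_subtractf sum_distrib_left mult_ac)
      moreover have "\<bar>real (e (\<sigma> t) i) - real n * \<theta> i\<bar> \<le> \<delta> / 4 * real n"
      proof -
        have "real (e (\<sigma> t) i) = real n * y i (\<sigma> t)" using i n(3) by (simp add: y_def n_def[symmetric])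
        then have "\<bar>real (e (\<sigma> t) i) - real n * \<theta> i\<bar> = real n * \<bar>y i (\<sigma> t) - \<theta> i\<bar>"
          by (simp add: right_diff_distrib[symmetric] abs_mult)
        also have "\<dots> \<le> real n * (\<delta> / 4)" using t(1) i by (intro mult_left_mono) (auto simp: less_imp_le)
        finally show ?thesis by (simp add: mult.commute)
      qed
      moreover have "\<bar>\<Sum>j<s. of_int (a i j) * (of_int (v j) - real n * \<omega> j)\<bar> \<le> real A"
      proof -
        have "\<bar>\<Sum>j<s. of_int (a i j) * (of_int (v j) - real n * \<omega> j)\<bar> \<le> (\<Sum>j<s. \<bar>of_int (a i j)\<bar> * 1)"
          by (rule order_trans[OF sum_abs], rule sum_mono, unfold abs_mult, intro mult_left_mono v) auto
        also have "\<dots> = real_of_int (\<Sum>j<s. \<bar>a i j\<bar>)" by simp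
        also have "\<dots> \<le> real_of_int (int A)" using sumA[OF i] by (simp only: of_int_le_iff)
        finally show ?thesis by simp
      qed
      ultimately show ?thesis using nA(1) by linarith
    qed
    have "\<exists>P. P \<noteq> 0 \<and> (\<forall>I\<in>keys P. keys I \<subseteq> {h * s..<h * s + s} \<and> (\<forall>c. lookup I c \<le> 2 * A)) \<and>
        sz P \<le> exp (\<delta> * real n) \<and>
        (\<forall>p. (\<forall>j<s. p (h * s + j) = upow (v j)) \<longrightarrow> of_nat q ^ R (\<sigma> t) dvd ev p 0 P)" for h
    proof -
      have "2 * real k * gphi powr (\<delta> / 2 * real n) = exp (ln (2 * real k) + \<delta> / 2 * real n * ln gphi)"
        using k0 by (simp add: exp_add powr_def)
      also have "\<dots> \<le> exp (\<delta> * real n)"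
      proof -
        have "\<delta> / 2 * real n * ln gphi \<le> \<delta> / 2 * real n * 1" using lng \<delta> by (intro mult_left_mono) auto
        moreover have "0 \<le> \<delta> * real n" using \<delta> by simp
        ultimately show ?thesis unfolding exp_le_cancel_iff using nA(2) by (simp add: field_simps)
      qed
      finally have "2 * real k * gphi powr (\<delta> / 2 * real n) \<le> exp (\<delta> * real n)" .
      note sz_le = this
      have nz: "(\<Sum>i<k. fib (e (\<sigma> t) i)) \<noteq> 0" using N1[of "\<sigma> t"] unfolding N_def by linarith
      have "\<exists>P. P \<noteq> 0 \<and> (\<forall>I\<in>keys P. keys I \<subseteq> {h * s..<h * s + s} \<and> (\<forall>c. lookup I c \<le> 2 * A)) \<and>
        sz P \<le> 2 * real k * gphi powr (\<delta> / 2 * real n) \<and>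
        (\<forall>p. (\<forall>j<s. p (h * s + j) = upow (v j)) \<longrightarrow> of_nat q ^ R (\<sigma> t) dvd ev p 0 P)"
        by (rule fibonacci_sum_form[OF aA rest nz R(1)])
      then obtain P where P: "P \<noteq> 0" "\<forall>I\<in>keys P. keys I \<subseteq> {h * s..<h * s + s} \<and> (\<forall>c. lookup I c \<le> 2 * A)"
        "sz P \<le> 2 * real k * gphi powr (\<delta> / 2 * real n)"
        "\<forall>p. (\<forall>j<s. p (h * s + j) = upow (v j)) \<longrightarrow> of_nat q ^ R (\<sigma> t) dvd ev p 0 P" by blast
      then show ?thesis using order_trans[OF P(3) sz_le] by blast
    qed
    note forms = this
    show "\<exists>n v Ra. n0 \<le> n \<and> (\<forall>j<s. \<bar>of_int (v j) - real n * \<omega> j\<bar> \<le> 1) \<and>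
      \<epsilon>2 * real n \<le> real Ra \<and> real Ra \<le> (real k + 1) * real n \<and>
      (\<forall>h. \<exists>P. P \<noteq> 0 \<and> (\<forall>I\<in>keys P. keys I \<subseteq> {h * s..<h * s + s} \<and> (\<forall>c. lookup I c \<le> 2 * A)) \<and>
        sz P \<le> exp (\<delta> * real n) \<and>
        (\<forall>p. (\<forall>j<s. p (h * s + j) = upow (v j)) \<longrightarrow> of_nat q ^ Ra dvd ev p 0 P))"
    proof (rule exI[of _ n], rule exI[of _ v], rule exI[of _ "R (\<sigma> t)"], intro conjI allI impI v forms n(2))
      show "\<epsilon>2 * real n \<le> real (R (\<sigma> t))" using R_ge n(3) unfolding n_def by blast
      show "real (R (\<sigma> t)) \<le> (real k + 1) * real n" using R_le unfolding n_def by blast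
    qed
  qed
qed

lemma few_digits_eq_sum_fib:
  assumes "N \<in> few_digits k"
  shows "\<exists>e :: nat \<Rightarrow> nat. N = (\<Sum>i<k. fib (e i))"
proof -
  obtain I where I: "finite I" "N = (\<Sum>j\<in>I. fib j)" "card I \<le> k"
    using assms unfolding few_digits_def zeckendorf_rep_def by blast
  obtain f where f: "bij_betw f {0..<card I} I" using ex_bij_betw_nat_finite[OF I(1)] by blast
  have "N = (\<Sum>i<card I. fib (f i))"
    unfolding I(2) using sum.reindex_bij_betw[OF f, of fib] by (simp add: lessThan_atLeast0)
  \<comment> \<open>Missing summands are filled up with index 0, since
    \<open>fib 0 = 0\<close>.\<close>
  also have "\<dots> = (\<Sum>i<k. fib (if i < card I then f i else 0))"
    using I(3) by (intro sum.mono_neutral_cong_left) auto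
  finally show ?thesis by (rule exI[of _ "\<lambda>i. if i < card I then f i else 0"])
qed

theorem theorem1p1:
  fixes k :: nat and \<epsilon> :: real and S :: "nat set"
  assumes "1 \<le> k" and "0 < \<epsilon>"
    and "finite S" and "S \<noteq> {}" and "\<And>q. q \<in> S \<Longrightarrow> prime q"
  shows "\<exists>j\<^sub>0. \<forall>j\<ge>j\<^sub>0. real (S_part S (zeckendorf_seq k j)) < real (zeckendorf_seq k j) powr \<epsilon>"
proof -
  \<comment> \<open>Sharing the exponent equally among the primes reduces the claim to one prime at
    a time.\<close>
  let ?\<epsilon> = "\<epsilon> / real (card S)"
  have card: "0 < card S" using assms(3,4) by (simp add: card_gt_0_iff)
  have "\<exists>b. \<forall>N\<ge>b. N \<in> few_digits k \<longrightarrow> real q ^ multiplicity q N < real N powr ?\<epsilon>" if q: "q \<in> S" for q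
  proof (rule ccontr)
    assume neg: "\<not> ?thesis"
    show False
    proof (rule fibonacci_sums_not_highly_divisible[of q ?\<epsilon> k])
      show "2 \<le> q" using assms(5)[OF q] by (rule prime_ge_2_nat)
      show "0 < ?\<epsilon>" using card assms(2) by simp
      fix n0
      obtain N where N: "n0 \<le> N" "N \<in> few_digits k" "real N powr ?\<epsilon> \<le> real q ^ multiplicity q N"
        using neg by (metis not_le)
      obtain e :: "nat \<Rightarrow> nat" where e: "N = (\<Sum>i<k. fib (e i))" using few_digits_eq_sum_fib[OF N(2)] by blast
      show "\<exists>(e :: nat \<Rightarrow> nat) R. n0 \<le> (\<Sum>i<k. fib (e i)) \<and> q ^ R dvd (\<Sum>i<k. fib (e i)) \<and>
        real (\<Sum>i<k. fib (e i)) powr ?\<epsilon> \<le> real q ^ R"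
        by (intro exI[of _ e] exI[of _ "multiplicity q N"]) (use N multiplicity_dvd[of q N] in \<open>simp add: e[symmetric]\<close>)
    qed
  qed
  then obtain b where b: "\<And>q N. q \<in> S \<Longrightarrow> b q \<le> N \<Longrightarrow> N \<in> few_digits k \<Longrightarrow>
      real q ^ multiplicity q N < real N powr ?\<epsilon>" by metis
  define B where "B = (\<Sum>q\<in>S. b q)"
  have B: "b q \<le> B" if "q \<in> S" for q
    unfolding B_def by (rule member_le_sum) (use that assms(3) in auto)
  have inf: "infinite (few_digits k)" using assms(1) by (rule infinite_few_digits)
  show ?thesis
  \<comment> \<open>The extra 1 compensates for \<open>zeckendorf_seq\<close> being indexed from 1:
    its value at \<open>j\<close> is at least \<open>j - 1\<close>.\<close>
  proof (intro exI[of _ "B + 1"] allI impI)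
    fix j assume j: "B + 1 \<le> j"
    define N where "N = zeckendorf_seq k j"
    have N: "N \<in> few_digits k" unfolding N_def zeckendorf_seq_def using inf by (rule enumerate_in_set)
    have "j - 1 \<le> N" unfolding N_def zeckendorf_seq_def using inf by (rule le_enumerate)
    then have BN: "B \<le> N" using j by simp
    have N0: "0 < N" using N by (simp add: few_digits_def)
    have "real (S_part S N) = (\<Prod>q\<in>S. real q ^ multiplicity q N)" by (simp add: S_part_def)
    also have "\<dots> < (\<Prod>q\<in>S. real N powr ?\<epsilon>)"
    proof -
      have lt: "real q ^ multiplicity q N < real N powr ?\<epsilon>" if "q \<in> S" for q
        using b[OF that _ N] B[OF that] BN by simp
      obtain q where "q \<in> S" using assms(4) by blast
      then show ?thesis using lt assms(3) N0 by (intro prod_mono_strict[of q]) (auto intro: less_imp_le)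
    qed
    also have "\<dots> = real N powr \<epsilon>" using card N0 by (simp add: powr_power)
    finally show "real (S_part S (zeckendorf_seq k j)) < real (zeckendorf_seq k j) powr \<epsilon>" by (simp add: N_def)
  qed
qed

end
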